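(* Let $T>0$, $H\in(0,1)$, and let $B^{(1)},B^{(2)}$ be two independent fractional Brownian motions with Hurst index $H$. For $\varepsilon>0$ set \[ \breve G_\varepsilon=\int_0^T\Big(\int_0^u\frac{B^{(1)}_{v+\varepsilon}-B^{(1)}_v}{\varepsilon}\,\mathrm dv\Big)\frac{B^{(2)}_{u+\varepsilon}-B^{(2)}_u}{\varepsilon}\,\mathrm du . \] (a) If $H<\tfrac14$, then as $\varepsilon\to0$, \[ \Big(\big(B^{(1)}_t,B^{(2)}_t\big)_{t\in[0,T]},\ \varepsilon^{1/2-2H}\breve G_\varepsilon\Big)\xrightarrow{\ \mathrm{Law}\ }\Big(\big(B^{(1)}_t,B^{(2)}_t\big)_{t\in[0,T]},\ N\Big), \] where $N\sim\mathscr N(0,T\breve\sigma_H^2)$ is independent of $(B^{(1)},B^{(2)})$ and \[ \breve\sigma_H^2=\frac{1}{4(2H+1)(2H+2)}\int_{\mathbb R}\big(|x+1|^{2H}+|x-1|^{2H}-2|x|^{2H}\big)\big(2|x|^{2H+2}-|x+1|^{2H+2}-|x-1|^{2H+2}\big)\,\mathrm dx . \] (b) If $H=\tfrac14$, then as $\varepsilon\to0$, \[ \Big(\big(B^{(1)}_t,B^{(2)}_t\big)_{t\in[0,T]},\ \frac{\breve G_\varepsilon}{\sqrt{\log(1/\varepsilon)}}\Big)\xrightarrow{\ \mathrm{Law}\ }\Big(\big(B^{(1)}_t,B^{(2)}_t\big)_{t\in[0,T]},\ N\Big), \] where $N\sim\mathscr N(0,T/8)$ is independent of $(B^{(1)}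,B^{(2)})$.
   Context: A fractional Brownian motion with Hurst index $H\in(0,1)$ is a centered Gaussian process $(B_t)_{t\ge0}$ with covariance $E(B_tB_s)=\tfrac12(t^{2H}+s^{2H}-|t-s|^{2H})$ (taken with continuous paths). Convergence in law is of random elements of $C([0,T];\mathbb R^2)\times\mathbb R$. *)

theory Defs
  imports "HOL-Probability.Probability"
begin

text \<open>Law of sqrt(v) * Z, Z standard normal; this is N(0,v) for v >= 0 (and the point mass at 0 for v = 0).\<close>
definition gauss_law :: "real \<Rightarrow> real measure" where
  "gauss_law v = distr (density lborel std_normal_density) borel (\<lambda>z. sqrt v * z)"

definition fBm_cov :: "real \<Rightarrow> real \<Rightarrow> real \<Rightarrow> real" where
  "fBm_cov H t s = (t powr (2*H) + s powr (2*H) - \<bar>t - s\<bar> powr (2*H)) / 2"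

definition is_fBm :: "'a measure \<Rightarrow> real \<Rightarrow> (real \<Rightarrow> 'a \<Rightarrow> real) \<Rightarrow> bool" where
  "is_fBm M H B \<longleftrightarrow> prob_space M \<and>
     (\<forall>t\<ge>0. B t \<in> borel_measurable M) \<and>
     (\<forall>\<omega>\<in>space M. continuous_on {0..} (\<lambda>t. B t \<omega>)) \<and>
     (\<forall>(I::real set) (c::real \<Rightarrow> real). finite I \<and> I \<subseteq> {0..} \<longrightarrow>
        distr M borel (\<lambda>\<omega>. \<Sum>t\<in>I. c t * B t \<omega>)
          = gauss_law (\<Sum>t\<in>I. \<Sum>s\<in>I. c t * c s * fBm_cov H t s))"

text \<open>F is a bounded continuous functional on C([0,T];R^2) x R (sup-norm on the path part);
  its values at non-continuous paths are irrelevant.\<close>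
definition bcont_CT_R :: "real \<Rightarrow> ((real \<Rightarrow> real \<times> real) \<times> real \<Rightarrow> real) \<Rightarrow> bool" where
  "bcont_CT_R T F \<longleftrightarrow>
     (\<exists>K. \<forall>f x. continuous_on {0..T} f \<longrightarrow> \<bar>F (f, x)\<bar> \<le> K) \<and>
     (\<forall>f x e. continuous_on {0..T} f \<and> e > 0 \<longrightarrow>
        (\<exists>d>0. \<forall>g y. continuous_on {0..T} g \<and> (\<forall>t\<in>{0..T}. dist (g t) (f t) < d) \<and> \<bar>y - x\<bar> < d
                 \<longrightarrow> \<bar>F (g, y) - F (f, x)\<bar> < e))"

text \<open>Convergence in law, as eps -> 0+, of the random elements X eps of C([0,T];R^2) x R
  to (P, N), where N has law nu and is independent of the random path P.\<close>
definition conv_law_indep ::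
  "'a measure \<Rightarrow> real \<Rightarrow> (real \<Rightarrow> 'a \<Rightarrow> (real \<Rightarrow> real \<times> real) \<times> real)
     \<Rightarrow> ('a \<Rightarrow> real \<Rightarrow> real \<times> real) \<Rightarrow> real measure \<Rightarrow> bool" where
  "conv_law_indep M T X P \<nu> \<longleftrightarrow>
     (\<forall>F. bcont_CT_R T F \<longrightarrow>
        ((\<lambda>\<epsilon>. \<integral>\<omega>. F (X \<epsilon> \<omega>) \<partial>M) \<longlongrightarrow> (\<integral>\<omega>. (\<integral>x. F (P \<omega>, x) \<partial>\<nu>) \<partial>M)) (at_right 0))"

definition G_breve :: "(real \<Rightarrow> 'a \<Rightarrow> real) \<Rightarrow> (real \<Rightarrow> 'a \<Rightarrow> real) \<Rightarrow> real \<Rightarrow> real \<Rightarrow> 'a \<Rightarrow> real" where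
  "G_breve B1 B2 T \<epsilon> \<omega> =
     integral {0..T} (\<lambda>u. integral {0..u} (\<lambda>v. (B1 (v + \<epsilon>) \<omega> - B1 v \<omega>) / \<epsilon>)
                          * ((B2 (u + \<epsilon>) \<omega> - B2 u \<omega>) / \<epsilon>))"

definition sigma_breve_sq :: "real \<Rightarrow> real" where
  "sigma_breve_sq H = 1 / (4 * (2*H + 1) * (2*H + 2)) *
     (\<integral>x. (\<bar>x + 1\<bar> powr (2*H) + \<bar>x - 1\<bar> powr (2*H) - 2 * \<bar>x\<bar> powr (2*H)) *
          (2 * \<bar>x\<bar> powr (2*H + 2) - \<bar>x + 1\<bar> powr (2*H + 2) - \<bar>x - 1\<bar> powr (2*H + 2)) \<partial>lborel)"

end

theory Submission
  imports Defs "HOL-Real_Asymp.Real_Asymp"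
begin

text \<open>
  Write \<open>X\<^sub>e\<close> for the normalized functional. By a theorem of Renyi, convergence in law of \<open>X\<^sub>e\<close>
  jointly with, and independently of, everything else on the probability space follows once
  \<open>E cos(a X\<^sub>e + b X\<^sub>d)\<close> factorizes asymptotically as \<open>e \<rightarrow> 0\<close> for each fixed \<open>d\<close>; no finite-dimensional
  distributions of the motions enter. Given the first motion, \<open>X\<^sub>e\<close> is a Gaussian linear functional of
  the second, so these expectations are governed by conditional covariances, which are quadratic in the
  moving averages \<open>(1/e) \<integral>\<^sub>u\<^sup>u\<^sup>+\<^sup>e B\<^sub>a da\<close> of the first motion. The off-diagonal ones stay bounded, so the
  normalization kills them. The diagonal one splits into a bounded part and a weighted integral of squared increments,
  which concentrates at its mean because increments decorrelate; the mean is computed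
  by scaling. At \<open>H = 1/4\<close> its density decays like \<open>1/x\<close>, whence the logarithm.
\<close>

text \<open>The threshold 1/4 belongs to the mean alone: with \<open>h = e*x\<close> its density is
  bounded by a multiple of \<open>|x|^(4*H-2)\<close>, which is integrable at infinity exactly for
  \<open>H < 1/4\<close>. The squared covariances behind the fluctuations decay at least like
  \<open>1/x^2\<close> also at 1/4, so one argument serves both regimes. The quadratic form resists
  direct estimates, since its kernel has size \<open>e^(2*H-2)\<close> near the diagonal; bounds
  uniform in \<open>e\<close> come from the kernel being a difference quotient of
  \<open>|z|^(2*H)\<close>, whose integrals leave boundary terms. Polarization brings a factor -1/2
  into the variance; the negative correlation of distant increments for \<open>H < 1/2\<close> makes
  up for the sign. The variance of averaged increments contains a constant that
  \<open>sigma_breve_sq\<close> does not show: it multiplies an integral equal to 0. On path space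
  the path itself does not vary with \<open>e\<close>, so approximation by countably many polynomial
  paths takes the place of tightness and also yields measurability.\<close>

lemma measurable_compose_caratheodory:
  fixes f :: "'a \<Rightarrow> real \<Rightarrow> real"
  assumes meas: "\<And>x. (\<lambda>w. f w x) \<in> borel_measurable N"
    and cont: "\<And>w. w \<in> space N \<Longrightarrow> continuous_on UNIV (f w)"
    and g: "g \<in> measurable K N" and X [measurable]: "X \<in> borel_measurable K"
  shows "(\<lambda>z. f (g z) (X z)) \<in> borel_measurable K"
proof (rule borel_measurable_LIMSEQ_real)
  \<comment> \<open>Rounding down to multiples of \<open>1 / Suc n\<close> leaves countably many
    values of the second argument, each with a measurable section; continuity in that argument
    carries measurability to the limit.\<close>
  define r where "r n x = real_of_int \<lfloor>real (Suc n) * x\<rfloor> / real (Suc n)" for n x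
  show "(\<lambda>z. f (g z) (r n (X z))) \<in> borel_measurable K" for n
    unfolding r_def
    by (rule measurable_compose_countable[where f = "\<lambda>i z. f (g z) (real_of_int i / real (Suc n))"])
       (auto intro: measurable_compose[OF g meas])
  fix z assume "z \<in> space K"
  then have c: "continuous_on UNIV (f (g z))"
    using cont measurable_space[OF g] by auto
  have "(\<lambda>n. r n (X z)) \<longlonglongrightarrow> X z"
  proof (rule tendsto_sandwich[of "\<lambda>n. X z - 1 / real (Suc n)" _ _ "\<lambda>n. X z"])
    have "real (Suc n) * X z - 1 \<le> real_of_int \<lfloor>real (Suc n) * X z\<rfloor>" for n by linarith
    then have "(real (Suc n) * X z - 1) / real (Suc n) \<le> r n (X z)" for n
      unfolding r_def by (intro divide_right_mono) auto
    then show "\<forall>\<^sub>F n in sequentially. X z - 1 / real (Suc n) \<le> r n (X z)"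
      by (simp add: field_simps)
    have "r n (X z) \<le> (real (Suc n) * X z) / real (Suc n)" for n
      unfolding r_def by (intro divide_right_mono) auto
    then show "\<forall>\<^sub>F n in sequentially. r n (X z) \<le> X z" by simp
    show "(\<lambda>n. X z - 1 / real (Suc n)) \<longlonglongrightarrow> X z" by real_asymp
  qed simp
  then show "(\<lambda>n. f (g z) (r n (X z))) \<longlonglongrightarrow> f (g z) (X z)"
    using c by (auto simp: continuous_on_eq_continuous_at intro: isCont_tendsto_compose)
qed

subsection \<open>Mixing convergence\<close>

context prob_space
begin

text \<open>If the claim failed, signed sums of well-chosen \<^term>\<open>f n\<close> would have norm of order
  \<open>\<surd>N\<close> but inner product of order \<open>N\<close> with \<^term>\<open>g\<close>.\<close>

lemma weakly_null_if_asymptotically_orthogonal: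
  fixes f :: "nat \<Rightarrow> 'a \<Rightarrow> real"
  assumes mf [measurable]: "\<And>n. f n \<in> borel_measurable M" and mg [measurable]: "g \<in> borel_measurable M"
    and bf: "\<And>n w. \<bar>f n w\<bar> \<le> C" and bg: "\<And>w. \<bar>g w\<bar> \<le> D"
    and orth: "\<And>k. (\<lambda>n. expectation (\<lambda>w. f n w * f k w)) \<longlonglongrightarrow> 0"
  shows "(\<lambda>n. expectation (\<lambda>w. f n w * g w)) \<longlonglongrightarrow> 0"
proof (rule ccontr)
  assume "\<not> ?thesis"
  then obtain c where c: "c > 0" and freq: "\<And>N. \<exists>n\<ge>N. \<bar>expectation (\<lambda>w. f n w * g w)\<bar> \<ge> c"
    unfolding LIMSEQ_iff by (auto simp: not_less)
  have int: "integrable M X" if "X \<in> borel_measurable M" "\<exists>K. \<forall>w. \<bar>X w\<bar> \<le> K" for X :: "'a \<Rightarrow> real"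
  proof -
    from that obtain K where "\<And>w. \<bar>X w\<bar> \<le> K" by auto
    then show ?thesis using that by (intro integrable_const_bound[where B=K]) auto
  qed
  have prod: "integrable M (\<lambda>w. X w * Y w)"
    if "X \<in> borel_measurable M" "\<exists>K. \<forall>w. \<bar>X w\<bar> \<le> K" "Y \<in> borel_measurable M" "\<exists>K. \<forall>w. \<bar>Y w\<bar> \<le> K"
    for X Y :: "'a \<Rightarrow> real"
  proof (rule int)
    from that obtain K L where KL: "\<And>w. \<bar>X w\<bar> \<le> K" "\<And>w. \<bar>Y w\<bar> \<le> L" by auto
    have "\<bar>X w * Y w\<bar> \<le> K * L" for w
      unfolding abs_mult using KL(1)[of w] KL(2)[of w] by (intro mult_mono) auto
    then show "\<exists>K. \<forall>w. \<bar>X w * Y w\<bar> \<le> K" by blast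
  qed (use that in auto)
  have bf': "\<exists>K. \<forall>w. \<bar>f n w\<bar> \<le> K" for n using bf by blast
  have bg': "\<exists>K. \<forall>w. \<bar>g w\<bar> \<le> K" using bg by blast
  \<comment> \<open>Budget of one summand in the squared norm: \<open>C\<^sup>2\<close> for its own
    square, 1 for its cross term with the sum built so far.\<close>
  let ?B = "C\<^sup>2 + 1"
  \<comment> \<open>Greedy construction of a signed sum \<open>S\<close> of \<open>N\<close> terms.
    That the sequence is weakly null against \<open>S\<close> is part of the induction: it supplies
    a further term almost orthogonal to \<open>S\<close>.\<close>
  have ex: "\<exists>S. S \<in> borel_measurable M \<and> (\<exists>K. \<forall>w. \<bar>S w\<bar> \<le> K) \<and>
      (\<lambda>n. expectation (\<lambda>w. f n w * S w)) \<longlonglongrightarrow> 0 \<and>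
      expectation (\<lambda>w. S w * S w) \<le> real N * ?B \<and> expectation (\<lambda>w. S w * g w) \<ge> real N * c" for N
  proof (induction N)
    case 0
    show ?case by (intro exI[of _ "\<lambda>_. 0"]) auto
  next
    case (Suc N)
    then obtain S K where mS [measurable]: "S \<in> borel_measurable M" and K: "\<And>w. \<bar>S w\<bar> \<le> K"
      and lim: "(\<lambda>n. expectation (\<lambda>w. f n w * S w)) \<longlonglongrightarrow> 0"
      and SS: "expectation (\<lambda>w. S w * S w) \<le> real N * ?B"
      and Sg: "expectation (\<lambda>w. S w * g w) \<ge> real N * c" by auto
    have bS: "\<exists>K. \<forall>w. \<bar>S w\<bar> \<le> K" using K by blast
    obtain n0 where n0: "\<And>n. n \<ge> n0 \<Longrightarrow> \<bar>expectation (\<lambda>w. f n w * S w)\<bar> < 1/2"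
      using LIMSEQ_D[OF lim, of "1/2"] by auto
    obtain n where n: "n \<ge> n0" "\<bar>expectation (\<lambda>w. f n w * g w)\<bar> \<ge> c" using freq by blast
    define \<theta> where "\<theta> = sgn (expectation (\<lambda>w. f n w * g w))"
    have \<theta>: "\<bar>\<theta>\<bar> \<le> 1" "\<theta> * expectation (\<lambda>w. f n w * g w) \<ge> c"
      using n(2) by (auto simp: \<theta>_def sgn_if)
    let ?S = "\<lambda>w. S w + \<theta> * f n w"
    have ff: "expectation (\<lambda>w. f n w * f n w) \<le> C\<^sup>2"
    proof -
      have "f n w * f n w \<le> C\<^sup>2" for w
        using bf[of n w] by (metis abs_ge_zero power2_abs power2_eq_square power_mono)
      then have "expectation (\<lambda>w. f n w * f n w) \<le> expectation (\<lambda>w. C\<^sup>2)"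
        by (intro integral_mono prod mf bf') auto
      then show ?thesis by (simp add: prob_space)
    qed
    have \<theta>2: "\<theta> * \<theta> \<le> 1" using \<theta>(1) by (metis abs_le_square_iff abs_one one_power2 power2_eq_square)
    have "expectation (\<lambda>w. ?S w * ?S w) = expectation (\<lambda>w. S w * S w + 2 * \<theta> * (f n w * S w) + (\<theta> * \<theta>) * (f n w * f n w))"
      by (intro Bochner_Integration.integral_cong) (auto simp: algebra_simps)
    also have "\<dots> = expectation (\<lambda>w. S w * S w) + 2 * \<theta> * expectation (\<lambda>w. f n w * S w)
        + (\<theta> * \<theta>) * expectation (\<lambda>w. f n w * f n w)"
      by (subst Bochner_Integration.integral_add | intro prod mS bS mf bf' Bochner_Integration.integrable_add integrable_mult_right)+ simp
    also have "\<dots> \<le> real N * ?B + 1 + C\<^sup>2"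
    proof -
      have "2 * \<theta> * expectation (\<lambda>w. f n w * S w) \<le> \<bar>2 * \<theta> * expectation (\<lambda>w. f n w * S w)\<bar>" by simp
      also have "\<dots> = 2 * (\<bar>\<theta>\<bar> * \<bar>expectation (\<lambda>w. f n w * S w)\<bar>)" by (simp add: abs_mult)
      also have "\<dots> \<le> 2 * (1 * (1/2))" using \<theta>(1) n0[OF n(1)] by (intro mult_left_mono mult_mono) auto
      finally have "2 * \<theta> * expectation (\<lambda>w. f n w * S w) \<le> 1" by simp
      moreover have "(\<theta> * \<theta>) * expectation (\<lambda>w. f n w * f n w) \<le> 1 * C\<^sup>2"
        using \<theta>2 ff by (intro mult_mono) (auto intro!: integral_nonneg_AE)
      ultimately show ?thesis using SS by simp
    qed
    also have "\<dots> = real (Suc N) * ?B" by (simp add: algebra_simps)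
    finally have 1: "expectation (\<lambda>w. ?S w * ?S w) \<le> real (Suc N) * ?B" .
    have "expectation (\<lambda>w. ?S w * g w) = expectation (\<lambda>w. S w * g w + \<theta> * (f n w * g w))"
      by (intro Bochner_Integration.integral_cong) (auto simp: algebra_simps)
    also have "\<dots> = expectation (\<lambda>w. S w * g w) + \<theta> * expectation (\<lambda>w. f n w * g w)"
      by (subst Bochner_Integration.integral_add | intro prod mS bS mf mg bg' bf' integrable_mult_right)+ simp
    finally have 2: "expectation (\<lambda>w. ?S w * g w) \<ge> real (Suc N) * c"
      using Sg \<theta>(2) by (simp add: algebra_simps)
    have "expectation (\<lambda>w. f k w * ?S w) = expectation (\<lambda>w. f k w * S w) + \<theta> * expectation (\<lambda>w. f k w * f n w)" for k
    proof -
      have "expectation (\<lambda>w. f k w * ?S w) = expectation (\<lambda>w. f k w * S w + \<theta> * (f k w * f n w))"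
        by (intro Bochner_Integration.integral_cong) (auto simp: algebra_simps)
      also have "\<dots> = expectation (\<lambda>w. f k w * S w) + \<theta> * expectation (\<lambda>w. f k w * f n w)"
        by (subst Bochner_Integration.integral_add | intro prod mS bS mf bf' integrable_mult_right)+ simp
      finally show ?thesis .
    qed
    then have 3: "(\<lambda>k. expectation (\<lambda>w. f k w * ?S w)) \<longlonglongrightarrow> 0"
      using tendsto_add[OF lim tendsto_mult_left[OF orth[of n], of \<theta>]] by simp
    have "\<bar>?S w\<bar> \<le> K + C" for w
    proof -
      have "\<bar>\<theta> * f n w\<bar> \<le> 1 * C" unfolding abs_mult using \<theta>(1) bf[of n w] by (intro mult_mono) auto
      then show ?thesis using K[of w] by linarith
    qed
    then have 4: "\<exists>K. \<forall>w. \<bar>?S w\<bar> \<le> K" by blast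
    show ?case using 1 2 3 4 by (intro exI[of _ ?S] conjI) auto
  qed
  have B: "?B > 0" by (simp add: add_nonneg_pos)
  \<comment> \<open>Minimizer of \<open>t^2 * N * ?B - 2 * t * N * c\<close>, the bound for the
    change of the squared norm of \<open>g\<close> when \<open>t * S\<close> is subtracted. The
    minimum \<open>- N * c^2 / ?B\<close> is unbounded below in \<open>N\<close>.\<close>
  let ?t = "c / ?B"
  have bound: "real N * (c\<^sup>2 / ?B) \<le> expectation (\<lambda>w. g w * g w)" for N
  proof -
    obtain S where mS [measurable]: "S \<in> borel_measurable M" and bS: "\<exists>K. \<forall>w. \<bar>S w\<bar> \<le> K"
      and SS: "expectation (\<lambda>w. S w * S w) \<le> real N * ?B"
      and Sg: "expectation (\<lambda>w. S w * g w) \<ge> real N * c" using ex[of N] by blast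
    have "0 \<le> expectation (\<lambda>w. (g w - ?t * S w) * (g w - ?t * S w))" by (intro integral_nonneg_AE) auto
    also have "\<dots> = expectation (\<lambda>w. g w * g w + (- 2 * ?t) * (S w * g w) + (?t * ?t) * (S w * S w))"
      by (intro Bochner_Integration.integral_cong) (auto simp: algebra_simps)
    also have "\<dots> = expectation (\<lambda>w. g w * g w) + (- 2 * ?t) * expectation (\<lambda>w. S w * g w) + (?t * ?t) * expectation (\<lambda>w. S w * S w)"
      by (subst Bochner_Integration.integral_add | intro prod mS bS mg bg' Bochner_Integration.integrable_add integrable_mult_right)+ simp
    also have "\<dots> \<le> expectation (\<lambda>w. g w * g w) + (- 2 * ?t) * (real N * c) + (?t * ?t) * (real N * ?B)"
      using SS Sg c B by (intro add_mono mult_left_mono mult_left_mono_neg) auto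
    also have "\<dots> = expectation (\<lambda>w. g w * g w) - real N * (c\<^sup>2 / ?B)"
    proof -
      have "(- 2 * (c/b)) * (r * c) + ((c/b) * (c/b)) * (r * b) = - (r * (c\<^sup>2 / b))" if "b > 0" for b r :: real
        using that by (simp add: field_simps power2_eq_square)
      from this[OF B, of "real N"] show ?thesis by linarith
    qed
    finally show ?thesis by simp
  qed
  have "c\<^sup>2 / ?B > 0" using c B by simp
  then obtain N where "real N * (c\<^sup>2 / ?B) > expectation (\<lambda>w. g w * g w)"
    using reals_Archimedean3 by blast
  with bound[of N] show False by simp
qed

end

section \<open>Characteristic functions and Renyi's mixing criterion\<close>

lemma real_distribution_gauss_law: "real_distribution (gauss_law v)"
  unfolding gauss_law_def
  by (intro prob_space.real_distribution_distr prob_space_normal_density) auto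

lemma char_gauss_law:
  assumes "v \<ge> 0"
  shows "char (gauss_law v) t = complex_of_real (exp (- (t\<^sup>2 * v) / 2))"
proof -
  have "char (gauss_law v) t = char std_normal_distribution (t * sqrt v)"
    unfolding char_def gauss_law_def by (subst integral_distr) (auto simp: ac_simps)
  also have "\<dots> = complex_of_real (exp (- (t\<^sup>2 * v) / 2))"
    using assms by (simp add: char_std_normal_distribution power_mult_distrib)
  finally show ?thesis .
qed

lemma (in prob_space) char_distr_eq:
  assumes [measurable]: "X \<in> borel_measurable M"
  shows "char (distr M borel X) t =
    complex_of_real (expectation (\<lambda>w. cos (t * X w))) + \<i> * complex_of_real (expectation (\<lambda>w. sin (t * X w)))"
proof -
  have i: "integrable M (\<lambda>w. cos (t * X w))" "integrable M (\<lambda>w. sin (t * X w))"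
    by (intro integrable_const_bound[where B=1]; simp)+
  have "char (distr M borel X) t = (CLINT w|M. iexp (t * X w))"
    unfolding char_def by (subst integral_distr) auto
  also have "\<dots> = (CLINT w|M. complex_of_real (cos (t * X w)) + \<i> * complex_of_real (sin (t * X w)))"
    by (intro Bochner_Integration.integral_cong)
       (simp_all add: cis_conv_exp[symmetric] complex_eq_iff del: of_real_mult)
  also have "\<dots> = complex_of_real (expectation (\<lambda>w. cos (t * X w))) + \<i> * complex_of_real (expectation (\<lambda>w. sin (t * X w)))"
    using i by (subst Bochner_Integration.integral_add) auto
  finally show ?thesis .
qed

context prob_space
begin

text \<open>By \<open>pair\<close>, the centered cosines and the sines of \<open>a * X n\<close> are
  asymptotically orthogonal to each fixed member of their own sequence, hence weakly null. Testing
  them against the indicator of \<open>A\<close> gives convergence of the characteristic functions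
  under the conditional law given \<open>A\<close>, and Levy continuity finishes. Frequencies with
  \<open>\<bar>b\<bar> = \<bar>a\<bar>\<close> suffice because products of two cosines or two sines
  produce only these.\<close>

lemma renyi_mixing:
  fixes X :: "nat \<Rightarrow> 'a \<Rightarrow> real"
  assumes mX [measurable]: "\<And>n. X n \<in> borel_measurable M" and v: "v \<ge> 0"
    and base: "\<And>a. (\<lambda>n. expectation (\<lambda>w. cos (a * X n w))) \<longlonglongrightarrow> exp (- (a\<^sup>2 * v) / 2)"
    and pair: "\<And>a b k. \<bar>b\<bar> = \<bar>a\<bar> \<Longrightarrow> (\<lambda>n. expectation (\<lambda>w. cos (a * X n w + b * X k w))) \<longlonglongrightarrow>
        exp (- (a\<^sup>2 * v) / 2) * expectation (\<lambda>w. cos (a * X k w))"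
    and A [measurable]: "A \<in> events"
    and h: "continuous_on UNIV h" and hb: "\<And>x. \<bar>h x\<bar> \<le> D"
  shows "(\<lambda>n. expectation (\<lambda>w. indicator A w * h (X n w))) \<longlonglongrightarrow> prob A * (\<integral>x. h x \<partial>gauss_law v)"
proof (cases "prob A = 0")
  case True
  have "AE w in M. w \<notin> A" using True by (simp add: prob_eq_0)
  then have "expectation (\<lambda>w. indicator A w * h (X n w)) = 0" for n
    by (intro integral_eq_zero_AE) auto
  then show ?thesis using True by simp
next
  case False
  let ?\<phi> = "\<lambda>a::real. exp (- (a\<^sup>2 * v) / 2)"
  have ic: "integrable M (\<lambda>w. cos (Y w))" "integrable M (\<lambda>w. sin (Y w))" if "Y \<in> borel_measurable M" for Y :: "'a \<Rightarrow> real"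
    using that by (auto intro!: integrable_const_bound[where B=1])
  have cosA: "(\<lambda>n. expectation (\<lambda>w. indicator A w * cos (a * X n w))) \<longlonglongrightarrow> prob A * ?\<phi> a" for a
  proof -
    let ?f = "\<lambda>n w. cos (a * X n w) - ?\<phi> a"
    have "(\<lambda>n. expectation (\<lambda>w. ?f n w * indicator A w)) \<longlonglongrightarrow> 0"
    proof (rule weakly_null_if_asymptotically_orthogonal[where C=2 and D=1])
      fix k
      \<comment> \<open>The cosines of the sum and of the difference have the same limit by
        \<open>pair\<close>; with the centering terms all limits cancel.\<close>
      have "expectation (\<lambda>w. ?f n w * ?f k w) =
         1/2 * expectation (\<lambda>w. cos (a * X n w + (-a) * X k w)) + 1/2 * expectation (\<lambda>w. cos (a * X n w + a * X k w))
         - ?\<phi> a * expectation (\<lambda>w. cos (a * X n w)) - ?\<phi> a * expectation (\<lambda>w. cos (a * X k w)) + ?\<phi> a * ?\<phi> a" for n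
      proof -
        have "expectation (\<lambda>w. ?f n w * ?f k w) =
          expectation (\<lambda>w. 1/2 * cos (a * X n w + (-a) * X k w) + 1/2 * cos (a * X n w + a * X k w)
            - ?\<phi> a * cos (a * X n w) - ?\<phi> a * cos (a * X k w) + ?\<phi> a * ?\<phi> a)"
          by (intro Bochner_Integration.integral_cong) (auto simp: cos_add cos_diff algebra_simps)
        also have "\<dots> = 1/2 * expectation (\<lambda>w. cos (a * X n w + (-a) * X k w)) + 1/2 * expectation (\<lambda>w. cos (a * X n w + a * X k w))
         - ?\<phi> a * expectation (\<lambda>w. cos (a * X n w)) - ?\<phi> a * expectation (\<lambda>w. cos (a * X k w)) + ?\<phi> a * ?\<phi> a"
          by (simp add: ic prob_space del: mult_minus_left)
        finally show ?thesis .
      qed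
      moreover have "(\<lambda>n. 1/2 * expectation (\<lambda>w. cos (a * X n w + (-a) * X k w)) + 1/2 * expectation (\<lambda>w. cos (a * X n w + a * X k w))
         - ?\<phi> a * expectation (\<lambda>w. cos (a * X n w)) - ?\<phi> a * expectation (\<lambda>w. cos (a * X k w)) + ?\<phi> a * ?\<phi> a)
         \<longlonglongrightarrow> 1/2 * (?\<phi> a * expectation (\<lambda>w. cos (a * X k w))) + 1/2 * (?\<phi> a * expectation (\<lambda>w. cos (a * X k w)))
         - ?\<phi> a * ?\<phi> a - ?\<phi> a * expectation (\<lambda>w. cos (a * X k w)) + ?\<phi> a * ?\<phi> a"
        by (intro tendsto_intros base pair) auto
      ultimately show "(\<lambda>n. expectation (\<lambda>w. ?f n w * ?f k w)) \<longlonglongrightarrow> 0" by simp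
    next
      fix n w
      have "?\<phi> a \<le> 1" using v by simp
      moreover have "\<bar>cos (a * X n w)\<bar> \<le> 1" "?\<phi> a \<ge> 0" by auto
      ultimately show "\<bar>?f n w\<bar> \<le> 2" by linarith
    qed (auto simp: indicator_def)
    moreover have "expectation (\<lambda>w. ?f n w * indicator A w) = expectation (\<lambda>w. indicator A w * cos (a * X n w)) - prob A * ?\<phi> a" for n
    proof -
      have "expectation (\<lambda>w. ?f n w * indicator A w) = expectation (\<lambda>w. indicator A w * cos (a * X n w) - ?\<phi> a * indicator A w)"
        by (intro Bochner_Integration.integral_cong) (auto simp: algebra_simps)
      also have "\<dots> = expectation (\<lambda>w. indicator A w * cos (a * X n w)) - ?\<phi> a * expectation (indicator A)"
        by (subst Bochner_Integration.integral_diff) (auto intro!: integrable_const_bound[where B=1] split: split_indicator)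
      finally show ?thesis by simp
    qed
    ultimately show ?thesis by (simp add: LIM_zero_iff)
  qed
  have sinA: "(\<lambda>n. expectation (\<lambda>w. indicator A w * sin (a * X n w))) \<longlonglongrightarrow> 0" for a
  proof -
    let ?f = "\<lambda>n w. sin (a * X n w)"
    have "(\<lambda>n. expectation (\<lambda>w. ?f n w * indicator A w)) \<longlonglongrightarrow> 0"
    proof (rule weakly_null_if_asymptotically_orthogonal[where C=1 and D=1])
      fix k
      \<comment> \<open>For sines the two limits enter with opposite signs, so they cancel without
        centering.\<close>
      have "expectation (\<lambda>w. ?f n w * ?f k w) =
         1/2 * expectation (\<lambda>w. cos (a * X n w + (-a) * X k w)) - 1/2 * expectation (\<lambda>w. cos (a * X n w + a * X k w))" for n
      proof -
        have "expectation (\<lambda>w. ?f n w * ?f k w) =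
          expectation (\<lambda>w. 1/2 * cos (a * X n w + (-a) * X k w) - 1/2 * cos (a * X n w + a * X k w))"
          by (intro Bochner_Integration.integral_cong) (auto simp: cos_add cos_diff algebra_simps)
        also have "\<dots> = 1/2 * expectation (\<lambda>w. cos (a * X n w + (-a) * X k w)) - 1/2 * expectation (\<lambda>w. cos (a * X n w + a * X k w))"
          by (simp add: ic prob_space del: mult_minus_left)
        finally show ?thesis .
      qed
      moreover have "(\<lambda>n. 1/2 * expectation (\<lambda>w. cos (a * X n w + (-a) * X k w)) - 1/2 * expectation (\<lambda>w. cos (a * X n w + a * X k w)))
         \<longlonglongrightarrow> 1/2 * (?\<phi> a * expectation (\<lambda>w. cos (a * X k w))) - 1/2 * (?\<phi> a * expectation (\<lambda>w. cos (a * X k w)))"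
        by (intro tendsto_intros pair) auto
      ultimately show "(\<lambda>n. expectation (\<lambda>w. ?f n w * ?f k w)) \<longlonglongrightarrow> 0" by simp
    qed (auto simp: indicator_def)
    then show ?thesis by (simp add: mult.commute)
  qed
  have pA: "prob A > 0" using False by (simp add: zero_less_measure_iff)
  \<comment> \<open>Conditional law given \<open>A\<close>; \<open>cosA\<close> and
    \<open>sinA\<close>, divided by \<open>prob A\<close>, are the limits of characteristic
    functions under it.\<close>
  define N where "N = density M (\<lambda>w. indicator A w / prob A)"
  have setsN [simp, measurable_cong]: "sets N = sets M" by (simp add: N_def)
  have spN [simp]: "space N = space M" by (simp add: N_def)
  have intN: "(\<integral>w. Y w \<partial>N) = expectation (\<lambda>w. indicator A w * Y w) / prob A"
    if [measurable]: "Y \<in> borel_measurable M" for Y :: "'a \<Rightarrow> real"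
  proof -
    have "(\<integral>w. Y w \<partial>N) = expectation (\<lambda>w. (indicator A w / prob A) * Y w)"
      unfolding N_def by (subst integral_real_density) auto
    also have "\<dots> = expectation (\<lambda>w. (indicator A w * Y w) / prob A)" by simp
    finally show ?thesis by simp
  qed
  interpret N: prob_space N
  proof
    have "emeasure N (space N) = (\<integral>\<^sup>+w. ennreal (indicator A w / prob A) \<partial>M)"
      unfolding N_def by (subst emeasure_density) (auto intro!: nn_integral_cong simp: indicator_def)
    also have "\<dots> = ennreal (expectation (\<lambda>w. indicator A w / prob A))"
      using pA by (intro nn_integral_eq_integral) (auto intro!: integrable_const_bound[where B="1/prob A"] simp: indicator_def)
    also have "\<dots> = 1" using pA by simp
    finally show "emeasure N (space N) = 1" .
  qed
  have wc: "weak_conv_m (\<lambda>n. distr N borel (X n)) (gauss_law v)"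
  proof (rule levy_continuity)
    show "real_distribution (distr N borel (X n))" for n by (rule N.real_distribution_distr) simp
    fix t
        have "(\<lambda>n. complex_of_real (expectation (\<lambda>w. indicator A w * cos (t * X n w)) / prob A)
        + \<i> * complex_of_real (expectation (\<lambda>w. indicator A w * sin (t * X n w)) / prob A))
       \<longlonglongrightarrow> complex_of_real ((prob A * ?\<phi> t) / prob A) + \<i> * complex_of_real (0 / prob A)"
      using pA by (intro tendsto_intros cosA sinA) auto
    then show "(\<lambda>n. char (distr N borel (X n)) t) \<longlonglongrightarrow> char (gauss_law v) t"
      using pA by (subst N.char_distr_eq) (simp_all add: intN char_gauss_law[OF v])
  qed (rule real_distribution_gauss_law)
  have hm [measurable]: "h \<in> borel_measurable borel" using h by (rule borel_measurable_continuous_onI)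
  have "(\<lambda>n. integral\<^sup>L (distr N borel (X n)) h) \<longlonglongrightarrow> integral\<^sup>L (gauss_law v) h"
    by (rule weak_conv_imp_integral_bdd_continuous_conv[OF _ _ wc, where B=D])
       (use h hb in \<open>auto intro: N.real_distribution_distr real_distribution_gauss_law simp: continuous_on_eq_continuous_at\<close>)
  then have "(\<lambda>n. prob A * integral\<^sup>L (distr N borel (X n)) h) \<longlonglongrightarrow> prob A * integral\<^sup>L (gauss_law v) h"
    by (rule tendsto_mult_left)
  moreover have "prob A * integral\<^sup>L (distr N borel (X n)) h = expectation (\<lambda>w. indicator A w * h (X n w))" for n
    using pA by (subst integral_distr) (simp_all add: intN)
  ultimately show ?thesis by simp
qed

end

section \<open>From mixing to continuous functionals of path and limit variable\<close>

text \<open>Reduces a bound over an interval to countably many conditions, so that events defined by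
  uniform closeness become measurable.\<close>

lemma continuous_le_on_rational_interval:
  fixes f :: "real \<Rightarrow> real"
  assumes "a < b" "continuous_on {a..b} f" "\<And>q. real_of_rat q \<in> {a<..<b} \<Longrightarrow> f (real_of_rat q) \<le> c" "x \<in> {a..b}"
  shows "f x \<le> c"
proof -
  have "closure ({a<..<b} \<inter> \<rat>) = {a..b}"
    using assms(1) by (subst closure_open_Int_superset) (auto simp: Rats_closure_real)
  then show ?thesis using continuous_le_on_closure[of "{a<..<b} \<inter> \<rat>" f x c] assms by (auto elim!: Rats_cases)
qed

text \<open>A countable family of continuous paths, dense in the uniform norm. Lists serve as codes
  because they can be enumerated by \<open>from_nat\<close>; a list of \<open>n + 1\<close>
  coefficient pairs encodes degree \<open>n\<close>.\<close>

definition Bernstein_path :: "real \<Rightarrow> (rat \<times> rat) list \<Rightarrow> real \<Rightarrow> real \<times> real" where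
  "Bernstein_path T l t =
    (\<Sum>k\<le>length l - 1. of_rat (fst (l ! k)) * Bernstein (length l - 1) k (t / T),
     \<Sum>k\<le>length l - 1. of_rat (snd (l ! k)) * Bernstein (length l - 1) k (t / T))"

lemma continuous_on_Bernstein_path: "T > 0 \<Longrightarrow> continuous_on S (Bernstein_path T l)"
  unfolding Bernstein_path_def Bernstein_def by (intro continuous_intros) auto

text \<open>Perturbing the coefficients by less than \<open>e/2\<close> moves the polynomial by at
  most \<open>e/2\<close>, since Bernstein polynomials are nonnegative and sum to 1. A threshold for
  all large degrees is produced, rather than one degree, so that both coordinates of a planar path
  can share the degree.\<close>

lemma Bernstein_rat_approx:
  fixes g :: "real \<Rightarrow> real"
  assumes T: "T > 0" and g: "continuous_on {0..T} g" and e: "e > 0"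
  obtains N where "\<And>n. n \<ge> N \<Longrightarrow> \<exists>q :: nat \<Rightarrow> rat. \<forall>t\<in>{0..T}.
    \<bar>(\<Sum>k\<le>n. of_rat (q k) * Bernstein n k (t / T)) - g t\<bar> < e"
proof -
  have "continuous_on {0..1} (\<lambda>x. g (T * x))"
    using T by (intro continuous_on_compose2[OF g] continuous_intros) (auto simp: mult_left_le)
  from Bernstein_Weierstrass[OF this, of "e/2"] e obtain N where
    N: "\<And>n x. N \<le> n \<Longrightarrow> x \<in> {0..1} \<Longrightarrow> \<bar>g (T * x) - (\<Sum>k\<le>n. g (T * (k/n)) * Bernstein n k x)\<bar> < e/2"
    by auto
  show ?thesis
  proof (rule that)
    fix n assume n: "N \<le> n"
    have "\<exists>q. \<bar>real_of_rat q - g (T * (k/n))\<bar> < e/2" for k :: nat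
    proof -
      obtain q where "g (T * (k/n)) - e/2 < real_of_rat q" "real_of_rat q < g (T * (k/n)) + e/2"
        using of_rat_dense[of "g (T * (k/n)) - e/2" "g (T * (k/n)) + e/2"] e by auto
      then have "\<bar>real_of_rat q - g (T * (k/n))\<bar> < e/2" by (simp only: abs_less_iff) linarith
      then show ?thesis ..
    qed
    then obtain q where q: "\<And>k. \<bar>real_of_rat (q k) - g (T * (real k/real n))\<bar> < e/2" by metis
    show "\<exists>q :: nat \<Rightarrow> rat. \<forall>t\<in>{0..T}. \<bar>(\<Sum>k\<le>n. of_rat (q k) * Bernstein n k (t / T)) - g t\<bar> < e"
    proof (intro exI ballI)
      fix t assume t: "t \<in> {0..T}"
      let ?x = "t / T"
      have x: "?x \<in> {0..1}" "T * ?x = t" using t T by auto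
      have "\<bar>(\<Sum>k\<le>n. of_rat (q k) * Bernstein n k ?x) - (\<Sum>k\<le>n. g (T * (k/n)) * Bernstein n k ?x)\<bar>
          = \<bar>\<Sum>k\<le>n. (of_rat (q k) - g (T * (k/n))) * Bernstein n k ?x\<bar>"
        by (simp add: sum_subtractf[symmetric] left_diff_distrib)
      also have "\<dots> \<le> (\<Sum>k\<le>n. e/2 * Bernstein n k ?x)"
        using q x(1) by (intro order_trans[OF sum_abs] sum_mono)
          (simp add: abs_mult Bernstein_nonneg less_imp_le mult_right_mono del: mult_le_cancel_right times_divide_eq_left times_divide_eq_right)
      also have "\<dots> = e/2" unfolding sum_distrib_left[symmetric] by simp
      finally show "\<bar>(\<Sum>k\<le>n. of_rat (q k) * Bernstein n k ?x) - g t\<bar> < e"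
        using N[OF n x(1)] unfolding x(2) by linarith
    qed
  qed
qed

lemma Bernstein_path_dense:
  fixes f :: "real \<Rightarrow> real \<times> real"
  assumes T: "T > 0" and f: "continuous_on {0..T} f" and e: "e > 0"
  shows "\<exists>l. \<forall>t\<in>{0..T}. dist (f t) (Bernstein_path T l t) < e"
proof -
  obtain N1 where N1: "\<And>n. n \<ge> N1 \<Longrightarrow> \<exists>q :: nat \<Rightarrow> rat. \<forall>t\<in>{0..T}.
    \<bar>(\<Sum>k\<le>n. of_rat (q k) * Bernstein n k (t / T)) - fst (f t)\<bar> < e/2"
    by (rule Bernstein_rat_approx[of T "\<lambda>t. fst (f t)" "e/2"]) (use T f e in \<open>auto intro!: continuous_intros\<close>)
  obtain N2 where N2: "\<And>n. n \<ge> N2 \<Longrightarrow> \<exists>q :: nat \<Rightarrow> rat. \<forall>t\<in>{0..T}.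
    \<bar>(\<Sum>k\<le>n. of_rat (q k) * Bernstein n k (t / T)) - snd (f t)\<bar> < e/2"
    by (rule Bernstein_rat_approx[of T "\<lambda>t. snd (f t)" "e/2"]) (use T f e in \<open>auto intro!: continuous_intros\<close>)
  define n where "n = max N1 N2"
  obtain q1 where q1: "\<And>t. t\<in>{0..T} \<Longrightarrow> \<bar>(\<Sum>k\<le>n. of_rat (q1 k) * Bernstein n k (t / T)) - fst (f t)\<bar> < e/2"
    using N1[of n] unfolding n_def by fastforce
  obtain q2 where q2: "\<And>t. t\<in>{0..T} \<Longrightarrow> \<bar>(\<Sum>k\<le>n. of_rat (q2 k) * Bernstein n k (t / T)) - snd (f t)\<bar> < e/2"
    using N2[of n] unfolding n_def by fastforce
  define l where "l = map (\<lambda>k. (q1 k, q2 k)) [0..<Suc n]"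
  have l: "length l - 1 = n" "\<And>k. k \<le> n \<Longrightarrow> l ! k = (q1 k, q2 k)"
    by (auto simp: l_def nth_append simp del: upt_Suc)
  have "dist (f t) (Bernstein_path T l t) < e" if t: "t \<in> {0..T}" for t
  proof -
    have eq: "Bernstein_path T l t = (\<Sum>k\<le>n. of_rat (q1 k) * Bernstein n k (t / T), \<Sum>k\<le>n. of_rat (q2 k) * Bernstein n k (t / T))"
      unfolding Bernstein_path_def l(1) by (auto simp: l(2) intro!: sum.cong)
    have "dist (f t) (Bernstein_path T l t) \<le> dist (fst (f t)) (fst (Bernstein_path T l t)) + dist (snd (f t)) (snd (Bernstein_path T l t))"
      unfolding dist_prod_def by (intro sqrt_sum_squares_le_sum) auto
    also have "\<dots> < e" using q1[OF t] q2[OF t] unfolding eq fst_conv snd_conv dist_real_def by linarith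
    finally show ?thesis .
  qed
  then show ?thesis by blast
qed

lemma bcont_CT_R_tendsto:
  assumes F: "bcont_CT_R T F" and f: "continuous_on {0..T} f"
    and g: "\<And>m. continuous_on {0..T} (g m)"
    and gd: "\<And>m t. t \<in> {0..T} \<Longrightarrow> dist (g m t) (f t) \<le> d m" and d: "d \<longlonglongrightarrow> 0"
    and x: "x \<longlonglongrightarrow> y"
  shows "(\<lambda>m. F (g m, x m)) \<longlonglongrightarrow> F (f, y)"
proof (rule LIMSEQ_I)
  fix e :: real assume e: "e > 0"
  have "\<forall>f x e. continuous_on {0..T} f \<and> e > 0 \<longrightarrow>
        (\<exists>d>0. \<forall>g y. continuous_on {0..T} g \<and> (\<forall>t\<in>{0..T}. dist (g t) (f t) < d) \<and> \<bar>y - x\<bar> < d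
                 \<longrightarrow> \<bar>F (g, y) - F (f, x)\<bar> < e)"
    using F unfolding bcont_CT_R_def by (rule conjunct2)
  from this[rule_format, OF conjI[OF f e], of y] obtain D where D: "D > 0"
    "\<And>g' y'. continuous_on {0..T} g' \<Longrightarrow> \<forall>t\<in>{0..T}. dist (g' t) (f t) < D \<Longrightarrow> \<bar>y' - y\<bar> < D
      \<Longrightarrow> \<bar>F (g', y') - F (f, y)\<bar> < e"
    by (elim exE conjE) simp
  obtain N1 where N1: "\<And>n. n \<ge> N1 \<Longrightarrow> \<bar>d n\<bar> < D" using LIMSEQ_D[OF d D(1)] by auto
  obtain N2 where N2: "\<And>n. n \<ge> N2 \<Longrightarrow> \<bar>x n - y\<bar> < D" using LIMSEQ_D[OF x D(1)] by auto
  have "norm (F (g n, x n) - F (f, y)) < e" if "n \<ge> max N1 N2" for n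
  proof -
    have "dist (g n t) (f t) < D" if "t \<in> {0..T}" for t
      using gd[OF that, of n] N1[of n] \<open>n \<ge> max N1 N2\<close> by auto
    then show ?thesis using D(2)[OF g, of n "x n"] N2[of n] that by auto
  qed
  then show "\<exists>no. \<forall>n\<ge>no. norm (F (g n, x n) - F (f, y)) < e" by blast
qed

context prob_space
begin

lemma integral_affine:
  fixes f g :: "'a \<Rightarrow> real"
  assumes "integrable M f" "integrable M g"
  shows "expectation (\<lambda>w. a + b * f w + c * g w) = a + b * expectation f + c * expectation g"
  using assms by (simp add: prob_space)

text \<open>Off an event of small probability and for bounded \<open>x\<close>,
  \<open>F (P w, x)\<close> is uniformly close to a finite sum of products of an indicator in
  \<open>w\<close> and a bounded continuous function of \<open>x\<close>; \<open>mix\<close> applies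
  to each product. Only the real component varies with \<open>n\<close>, so no compactness of path
  laws enters.\<close>

lemma functional_convergence:
  fixes P :: "'a \<Rightarrow> real \<Rightarrow> real \<times> real" and X :: "nat \<Rightarrow> 'a \<Rightarrow> real"
  assumes T: "T > 0" and Pm [measurable]: "\<And>t. t \<in> {0..T} \<Longrightarrow> (\<lambda>w. P w t) \<in> borel_measurable M"
    and Pc: "\<And>w. w \<in> space M \<Longrightarrow> continuous_on {0..T} (P w)"
    and Xm [measurable]: "\<And>n. X n \<in> borel_measurable M"
    and \<nu>: "real_distribution \<nu>"
    and mix: "\<And>A h D. A \<in> events \<Longrightarrow> continuous_on UNIV h \<Longrightarrow> (\<And>x. \<bar>h x\<bar> \<le> D) \<Longrightarrow>
        (\<lambda>n. expectation (\<lambda>w. indicator A w * h (X n w))) \<longlonglongrightarrow> prob A * (\<integral>x. h x \<partial>\<nu>)"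
    and F: "bcont_CT_R T F"
  shows "(\<lambda>n. expectation (\<lambda>w. F (P w, X n w))) \<longlonglongrightarrow> expectation (\<lambda>w. \<integral>x. F (P w, x) \<partial>\<nu>)"
proof -
  interpret N: real_distribution \<nu> by fact
  obtain K0 where K0: "\<And>f x. continuous_on {0..T} f \<Longrightarrow> \<bar>F (f, x)\<bar> \<le> K0"
    using F unfolding bcont_CT_R_def by (elim conjE exE) blast
  define K where "K = max K0 0"
  have K: "\<bar>F (f, x)\<bar> \<le> K" if "continuous_on {0..T} f" for f x using K0[OF that, of x] by (simp add: K_def)
  have K_nonneg: "K \<ge> 0" by (simp add: K_def)
  define p where "p k = Bernstein_path T (from_nat k)" for k :: nat
  have pc: "continuous_on {0..T} (p k)" for k unfolding p_def by (rule continuous_on_Bernstein_path[OF T])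
  \<comment> \<open>Rational times keep this a countable conjunction, hence a measurable event; path
    continuity extends the closeness to all of \<open>{0..T}\<close>.\<close>
  define near where "near m k w \<longleftrightarrow> (\<forall>q. real_of_rat q \<in> {0<..<T} \<longrightarrow> dist (P w (real_of_rat q)) (p k (real_of_rat q)) \<le> 1 / real (Suc m))" for m k w
  have near_D: "dist (p k t) (P w t) \<le> 1 / real (Suc m)" if "near m k w" "w \<in> space M" "t \<in> {0..T}" for m k w t
  proof -
    have "dist (P w t) (p k t) \<le> 1 / real (Suc m)"
      by (rule continuous_le_on_rational_interval[OF T, of "\<lambda>t. dist (P w t) (p k t)"])
        (use that in \<open>auto simp: near_def intro!: continuous_on_dist Pc pc\<close>)
    then show ?thesis by (simp add: dist_commute)
  qed
  have near_ex: "\<exists>k. near m k w" if w: "w \<in> space M" for m w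
  proof -
    obtain l where "\<And>t. t \<in> {0..T} \<Longrightarrow> dist (P w t) (Bernstein_path T l t) < 1 / real (Suc m)"
      using Bernstein_path_dense[OF T Pc[OF w], of "1 / real (Suc m)"] by fastforce
    then have "near m (to_nat l) w" unfolding near_def p_def by (auto intro: less_imp_le)
    then show ?thesis ..
  qed
  have near_m [measurable]: "Measurable.pred M (near m k)" for m k
  proof -
    have "Measurable.pred M (\<lambda>w. real_of_rat q \<in> {0<..<T} \<longrightarrow> dist (P w (real_of_rat q)) (p k (real_of_rat q)) \<le> 1 / real (Suc m))" for q
    proof (cases "real_of_rat q \<in> {0<..<T}")
      case True
      then have [measurable]: "(\<lambda>w. P w (real_of_rat q)) \<in> borel_measurable M" by (intro Pm) auto
      show ?thesis using True by simp
    qed simp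
    then show ?thesis unfolding near_def by (rule pred_intros_countable)
  qed
  \<comment> \<open>The least index of a good approximation is a measurable choice with countably
    many values. Hence \<open>F (p (\<kappa> m w), x)\<close> is measurable in \<open>w\<close>, and
    so is its limit \<open>F (P w, x)\<close>.\<close>
  define \<kappa> where "\<kappa> m w = (LEAST k. near m k w)" for m w
  have \<kappa>: "near m (\<kappa> m w) w" if "w \<in> space M" for m w
    unfolding \<kappa>_def using near_ex[OF that] by (rule LeastI_ex)
  have \<kappa>m [measurable]: "\<kappa> m \<in> measurable M (count_space UNIV)" for m unfolding \<kappa>_def by measurable
  have lim: "(\<lambda>m. F (p (\<kappa> (r m) w), x m)) \<longlonglongrightarrow> F (P w, y)"
    if w: "w \<in> space M" and r: "strict_mono r" and x: "x \<longlonglongrightarrow> y" for w r x y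
  proof (rule bcont_CT_R_tendsto[OF F Pc[OF w] pc _ _ x, where d = "\<lambda>m. 1 / real (Suc (r m))"])
    show "dist (p (\<kappa> (r m) w) t) (P w t) \<le> 1 / real (Suc (r m))" if "t \<in> {0..T}" for m t
      using near_D[OF \<kappa>[OF w] w that] .
    have "(\<lambda>m. 1 / real (Suc m)) \<longlonglongrightarrow> 0" by real_asymp
    from LIMSEQ_subseq_LIMSEQ[OF this r] show "(\<lambda>m. 1 / real (Suc (r m))) \<longlonglongrightarrow> 0" by (simp add: o_def)
  qed
  have Fcont: "continuous_on UNIV (\<lambda>x. F (f, x))" if "continuous_on {0..T} f" for f
    unfolding continuous_on_sequentially o_def
  proof (intro ballI allI impI, elim conjE)
    fix y :: real and x :: "nat \<Rightarrow> real" assume "x \<longlonglongrightarrow> y"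
    then show "(\<lambda>n. F (f, x n)) \<longlonglongrightarrow> F (f, y)"
      by (intro bcont_CT_R_tendsto[OF F that that, where d = "\<lambda>_. 0"]) auto
  qed
  have Fm [measurable]: "(\<lambda>w. F (P w, x)) \<in> borel_measurable M" for x
  proof (rule borel_measurable_LIMSEQ_real)
    show "(\<lambda>w. F (p (\<kappa> m w), x)) \<in> borel_measurable M" for m
      by (rule measurable_compose[OF \<kappa>m, of "\<lambda>k. F (p k, x)"]) simp
    show "(\<lambda>m. F (p (\<kappa> m w), x)) \<longlonglongrightarrow> F (P w, x)" if "w \<in> space M" for w
      using lim[OF that, of "\<lambda>m. m" "\<lambda>_. x" x] by (simp add: strict_mono_def)
  qed
  have FXm [measurable]: "(\<lambda>w. F (P w, X n w)) \<in> borel_measurable M" for n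
    using measurable_compose_caratheodory[of "\<lambda>w x. F (P w, x)" M "\<lambda>w. w" M "X n"] Fcont Pc by auto
  have Fjm [measurable]: "(\<lambda>z. F (P (fst z), snd z)) \<in> borel_measurable (M \<Otimes>\<^sub>M \<nu>)"
    using measurable_compose_caratheodory[of "\<lambda>w x. F (P w, x)" M fst "M \<Otimes>\<^sub>M \<nu>" snd] Fcont Pc by auto
  have Fpm [measurable]: "(\<lambda>x. F (p k, x)) \<in> borel_measurable borel" for k
    using Fcont[OF pc] by (rule borel_measurable_continuous_onI)
  have Fwm [measurable]: "w \<in> space M \<Longrightarrow> (\<lambda>x. F (P w, x)) \<in> borel_measurable borel" for w
    using Fcont[OF Pc] by (rule borel_measurable_continuous_onI)
  have intm [measurable]: "(\<lambda>w. \<integral>x. F (P w, x) \<partial>\<nu>) \<in> borel_measurable M"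
    by (rule N.borel_measurable_lebesgue_integral) (use Fjm in \<open>simp add: case_prod_beta\<close>)
  let ?a = "\<lambda>n. expectation (\<lambda>w. F (P w, X n w))" and ?L = "expectation (\<lambda>w. \<integral>x. F (P w, x) \<partial>\<nu>)"
  have main: "\<exists>n0. \<forall>n\<ge>n0. \<bar>?a n - ?L\<bar> \<le> (3 + 5 * K) * e" if e: "e > 0" for e
  proof -
    \<comment> \<open>Continuous cutoff: 1 on \<open>[-R, R]\<close>, 0 outside
      \<open>[-R-1, R+1]\<close>, linear in between.\<close>
    define ct where "ct R x = max 0 (min 1 (R + 1 - \<bar>x\<bar>))" for R x :: real
    have ctc: "continuous_on S (ct R)" for R S unfolding ct_def by (intro continuous_intros)
    have ctm [measurable]: "ct R \<in> borel_measurable borel" for R by (rule borel_measurable_continuous_onI[OF ctc])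
    have ctb: "0 \<le> ct R x" "ct R x \<le> 1" for R x by (auto simp: ct_def)
    have "(\<lambda>n. \<integral>x. 1 - ct (real n) x \<partial>\<nu>) \<longlonglongrightarrow> (\<integral>x. 0 \<partial>\<nu>)"
    proof (rule integral_dominated_convergence[where w = "\<lambda>_. 1"])
      show "AE x in \<nu>. (\<lambda>n. 1 - ct (real n) x) \<longlonglongrightarrow> 0"
      proof (intro AE_I2)
        fix x :: real
        have "\<forall>\<^sub>F n in sequentially. 1 - ct (real n) x = 0"
          using eventually_ge_at_top[of "nat \<lceil>\<bar>x\<bar>\<rceil>"] by eventually_elim (auto simp: ct_def)
        then show "(\<lambda>n. 1 - ct (real n) x) \<longlonglongrightarrow> 0" by (rule tendsto_eventually)
      qed
    qed (use ctb in auto)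
    from LIMSEQ_D[OF this e] obtain n1 where "norm ((\<integral>x. 1 - ct (real n1) x \<partial>\<nu>) - (\<integral>x. 0 \<partial>\<nu>)) < e" by blast
    then have tail: "(\<integral>x. 1 - ct (real n1) x \<partial>\<nu>) < e" by simp
    \<comment> \<open>One more than the plateau, so that the cutoff vanishes outside
      \<open>[-R, R]\<close>; it also makes \<open>R\<close> positive when
      \<open>n1 = 0\<close>.\<close>
    define R where "R = real n1 + 1"
    have R: "R > 0" by (simp add: R_def)
    define c where "c = ct (real n1)"
    have c0: "c x = 0" if "x \<notin> {-R..R}" for x using that by (auto simp: c_def ct_def R_def)
    have cb: "0 \<le> c x" "c x \<le> 1" for x by (simp_all add: c_def ctb)
    have cm [measurable]: "c \<in> borel_measurable borel" by (simp add: c_def)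
    have tail: "(\<integral>x. 1 - c x \<partial>\<nu>) < e" using tail by (simp add: c_def)
    define B where "B k = {w \<in> space M. \<forall>q. real_of_rat q \<in> {-R<..<R} \<longrightarrow> \<bar>F (P w, real_of_rat q) - F (p k, real_of_rat q)\<bar> \<le> e}" for k
    have Bm [measurable]: "B k \<in> events" for k
unfolding B_def by measurable
    have BD: "\<bar>F (P w, x) - F (p k, x)\<bar> \<le> e" if w: "w \<in> B k" and x: "x \<in> {-R..R}" for w k x
    proof (rule continuous_le_on_rational_interval[of "-R" R "\<lambda>x. \<bar>F (P w, x) - F (p k, x)\<bar>"])
      have "w \<in> space M" using w by (simp add: B_def)
      then show "continuous_on {-R..R} (\<lambda>x. \<bar>F (P w, x) - F (p k, x)\<bar>)"
        by (intro continuous_intros continuous_on_subset[OF Fcont] Pc pc) auto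
    qed (use w x R in \<open>auto simp: B_def\<close>)
    have Bcov: "\<exists>k. w \<in> B k" if w: "w \<in> space M" for w
    proof (rule ccontr)
      assume "\<not> ?thesis"
      \<comment> \<open>Points at which every selected approximation fails. A subsequence converges
        in the compact interval, and along it both values of \<open>F\<close> tend to
        \<open>F (P w, y)\<close>, although they stay \<open>e\<close> apart.\<close>
      then have "\<forall>m. \<exists>x\<in>{-R..R}. \<bar>F (P w, x) - F (p (\<kappa> m w), x)\<bar> > e"
        using w R unfolding B_def by (force simp: not_le)
      then obtain x where x: "\<And>m. x m \<in> {-R..R}" "\<And>m. \<bar>F (P w, x m) - F (p (\<kappa> m w), x m)\<bar> > e" by metis
      obtain y r where yr: "y \<in> {-R..R}" "strict_mono r" "(x \<circ> r) \<longlonglongrightarrow> y"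
        using compact_Icc[of "-R" R] x(1) unfolding compact_def by blast
      have "(\<lambda>m. F (p (\<kappa> (r m) w), x (r m))) \<longlonglongrightarrow> F (P w, y)"
        using lim[OF w yr(2), of "x \<circ> r" y] yr(3) by (simp add: o_def)
      moreover have "(\<lambda>m. F (P w, x (r m))) \<longlonglongrightarrow> F (P w, y)"
        using Fcont[OF Pc[OF w]] yr(3) by (auto simp: continuous_on_eq_continuous_at o_def intro: isCont_tendsto_compose)
      ultimately have "(\<lambda>m. \<bar>F (P w, x (r m)) - F (p (\<kappa> (r m) w), x (r m))\<bar>) \<longlonglongrightarrow> \<bar>F (P w, y) - F (P w, y)\<bar>"
        by (intro tendsto_intros)
      then have "(\<lambda>m. \<bar>F (P w, x (r m)) - F (p (\<kappa> (r m) w), x (r m))\<bar>) \<longlonglongrightarrow> 0" by simp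
      then have "e \<le> 0" using x(2) by (intro LIMSEQ_le_const) (auto simp: less_imp_le)
      with e show False by simp
    qed
    \<comment> \<open>The sets \<open>B k\<close> cover the space, so finitely many of them leave
      out probability less than \<open>e\<close>. Disjointing them later makes at most one summand
      of \<open>\<Psi>\<close> active at each outcome.\<close>
    define U where "U m = (\<Union>k<m. B k)" for m
    have "(\<lambda>m. prob (U m)) \<longlonglongrightarrow> prob (\<Union>m. U m)"
      by (rule finite_Lim_measure_incseq) (auto simp: U_def incseq_def intro: less_le_trans)
    moreover have "(\<Union>m. U m) = space M"
    proof
      show "(\<Union>m. U m) \<subseteq> space M" by (auto simp: U_def B_def)
      show "space M \<subseteq> (\<Union>m. U m)" unfolding U_def using Bcov by blast
    qed
    ultimately have "(\<lambda>m. prob (U m)) \<longlonglongrightarrow> 1" by (simp add: prob_space)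
    from LIMSEQ_D[OF this e] obtain m where "\<bar>prob (U m) - 1\<bar> < e" by auto
    then have Um: "prob (space M - U m) < e" by (subst prob_compl) (auto simp: U_def)
    define A where "A = disjointed B"
    have Am [measurable]: "A k \<in> events" for k 
    proof -
      have "range B \<subseteq> events" using Bm by blast
      from sets.range_disjointed_sets[OF this] show ?thesis unfolding A_def by blast
    qed
    have AB: "A k \<subseteq> B k" for k unfolding A_def by (rule disjointed_subset)
    have AU: "(\<Union>k<m. A k) = U m" unfolding A_def U_def using finite_UN_disjointed_eq[of B m] by (simp add: lessThan_atLeast0)
    have Adisj: "i \<noteq> j \<Longrightarrow> A i \<inter> A j = {}" for i j
      unfolding A_def using disjoint_family_disjointed[of B] by (auto simp: disjoint_family_on_def)
    define h where "h k x = c x * F (p k, x)" for k x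
    have hm [measurable]: "h k \<in> borel_measurable borel" for k unfolding h_def by measurable
    have hc: "continuous_on UNIV (h k)" for k unfolding h_def c_def by (intro continuous_intros ctc Fcont pc)
    have hb: "\<bar>h k x\<bar> \<le> K" for k x
    proof -
      have "\<bar>c x\<bar> * \<bar>F (p k, x)\<bar> \<le> 1 * K" using cb[of x] K[OF pc, of k x] by (intro mult_mono) auto
      then show ?thesis by (simp add: h_def abs_mult)
    qed
    define \<Psi> where "\<Psi> w x = (\<Sum>k<m. indicator (A k) w * h k x)" for w x
    \<comment> \<open>Three sources of error: replacing the path by \<open>p k\<close> on
      \<open>[-R, R]\<close>, the cutoff in \<open>x\<close>, and the outcomes outside
      \<open>U m\<close>.\<close>
    have key: "\<bar>F (P w, x) - \<Psi> w x\<bar> \<le> e + K * (1 - c x) + K * indicator (space M - U m) w" if w: "w \<in> space M" for w x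
    proof (cases "w \<in> U m")
      case True
      then obtain j where j: "j < m" "w \<in> A j" using AU by auto
      have "indicator (A k) w = (if k = j then 1 else (0::real))" for k using Adisj[of k j] j by (auto simp: indicator_def)
      then have \<Psi>: "\<Psi> w x = h j x" unfolding \<Psi>_def using j by (simp add: if_distrib[of "\<lambda>c. c * _"] cong: if_cong)
      have "F (P w, x) - h j x = (1 - c x) * F (P w, x) + c x * (F (P w, x) - F (p j, x))"
        by (simp add: h_def algebra_simps)
      moreover have "\<bar>(1 - c x) * F (P w, x)\<bar> \<le> (1 - c x) * K"
        unfolding abs_mult using cb[of x] K[OF Pc[OF w], of x] by (intro mult_mono) auto
      moreover have "\<bar>c x * (F (P w, x) - F (p j, x))\<bar> \<le> e"
      proof (cases "x \<in> {-R..R}")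
        case True
        then have "\<bar>F (P w, x) - F (p j, x)\<bar> \<le> e" using BD AB j(2) by blast
        then have "\<bar>c x * (F (P w, x) - F (p j, x))\<bar> \<le> 1 * e"
          unfolding abs_mult using cb[of x] by (intro mult_mono) auto
        then show ?thesis by simp
      qed (use c0 e in auto)
      ultimately show ?thesis using True \<Psi> by (simp add: mult.commute)
    next
      case False
      then have "w \<notin> A k" if "k < m" for k using AU that by blast
      then have "\<Psi> w x = 0" unfolding \<Psi>_def by simp
      moreover have "0 \<le> K * (1 - c x)" using K_nonneg cb[of x] by simp
      ultimately show ?thesis using K[OF Pc[OF w], of x] False w e by simp
    qed
    have i1: "integrable M (\<lambda>w. F (P w, X n w))" for n
      using K[OF Pc] by (intro integrable_const_bound[where B=K]) auto
    have \<Psi>b: "\<bar>\<Psi> w x\<bar> \<le> real m * K" for w x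
    proof -
      have "\<bar>\<Psi> w x\<bar> \<le> (\<Sum>k<m. \<bar>indicator (A k) w * h k x\<bar>)" unfolding \<Psi>_def by (rule sum_abs)
      also have "\<dots> \<le> (\<Sum>k<m. K)" using hb K_nonneg by (intro sum_mono) (auto simp: indicator_def)
      finally show ?thesis by simp
    qed
    have \<Psi>m [measurable]: "(\<lambda>w. \<Psi> w (X n w)) \<in> borel_measurable M" for n unfolding \<Psi>_def by measurable
    have \<Psi>m' [measurable]: "\<Psi> w \<in> borel_measurable borel" for w unfolding \<Psi>_def by measurable
    have i2: "integrable M (\<lambda>w. \<Psi> w (X n w))" for n
      using \<Psi>b by (intro integrable_const_bound[where B="real m * K"]) auto
    have i3: "integrable M (\<lambda>w. e + K * (1 - c (X n w)) + K * indicator (space M - U m) w)" for n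
    proof -
      have "U m \<in> events" by (simp add: U_def)
      then have [measurable]: "space M - U m \<in> events" by auto
      have "integrable M (\<lambda>w. 1 - c (X n w))" by (intro integrable_const_bound[where B=1]) (use cb in auto)
      then show ?thesis by (intro Bochner_Integration.integrable_add integrable_mult_right) (auto simp: emeasure_eq_measure)
    qed
    have U1: "expectation (indicator (space M - U m)) = prob (space M - U m)"
      by (subst Bochner_Integration.integral_indicator) (auto simp: U_def Int_absorb2)
    have b1: "\<bar>?a n - expectation (\<lambda>w. \<Psi> w (X n w))\<bar> \<le> e + K * expectation (\<lambda>w. 1 - c (X n w)) + K * e" for n
    proof -
      have "\<bar>?a n - expectation (\<lambda>w. \<Psi> w (X n w))\<bar> = \<bar>expectation (\<lambda>w. F (P w, X n w) - \<Psi> w (X n w))\<bar>"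
        using i1 i2 by simp
      also have "\<dots> \<le> expectation (\<lambda>w. \<bar>F (P w, X n w) - \<Psi> w (X n w)\<bar>)" by (rule integral_abs_bound)
      also have "\<dots> \<le> expectation (\<lambda>w. e + K * (1 - c (X n w)) + K * indicator (space M - U m) w)"
        using i1 i2 i3 key by (intro integral_mono integrable_abs Bochner_Integration.integrable_diff) auto
      also have "\<dots> = e + K * expectation (\<lambda>w. 1 - c (X n w)) + K * prob (space M - U m)"
      proof -
        have [measurable]: "space M - U m \<in> events" by (auto simp: U_def)
        have "integrable M (\<lambda>w. 1 - c (X n w))" by (intro integrable_const_bound[where B=1]) (use cb in auto)
        moreover have "integrable M (indicator (space M - U m) :: 'a \<Rightarrow> real)" by (auto simp: emeasure_eq_measure)
        ultimately show ?thesis unfolding U1[symmetric] by (rule integral_affine)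
      qed
      also have "\<dots> \<le> e + K * expectation (\<lambda>w. 1 - c (X n w)) + K * e" using Um K_nonneg by (intro add_mono mult_left_mono) auto
      finally show ?thesis .
    qed
    have eqn: "expectation (\<lambda>w. \<Psi> w (X n w)) = (\<Sum>k<m. expectation (\<lambda>w. indicator (A k) w * h k (X n w)))" for n
      unfolding \<Psi>_def using hb K_nonneg
      by (intro Bochner_Integration.integral_sum integrable_const_bound[where B=K]) (auto simp: indicator_def)
    have ih: "integrable \<nu> (h k)" for k using hb by (intro N.integrable_const_bound[where B=K]) auto
    have L\<Psi>: "(\<integral>x. \<Psi> w x \<partial>\<nu>) = (\<Sum>k<m. indicator (A k) w * (\<integral>x. h k x \<partial>\<nu>))" for w
      unfolding \<Psi>_def using ih by simp
    have eqL: "expectation (\<lambda>w. \<integral>x. \<Psi> w x \<partial>\<nu>) = (\<Sum>k<m. prob (A k) * (\<integral>x. h k x \<partial>\<nu>))"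
      unfolding L\<Psi> by (subst Bochner_Integration.integral_sum) (auto simp: emeasure_eq_measure)
    have b2: "\<bar>?L - expectation (\<lambda>w. \<integral>x. \<Psi> w x \<partial>\<nu>)\<bar> \<le> e + K * e + K * e"
    proof -
      have inner: "\<bar>(\<integral>x. F (P w, x) \<partial>\<nu>) - (\<integral>x. \<Psi> w x \<partial>\<nu>)\<bar> \<le> e + K * e + K * indicator (space M - U m) w" if w: "w \<in> space M" for w
      proof -
        have 1: "integrable \<nu> (\<lambda>x. F (P w, x))" using K[OF Pc[OF w]] Fwm[OF w] by (intro N.integrable_const_bound[where B=K]) auto
        have 2: "integrable \<nu> (\<lambda>x. \<Psi> w x)" using \<Psi>b[of w] by (intro N.integrable_const_bound[where B="real m * K"]) auto
        have 3: "integrable \<nu> (\<lambda>x. 1 - c x)" by (intro N.integrable_const_bound[where B=1]) (use cb in auto)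
        have 4: "integrable \<nu> c" by (intro N.integrable_const_bound[where B=1]) (use cb in auto)
        have "\<bar>(\<integral>x. F (P w, x) \<partial>\<nu>) - (\<integral>x. \<Psi> w x \<partial>\<nu>)\<bar> = \<bar>\<integral>x. F (P w, x) - \<Psi> w x \<partial>\<nu>\<bar>" using 1 2 by simp
        also have "\<dots> \<le> (\<integral>x. \<bar>F (P w, x) - \<Psi> w x\<bar> \<partial>\<nu>)" by (rule integral_abs_bound)
        also have "\<dots> \<le> (\<integral>x. e + K * (1 - c x) + K * indicator (space M - U m) w \<partial>\<nu>)"
          using 1 2 3 4 key[OF w] by (intro integral_mono integrable_abs Bochner_Integration.integrable_diff
             Bochner_Integration.integrable_add integrable_mult_right) auto
        also have "\<dots> = e + K * (\<integral>x. 1 - c x \<partial>\<nu>) + K * indicator (space M - U m) w"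
          using N.integral_affine[OF 3, of "\<lambda>_. 1"] N.prob_space by simp
        also have "\<dots> \<le> e + K * e + K * indicator (space M - U m) w" using tail K_nonneg by (intro add_mono mult_left_mono) auto
        finally show ?thesis .
      qed
      have 1: "integrable M (\<lambda>w. \<integral>x. F (P w, x) \<partial>\<nu>)"
      proof (rule integrable_const_bound[where B=K])
        have "\<bar>\<integral>x. F (P w, x) \<partial>\<nu>\<bar> \<le> K" if w: "w \<in> space M" for w
        proof -
          have "\<bar>\<integral>x. F (P w, x) \<partial>\<nu>\<bar> \<le> (\<integral>x. \<bar>F (P w, x)\<bar> \<partial>\<nu>)" by (rule integral_abs_bound)
          also have "\<dots> \<le> (\<integral>x. K \<partial>\<nu>)" using K_nonneg K[OF Pc[OF w]] Fwm[OF w]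
            by (intro integral_mono N.integrable_const_bound[where B=K]) auto
          finally show ?thesis using N.prob_space by simp
        qed
        then show "AE w in M. norm (\<integral>x. F (P w, x) \<partial>\<nu>) \<le> K" by auto
      qed simp
      have 2: "integrable M (\<lambda>w. \<integral>x. \<Psi> w x \<partial>\<nu>)" unfolding L\<Psi>
        by (intro Bochner_Integration.integrable_sum integrable_mult_left) (auto simp: emeasure_eq_measure)
      have [measurable]: "space M - U m \<in> events" by (auto simp: U_def)
      have 3: "integrable M (indicator (space M - U m) :: 'a \<Rightarrow> real)" by (auto simp: emeasure_eq_measure)
      have "\<bar>?L - expectation (\<lambda>w. \<integral>x. \<Psi> w x \<partial>\<nu>)\<bar> = \<bar>expectation (\<lambda>w. (\<integral>x. F (P w, x) \<partial>\<nu>) - (\<integral>x. \<Psi> w x \<partial>\<nu>))\<bar>" using 1 2 by simp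
      also have "\<dots> \<le> expectation (\<lambda>w. \<bar>(\<integral>x. F (P w, x) \<partial>\<nu>) - (\<integral>x. \<Psi> w x \<partial>\<nu>)\<bar>)" by (rule integral_abs_bound)
      also have "\<dots> \<le> expectation (\<lambda>w. e + K * e + K * indicator (space M - U m) w)"
        using 1 2 3 inner by (intro integral_mono integrable_abs Bochner_Integration.integrable_diff
             Bochner_Integration.integrable_add integrable_mult_right) auto
      also have "\<dots> = e + K * e + K * prob (space M - U m)" using 3 U1
        by (subst Bochner_Integration.integral_add) (auto simp: prob_space)
      also have "\<dots> \<le> e + K * e + K * e" using Um K_nonneg by (intro add_mono mult_left_mono) auto
      finally show ?thesis .
    qed
    have "(\<lambda>n. expectation (\<lambda>w. \<Psi> w (X n w))) \<longlonglongrightarrow> expectation (\<lambda>w. \<integral>x. \<Psi> w x \<partial>\<nu>)"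
      unfolding eqn eqL by (intro tendsto_sum mix[OF _ hc hb]) auto
    from LIMSEQ_D[OF this e] obtain n2 where n2: "\<And>n. n \<ge> n2 \<Longrightarrow> \<bar>expectation (\<lambda>w. \<Psi> w (X n w)) - expectation (\<lambda>w. \<integral>x. \<Psi> w x \<partial>\<nu>)\<bar> < e"
      by auto
    have "(\<lambda>n. expectation (\<lambda>w. indicator (space M) w * (1 - c (X n w)))) \<longlonglongrightarrow> prob (space M) * (\<integral>x. 1 - c x \<partial>\<nu>)"
      by (rule mix[of "space M" "\<lambda>x. 1 - c x" 1]) (use cb in \<open>auto simp: c_def intro!: continuous_intros ctc\<close>)
    moreover have "expectation (\<lambda>w. indicator (space M) w * (1 - c (X n w))) = expectation (\<lambda>w. 1 - c (X n w))" for n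
      by (intro Bochner_Integration.integral_cong) auto
    ultimately have "(\<lambda>n. expectation (\<lambda>w. 1 - c (X n w))) \<longlonglongrightarrow> (\<integral>x. 1 - c x \<partial>\<nu>)" by (simp add: prob_space)
    from LIMSEQ_D[OF this e] obtain n3 where "\<And>n. n \<ge> n3 \<Longrightarrow> \<bar>expectation (\<lambda>w. 1 - c (X n w)) - (\<integral>x. 1 - c x \<partial>\<nu>)\<bar> < e"
      by auto
    then have n3: "expectation (\<lambda>w. 1 - c (X n w)) \<le> 2 * e" if "n \<ge> n3" for n using tail that by fastforce
    have "\<bar>?a n - ?L\<bar> \<le> (3 + 5 * K) * e" if n: "n \<ge> max n2 n3" for n
    proof -
      have "K * expectation (\<lambda>w. 1 - c (X n w)) \<le> K * (2 * e)" using n3[of n] n K_nonneg by (intro mult_left_mono) auto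
      \<comment> \<open>The groups come from \<open>b1\<close>, from convergence of the finite sum,
        and from \<open>b2\<close>. The cutoff costs \<open>2 * e\<close> in the first because for
        \<open>X n\<close> the tail is below \<open>e\<close> only up to a further
        \<open>e\<close>.\<close>
      then have "\<bar>?a n - ?L\<bar> \<le> (e + K * (2 * e) + K * e) + e + (e + K * e + K * e)"
        using b1[of n] b2 n2[of n] n by linarith
      then show ?thesis by (simp add: algebra_simps)
    qed
    then show ?thesis by blast
  qed
  show ?thesis
  proof (rule LIMSEQ_I)
    fix r :: real assume r: "r > 0"
    define e where "e = (r / 2) / (3 + 5 * K)"
    have e: "e > 0" using r K_nonneg by (simp add: e_def)
    have "3 + 5 * K \<noteq> 0" using K_nonneg by linarith
    then have "(3 + 5 * K) * e = r / 2" unfolding e_def by (rule nonzero_mult_div_cancel_left[of "3 + 5 * K" "r / 2", unfolded times_divide_eq_right[symmetric]])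
    then show "\<exists>no. \<forall>n\<ge>no. norm (?a n - ?L) < r" using main[OF e] r by fastforce
  qed
qed

end

subsection \<open>Gaussian spaces of path functionals\<close>

text \<open>Left-endpoint sums on the uniform grid: they exhibit path integrals as pointwise limits
  of linear combinations of the process.\<close>

lemma riemann_sum_tendsto:
  fixes f :: "real \<Rightarrow> real"
  assumes ab: "a \<le> b" and f: "continuous_on {a..b} f"
  shows "(\<lambda>n. \<Sum>k<Suc n. (b - a) / real (Suc n) * f (a + (b - a) * real k / real (Suc n))) \<longlonglongrightarrow> integral {a..b} f"
proof (cases "a = b")
  case False
  then have ab: "a < b" using ab by simp
  show ?thesis
  proof (rule LIMSEQ_I)
    fix e :: real assume e: "e > 0"
    define e' where "e' = e / 2 / (b - a)"
    have e': "e' > 0" using e ab by (simp add: e'_def)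
    have "uniformly_continuous_on {a..b} f" using f by (rule compact_uniformly_continuous) simp
    then obtain d where d: "d > 0" "\<And>x y. x \<in> {a..b} \<Longrightarrow> y \<in> {a..b} \<Longrightarrow> \<bar>x - y\<bar> < d \<Longrightarrow> \<bar>f x - f y\<bar> < e'"
      unfolding uniformly_continuous_on_def dist_real_def using e' by metis
    define F where "F x = integral {a..x} f" for x
    have F: "(F has_real_derivative f x) (at x within {a..b})" if "x \<in> {a..b}" for x
      unfolding F_def using integral_has_real_derivative[OF f that] .
    obtain N where N: "(b - a) / real (Suc N) < d"
    proof -
      obtain N where "(b - a) / d < real N" using reals_Archimedean2 by blast
      then have "(b - a) / d < real (Suc N)" by simp
      then have "(b - a) / real (Suc N) < d" using d(1) by (simp add: field_simps)
      then show ?thesis using that by blast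
    qed
    have "norm ((\<Sum>k<Suc n. (b - a) / real (Suc n) * f (a + (b - a) * real k / real (Suc n))) - integral {a..b} f) < e"
      if n: "n \<ge> N" for n
    proof -
      define h where "h = (b - a) / real (Suc n)"
      have h: "h > 0" using ab by (simp add: h_def)
      have hd: "h < d"
      proof -
        have "h \<le> (b - a) / real (Suc N)" unfolding h_def using n ab by (intro divide_left_mono) auto
        then show ?thesis using N by simp
      qed
      define t where "t k = a + (b - a) * real k / real (Suc n)" for k
      have tS: "t (Suc k) = t k + h" for k by (simp add: t_def h_def distrib_left add_divide_distrib)
      have t0: "t 0 = a" by (simp add: t_def)
      have tn: "t (Suc n) = b" by (simp add: t_def)
      have tm: "t k \<in> {a..b}" if "k \<le> Suc n" for k
      proof -
        have "(b - a) * real k / real (Suc n) \<le> (b - a) * 1"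
          using that ab by (simp only: times_divide_eq_right[symmetric]) (intro mult_left_mono, auto)
        then show ?thesis using ab by (auto simp: t_def)
      qed
      have step: "\<bar>h * f (t k) - (F (t (Suc k)) - F (t k))\<bar> \<le> h * e'" if k: "k < Suc n" for k
      proof -
        have sub: "{t k..t (Suc k)} \<subseteq> {a..b}" using tm[of k] tm[of "Suc k"] k by auto
        \<comment> \<open>The mean value theorem for the primitive turns the integral over a cell
          into one value of \<open>f\<close> in that cell; uniform continuity compares it with the
          left endpoint.\<close>
        have "\<exists>x\<in>{t k<..<t (Suc k)}. F (t (Suc k)) - F (t k) = f x * (t (Suc k) - t k)"
        proof (rule mvt_simple[of "t k" "t (Suc k)" F "\<lambda>x y. f x * y"])
          show "t k < t (Suc k)" using h by (simp add: tS)
          fix x assume x: "t k \<le> x" "x \<le> t (Suc k)"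
          then have "x \<in> {a..b}" using sub by auto
          from has_field_derivative_subset[OF F[OF this] sub]
          show "(F has_derivative (\<lambda>y. f x * y)) (at x within {t k..t (Suc k)})"
            by (simp add: has_field_derivative_def)
        qed
        then obtain x where x: "x \<in> {t k<..<t (Suc k)}" "F (t (Suc k)) - F (t k) = f x * h" by (auto simp: tS)
        have "\<bar>f (t k) - f x\<bar> < e'"
        proof (rule d(2))
          show "x \<in> {a..b}" using x sub by auto
          show "t k \<in> {a..b}" using tm k by auto
          show "\<bar>t k - x\<bar> < d" using x(1) hd by (auto simp: tS)
        qed
        then have "h * \<bar>f (t k) - f x\<bar> \<le> h * e'" using h by (intro mult_left_mono) auto
        moreover have "h * f (t k) - f x * h = h * (f (t k) - f x)" by (simp add: algebra_simps)
        ultimately show ?thesis unfolding x(2) using h by (simp add: abs_mult)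
      qed
      have "integral {a..b} f = F (t (Suc n)) - F (t 0)" by (simp add: tn t0 F_def)
      also have "\<dots> = (\<Sum>k<Suc n. F (t (Suc k)) - F (t k))" by (rule sum_lessThan_telescope[symmetric])
      finally have "(\<Sum>k<Suc n. h * f (t k)) - integral {a..b} f = (\<Sum>k<Suc n. h * f (t k) - (F (t (Suc k)) - F (t k)))"
        by (simp add: sum_subtractf)
      also have "\<bar>\<dots>\<bar> \<le> (\<Sum>k<Suc n. h * e')"
        by (intro order_trans[OF sum_abs] sum_mono step) auto
      also have "\<dots> = (real (Suc n) * h) * e'" by simp
      also have "real (Suc n) * h = b - a" by (simp add: h_def del: of_nat_Suc)
      also have "(b - a) * e' = e / 2"
        unfolding e'_def using ab nonzero_mult_div_cancel_left[of "b - a" "e / 2"] by (simp del: nonzero_mult_div_cancel_left)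
      finally show ?thesis unfolding h_def t_def using e by simp
    qed
    then show "\<exists>no. \<forall>n\<ge>no. norm ((\<Sum>k<Suc n. (b - a) / real (Suc n) * f (a + (b - a) * real k / real (Suc n))) - integral {a..b} f) < e"
      by blast
  qed
qed simp

text \<open>The absolute values come from \<open>sqrt\<close> being odd: for negative
  \<open>v\<close> the law is still Gaussian with variance \<open>\<bar>v\<bar>\<close>. A parameter
  of unknown sign can therefore be handled throughout.\<close>

lemma gauss_law_moments:
  "integrable (gauss_law v) (\<lambda>x. x ^ k)"
  "(\<integral>x. x\<^sup>2 \<partial>gauss_law v) = \<bar>v\<bar>" "(\<integral>x. x ^ 4 \<partial>gauss_law v) = 3 * v\<^sup>2"
  "(\<integral>x. cos (a * x) \<partial>gauss_law v) = exp (- (a\<^sup>2 * \<bar>v\<bar>) / 2)"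
proof -
  interpret std: prob_space std_normal_distribution using prob_space_normal_density[of 1 0] by simp
  have s2: "(sqrt v)\<^sup>2 = \<bar>v\<bar>" by (simp add: power2_eq_square real_sqrt_mult[symmetric])
  have s4: "(sqrt v) ^ 4 = v\<^sup>2" using arg_cong[OF s2, of "\<lambda>x. x\<^sup>2"] by (simp flip: power_mult)
  show "integrable (gauss_law v) (\<lambda>x. x ^ k)"
    unfolding gauss_law_def
    by (subst integrable_distr_eq) (auto simp: power_mult_distrib intro!: integrable_mult_right integrable_std_normal_distribution_moment)
  show "(\<integral>x. x\<^sup>2 \<partial>gauss_law v) = \<bar>v\<bar>"
    unfolding gauss_law_def using std_normal_distribution_even_moments(1)[of 1] s2
    by (subst integral_distr) (auto simp: power_mult_distrib)
  show "(\<integral>x. x ^ 4 \<partial>gauss_law v) = 3 * v\<^sup>2"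
    unfolding gauss_law_def using std_normal_distribution_even_moments(1)[of 2] s4
    by (subst integral_distr) (auto simp: power_mult_distrib fact_numeral)
  have "char std_normal_distribution (a * sqrt v) = complex_of_real (exp (- (a\<^sup>2 * \<bar>v\<bar>) / 2))"
    by (simp add: char_std_normal_distribution power_mult_distrib s2)
  moreover have "char std_normal_distribution (a * sqrt v) = char (distr std_normal_distribution borel (\<lambda>x. x)) (a * sqrt v)"
    unfolding char_def by (subst integral_distr) auto
  ultimately have "std.expectation (\<lambda>x. cos (a * sqrt v * x)) = exp (- (a\<^sup>2 * \<bar>v\<bar>) / 2)"
    by (subst (asm) std.char_distr_eq) (auto simp: complex_eq_iff)
  then show "(\<integral>x. cos (a * x) \<partial>gauss_law v) = exp (- (a\<^sup>2 * \<bar>v\<bar>) / 2)"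
    unfolding gauss_law_def by (subst integral_distr) (auto simp: mult.assoc)
qed

text \<open>Paths are continuous on the whole line while Gaussianity concerns nonnegative times: the
  intended instance is a motion frozen at its initial value, \<open>B (max 0 t)\<close>, whose
  shifted paths can be integrated without side conditions.\<close>

locale gaussian_process = prob_space M for M :: "'a measure" +
  fixes W :: "real \<Rightarrow> 'a \<Rightarrow> real"
  assumes W_measurable [measurable]: "\<And>t. W t \<in> borel_measurable M"
    and W_continuous: "\<And>w. w \<in> space M \<Longrightarrow> continuous_on UNIV (\<lambda>t. W t w)"
    and W_gauss: "\<And>I c. finite I \<Longrightarrow> I \<subseteq> {0..} \<Longrightarrow> \<exists>v. distr M borel (\<lambda>w. \<Sum>t\<in>I. c t * W t w) = gauss_law v"
begin

text \<open>Generated one term at a time and not indexed by a set of times, so that sums are linear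
  combinations without merging index sets. The merging is done once, in
  \<open>lincomb_repr\<close>.\<close>

inductive lincomb :: "('a \<Rightarrow> real) \<Rightarrow> bool" where
  zero: "lincomb (\<lambda>_. 0)"
| add: "lincomb X \<Longrightarrow> t \<ge> 0 \<Longrightarrow> lincomb (\<lambda>w. X w + c * W t w)"

lemma lincomb_repr:
  assumes "lincomb X"
  shows "\<exists>I c. finite I \<and> I \<subseteq> {0..} \<and> X = (\<lambda>w. \<Sum>t\<in>I. c t * W t w)"
  using assms
proof induction
  case zero
  show ?case by (rule exI[of _ "{}"]) auto
next
  case (add X t d)
  then obtain I c where I: "finite I" "I \<subseteq> {0..}" "X = (\<lambda>w. \<Sum>t\<in>I. c t * W t w)" by blast
  show ?case
  proof (cases "t \<in> I")
    case True
    have "(\<Sum>s\<in>I. (c(t := c t + d)) s * W s w) = (\<Sum>s\<in>I. c s * W s w) + d * W t w" for w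
    proof -
      have "(\<Sum>s\<in>I. (c(t := c t + d)) s * W s w) = (c t + d) * W t w + (\<Sum>s\<in>I - {t}. c s * W s w)"
        using True I(1) by (subst sum.remove[of I t]) (auto intro!: sum.cong)
      also have "\<dots> = (\<Sum>s\<in>I. c s * W s w) + d * W t w"
        using True I(1) by (subst sum.remove[of I t]) (auto simp: algebra_simps)
      finally show ?thesis .
    qed
    then show ?thesis using I by (intro exI[of _ I] exI[of _ "c(t := c t + d)"]) auto
  next
    case False
    have "(\<Sum>s\<in>insert t I. (c(t := d)) s * W s w) = (\<Sum>s\<in>I. c s * W s w) + d * W t w" for w
    proof -
      have "(\<Sum>s\<in>I. (c(t := d)) s * W s w) = (\<Sum>s\<in>I. c s * W s w)" using False by (intro sum.cong) auto
      then show ?thesis using False I(1) by simp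
    qed
    then show ?thesis using I add.hyps by (intro exI[of _ "insert t I"] exI[of _ "c(t := d)"]) auto
  qed
qed

lemma lincomb_measurable: "lincomb X \<Longrightarrow> X \<in> borel_measurable M"
  by (induction rule: lincomb.induct) auto

lemma lincomb_gauss: "lincomb X \<Longrightarrow> \<exists>v. distr M borel X = gauss_law v"
  using lincomb_repr W_gauss by metis

lemma lincomb_scale: "lincomb X \<Longrightarrow> lincomb (\<lambda>w. a * X w)"
proof (induction rule: lincomb.induct)
  case zero
  then show ?case using lincomb.zero by simp
next
  case (add X t c)
  from lincomb.add[OF add.IH add.hyps(2), of "a * c"] show ?case by (simp add: algebra_simps)
qed

lemma lincomb_add:
  assumes "lincomb X" "lincomb Y"
  shows "lincomb (\<lambda>w. X w + Y w)"
  using assms(2)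
proof (induction rule: lincomb.induct)
  case (add Y t c)
  from lincomb.add[OF add.IH add.hyps(2), of c] show ?case by (simp add: algebra_simps)
qed (use assms(1) in simp)

lemma lincomb_W: "t \<ge> 0 \<Longrightarrow> lincomb (W t)"
  using lincomb.add[OF lincomb.zero, of t 1] by simp

lemma lincomb_sum: "(\<And>k. k \<in> S \<Longrightarrow> lincomb (X k)) \<Longrightarrow> lincomb (\<lambda>w. \<Sum>k\<in>S. X k w)"
  by (induction S rule: infinite_finite_induct) (auto intro: lincomb.zero lincomb_add)

text \<open>Limits for every outcome instead of limits in mean square: path integrals are of this
  form through Riemann sums, and Gaussianity survives by dominated convergence of characteristic
  functions.\<close>

definition glim :: "('a \<Rightarrow> real) \<Rightarrow> bool" where
  "glim X \<longleftrightarrow> (\<exists>Z. (\<forall>n. lincomb (Z n)) \<and> (\<forall>w\<in>space M. (\<lambda>n. Z n w) \<longlonglongrightarrow> X w))"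

lemma glim_lincomb: "lincomb X \<Longrightarrow> glim X"
  unfolding glim_def by (intro exI[of _ "\<lambda>_. X"]) auto

lemma glim_measurable: assumes "glim X" shows "X \<in> borel_measurable M"
proof -
  from assms obtain Z where "\<And>n. lincomb (Z n)" "\<And>w. w \<in> space M \<Longrightarrow> (\<lambda>n. Z n w) \<longlonglongrightarrow> X w"
    unfolding glim_def by blast
  then show ?thesis by (intro borel_measurable_LIMSEQ_real[of M Z X]) (auto intro: lincomb_measurable)
qed

lemma glim_add:
  assumes "glim X" "glim Y" shows "glim (\<lambda>w. X w + Y w)"
proof -
  from assms obtain Z1 Z2 where "\<And>n. lincomb (Z1 n)" "\<And>w. w \<in> space M \<Longrightarrow> (\<lambda>n. Z1 n w) \<longlonglongrightarrow> X w"
    "\<And>n. lincomb (Z2 n)" "\<And>w. w \<in> space M \<Longrightarrow> (\<lambda>n. Z2 n w) \<longlonglongrightarrow> Y w"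
    unfolding glim_def by blast
  then show ?thesis unfolding glim_def
    by (intro exI[of _ "\<lambda>n w. Z1 n w + Z2 n w"]) (auto intro: lincomb_add tendsto_add)
qed

lemma glim_scale:
  assumes "glim X" shows "glim (\<lambda>w. a * X w)"
proof -
  from assms obtain Z where "\<And>n. lincomb (Z n)" "\<And>w. w \<in> space M \<Longrightarrow> (\<lambda>n. Z n w) \<longlonglongrightarrow> X w"
    unfolding glim_def by blast
  then show ?thesis unfolding glim_def
    by (intro exI[of _ "\<lambda>n w. a * Z n w"]) (auto intro: lincomb_scale tendsto_mult_left)
qed

lemma glim_diff: "glim X \<Longrightarrow> glim Y \<Longrightarrow> glim (\<lambda>w. X w - Y w)"
  using glim_add[of X "\<lambda>w. (-1) * Y w"] glim_scale[of Y "-1"] by simp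

lemma glim_integral:
  fixes a b :: real
  assumes ab: "a \<le> b" and \<phi>: "continuous_on {a..b} \<phi>"
    and D: "\<And>u. u \<in> {a..b} \<Longrightarrow> lincomb (D u)"
    and Dc: "\<And>w. w \<in> space M \<Longrightarrow> continuous_on {a..b} (\<lambda>u. D u w)"
  shows "glim (\<lambda>w. integral {a..b} (\<lambda>u. \<phi> u * D u w))"
  unfolding glim_def
proof (intro exI conjI allI ballI)
  let ?t = "\<lambda>n k. a + (b - a) * real k / real (Suc n)"
  fix n
  show "lincomb (\<lambda>w. \<Sum>k<Suc n. (b - a) / real (Suc n) * (\<phi> (?t n k) * D (?t n k) w))"
  proof (intro lincomb_sum)
    fix k assume "k \<in> {..<Suc n}"
    then have "(b - a) * (real k / real (Suc n)) \<le> (b - a) * 1" using ab by (intro mult_left_mono) auto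
    then have "?t n k \<in> {a..b}" using ab by auto
    from lincomb_scale[OF D[OF this], of "(b - a) / real (Suc n) * \<phi> (?t n k)"]
    show "lincomb (\<lambda>w. (b - a) / real (Suc n) * (\<phi> (?t n k) * D (?t n k) w))" by (simp add: mult.assoc)
  qed
next
  fix w assume "w \<in> space M"
  then show "(\<lambda>n. \<Sum>k<Suc n. (b - a) / real (Suc n) * (\<phi> (a + (b - a) * real k / real (Suc n)) * D (a + (b - a) * real k / real (Suc n)) w))
     \<longlonglongrightarrow> integral {a..b} (\<lambda>u. \<phi> u * D u w)"
    by (intro riemann_sum_tendsto ab continuous_intros \<phi> Dc)
qed

text \<open>The variances of an approximating sequence converge because the limiting characteristic
  function is continuous at 0, hence nonzero near 0.\<close>

lemma glim_gauss:
  assumes "glim X" shows "\<exists>v\<ge>0. distr M borel X = gauss_law v"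
proof -
  from assms obtain Z where Z: "\<And>n. lincomb (Z n)" and lim: "\<And>w. w \<in> space M \<Longrightarrow> (\<lambda>n. Z n w) \<longlonglongrightarrow> X w"
    unfolding glim_def by blast
  have [measurable]: "X \<in> borel_measurable M" by (rule glim_measurable[OF assms])
  have Zm [measurable]: "Z n \<in> borel_measurable M" for n by (rule lincomb_measurable[OF Z])
  from lincomb_gauss[OF Z] obtain v where v: "\<And>n. distr M borel (Z n) = gauss_law (v n)" by metis
  have cosZ: "expectation (\<lambda>w. cos (a * Z n w)) = exp (- (a\<^sup>2 * \<bar>v n\<bar>) / 2)" for a n
    unfolding gauss_law_moments(4)[symmetric] v[symmetric] by (subst integral_distr) auto
  have cosl: "(\<lambda>n. exp (- (a\<^sup>2 * \<bar>v n\<bar>) / 2)) \<longlonglongrightarrow> expectation (\<lambda>w. cos (a * X w))" for a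
    unfolding cosZ[symmetric]
    by (rule integral_dominated_convergence[where w = "\<lambda>_. 1"]) (auto intro!: tendsto_intros lim)
  have "(\<lambda>n. expectation (\<lambda>w. cos (inverse (real (Suc n)) * X w))) \<longlonglongrightarrow> expectation (\<lambda>w. cos (0 * X w))"
  proof (rule integral_dominated_convergence[where w = "\<lambda>_. 1"])
    show "AE w in M. (\<lambda>n. cos (inverse (real (Suc n)) * X w)) \<longlonglongrightarrow> cos (0 * X w)"
      by (intro AE_I2 tendsto_intros LIMSEQ_inverse_real_of_nat)
  qed auto
  then have "(\<lambda>n. expectation (\<lambda>w. cos (inverse (real (Suc n)) * X w))) \<longlonglongrightarrow> 1" by (simp add: prob_space)
  from LIMSEQ_D[OF this, of 1] obtain m where m: "\<bar>expectation (\<lambda>w. cos (inverse (real (Suc m)) * X w)) - 1\<bar> < 1" by auto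
  define a where "a = inverse (real (Suc m))"
  have a: "a > 0" by (simp add: a_def)
  define c where "c = expectation (\<lambda>w. cos (a * X w))"
  have c: "c > 0" using m unfolding c_def a_def by linarith
  \<comment> \<open>Solves \<open>c = exp (- a\<^sup>2 * V / 2)\<close>. Since \<open>ln\<close> is
    continuous at \<open>c > 0\<close>, convergence at this single frequency already forces the
    variances to converge.\<close>
  define V where "V = - 2 * ln c / a\<^sup>2"
  have "(\<lambda>n. - 2 * ln (exp (- (a\<^sup>2 * \<bar>v n\<bar>) / 2)) / a\<^sup>2) \<longlonglongrightarrow> V"
    unfolding V_def c_def using cosl[of a] c a by (intro tendsto_intros) (auto simp: c_def)
  then have vV: "(\<lambda>n. \<bar>v n\<bar>) \<longlonglongrightarrow> V" using a by simp
  then have V0: "V \<ge> 0" by (rule LIMSEQ_le_const) auto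
  have cosX: "expectation (\<lambda>w. cos (b * X w)) = exp (- (b\<^sup>2 * V) / 2)" for b
    by (rule LIMSEQ_unique[OF cosl]) (intro tendsto_intros vV, auto)
  have sinZ: "expectation (\<lambda>w. sin (b * Z n w)) = 0" for b n
  proof -
    have "char (distr M borel (Z n)) b = complex_of_real (exp (- (b\<^sup>2 * \<bar>v n\<bar>) / 2))"
    proof -
      have "char (gauss_law (v n)) b = char std_normal_distribution (b * sqrt (v n))"
        unfolding char_def gauss_law_def by (subst integral_distr) (auto simp: ac_simps)
      also have "\<dots> = complex_of_real (exp (- (b\<^sup>2 * \<bar>v n\<bar>) / 2))"
        by (simp add: char_std_normal_distribution power_mult_distrib power2_eq_square[of "sqrt _"] real_sqrt_mult[symmetric])
      finally show ?thesis by (simp add: v)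
    qed
    then show ?thesis by (subst (asm) char_distr_eq) (auto simp: complex_eq_iff)
  qed
  have "(\<lambda>n. expectation (\<lambda>w. sin (b * Z n w))) \<longlonglongrightarrow> expectation (\<lambda>w. sin (b * X w))" for b
    by (rule integral_dominated_convergence[where w = "\<lambda>_. 1"]) (auto intro!: tendsto_intros lim)
  then have sinX: "expectation (\<lambda>w. sin (b * X w)) = 0" for b
    unfolding sinZ using LIMSEQ_unique tendsto_const by blast
  have "distr M borel X = gauss_law V"
  proof (rule Levy_uniqueness)
    show "real_distribution (distr M borel X)" by (rule real_distribution_distr) simp
    show "char (distr M borel X) = char (gauss_law V)"
      by (rule ext) (subst char_distr_eq, auto simp: cosX sinX char_gauss_law[OF V0])
  qed (rule real_distribution_gauss_law)
  with V0 show ?thesis by blast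
qed

lemma glim_moments:
  assumes "glim X"
  shows "integrable M (\<lambda>w. X w ^ k)"
    and "expectation (\<lambda>w. X w ^ 4) = 3 * (expectation (\<lambda>w. (X w)\<^sup>2))\<^sup>2"
    and "expectation (\<lambda>w. cos (a * X w)) = exp (- (a\<^sup>2 * expectation (\<lambda>w. (X w)\<^sup>2)) / 2)"
proof -
  obtain v where v: "v \<ge> 0" "distr M borel X = gauss_law v" using glim_gauss[OF assms] by blast
  have [measurable]: "X \<in> borel_measurable M" by (rule glim_measurable[OF assms])
  have E: "expectation (\<lambda>w. f (X w)) = (\<integral>x. f x \<partial>gauss_law v)" if "f \<in> borel_measurable borel" for f :: "real \<Rightarrow> real"
    unfolding v(2)[symmetric] using that by (subst integral_distr) auto
  have E2: "expectation (\<lambda>w. (X w)\<^sup>2) = v" using E[of "\<lambda>x. x\<^sup>2"] v(1) by (simp add: gauss_law_moments)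
  show "integrable M (\<lambda>w. X w ^ k)"
    using gauss_law_moments(1)[of v k] unfolding v(2)[symmetric] by (subst (asm) integrable_distr_eq) auto
  show "expectation (\<lambda>w. X w ^ 4) = 3 * (expectation (\<lambda>w. (X w)\<^sup>2))\<^sup>2"
    unfolding E2 using E[of "\<lambda>x. x ^ 4"] by (simp add: gauss_law_moments)
  show "expectation (\<lambda>w. cos (a * X w)) = exp (- (a\<^sup>2 * expectation (\<lambda>w. (X w)\<^sup>2)) / 2)"
    unfolding E2 using E[of "\<lambda>x. cos (a * x)"] v(1) by (simp add: gauss_law_moments)
qed

lemma glim_prod_integrable:
  assumes "glim X" "glim Y"
  shows "integrable M (\<lambda>w. X w * Y w)" "integrable M (\<lambda>w. (X w)\<^sup>2 * (Y w)\<^sup>2)"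
proof -
  have [measurable]: "X \<in> borel_measurable M" "Y \<in> borel_measurable M" using assms by (auto intro: glim_measurable)
  show "integrable M (\<lambda>w. X w * Y w)"
  proof (rule Bochner_Integration.integrable_bound[of M "\<lambda>w. (X w)\<^sup>2 + (Y w)\<^sup>2"])
    show "AE w in M. norm (X w * Y w) \<le> norm ((X w)\<^sup>2 + (Y w)\<^sup>2)"
    proof (rule AE_I2)
      fix w
      have "2 * \<bar>X w * Y w\<bar> \<le> (X w)\<^sup>2 + (Y w)\<^sup>2"
        using sum_squares_bound[of "\<bar>X w\<bar>" "\<bar>Y w\<bar>"] by (simp add: abs_mult)
      then show "norm (X w * Y w) \<le> norm ((X w)\<^sup>2 + (Y w)\<^sup>2)" by simp
    qed
  qed (use assms in \<open>auto intro: glim_moments\<close>)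
  show "integrable M (\<lambda>w. (X w)\<^sup>2 * (Y w)\<^sup>2)"
  proof (rule Bochner_Integration.integrable_bound[of M "\<lambda>w. X w ^ 4 + Y w ^ 4"])
    show "AE w in M. norm ((X w)\<^sup>2 * (Y w)\<^sup>2) \<le> norm (X w ^ 4 + Y w ^ 4)"
    proof (rule AE_I2)
      fix w
      have "2 * ((X w)\<^sup>2 * (Y w)\<^sup>2) \<le> X w ^ 4 + Y w ^ 4"
        using sum_squares_bound[of "(X w)\<^sup>2" "(Y w)\<^sup>2"] by (simp flip: power_mult add: mult.assoc)
      moreover have "(X w)\<^sup>2 * (Y w)\<^sup>2 \<ge> 0" by simp
      ultimately have "\<bar>(X w)\<^sup>2 * (Y w)\<^sup>2\<bar> \<le> \<bar>X w ^ 4 + Y w ^ 4\<bar>" by linarith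
      then show "norm ((X w)\<^sup>2 * (Y w)\<^sup>2) \<le> norm (X w ^ 4 + Y w ^ 4)" by simp
    qed
  qed (use assms in \<open>auto intro: glim_moments\<close>)
qed

lemma glim_second_moment_combination:
  assumes "glim X" "glim Y"
  shows "expectation (\<lambda>w. (a * X w + b * Y w)\<^sup>2) =
    a\<^sup>2 * expectation (\<lambda>w. (X w)\<^sup>2) + b\<^sup>2 * expectation (\<lambda>w. (Y w)\<^sup>2) + 2 * a * b * expectation (\<lambda>w. X w * Y w)"
proof -
  have i: "integrable M (\<lambda>w. (X w)\<^sup>2)" "integrable M (\<lambda>w. (Y w)\<^sup>2)" "integrable M (\<lambda>w. X w * Y w)"
    using assms by (auto intro: glim_moments glim_prod_integrable)
  have "expectation (\<lambda>w. (a * X w + b * Y w)\<^sup>2) = expectation (\<lambda>w. a\<^sup>2 * (X w)\<^sup>2 + b\<^sup>2 * (Y w)\<^sup>2 + (2 * a * b) * (X w * Y w))"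
    by (intro Bochner_Integration.integral_cong) (auto simp: power2_eq_square algebra_simps)
  also have "\<dots> = a\<^sup>2 * expectation (\<lambda>w. (X w)\<^sup>2) + b\<^sup>2 * expectation (\<lambda>w. (Y w)\<^sup>2) + (2 * a * b) * expectation (\<lambda>w. X w * Y w)"
    using i by simp
  finally show ?thesis .
qed

text \<open>Polarization of the one-dimensional fourth moment:
  \<open>(X+Y)^4 + (X-Y)^4 = 2*X^4 + 2*Y^4 + 12*X^2*Y^2\<close>, and \<open>X+Y\<close>,
  \<open>X-Y\<close> are again Gaussian. No joint density is used.\<close>

lemma glim_wick:
  assumes X: "glim X" and Y: "glim Y"
  shows "expectation (\<lambda>w. (X w)\<^sup>2 * (Y w)\<^sup>2) =
    expectation (\<lambda>w. (X w)\<^sup>2) * expectation (\<lambda>w. (Y w)\<^sup>2) + 2 * (expectation (\<lambda>w. X w * Y w))\<^sup>2"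
proof -
  define a b c where "a = expectation (\<lambda>w. (X w)\<^sup>2)" and "b = expectation (\<lambda>w. (Y w)\<^sup>2)" and "c = expectation (\<lambda>w. X w * Y w)"
  have S: "glim (\<lambda>w. 1 * X w + 1 * Y w)" "glim (\<lambda>w. 1 * X w + (-1) * Y w)" using X Y by (auto intro!: glim_add glim_diff simp: )
  have p: "expectation (\<lambda>w. (1 * X w + 1 * Y w) ^ 4) = 3 * (a + b + 2 * c)\<^sup>2"
    unfolding glim_moments(2)[OF S(1)] glim_second_moment_combination[OF X Y] by (simp add: a_def b_def c_def)
  have m: "expectation (\<lambda>w. (1 * X w + (-1) * Y w) ^ 4) = 3 * (a + b - 2 * c)\<^sup>2"
    unfolding glim_moments(2)[OF S(2)] glim_second_moment_combination[OF X Y] by (simp add: a_def b_def c_def)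
  have i: "integrable M (\<lambda>w. X w ^ 4)" "integrable M (\<lambda>w. Y w ^ 4)" "integrable M (\<lambda>w. (X w)\<^sup>2 * (Y w)\<^sup>2)"
    "integrable M (\<lambda>w. (1 * X w + 1 * Y w) ^ 4)" "integrable M (\<lambda>w. (1 * X w + (-1) * Y w) ^ 4)"
    using X Y S by (auto intro: glim_moments glim_prod_integrable)
  have "expectation (\<lambda>w. (1 * X w + 1 * Y w) ^ 4) + expectation (\<lambda>w. (1 * X w + (-1) * Y w) ^ 4)
      = expectation (\<lambda>w. (1 * X w + 1 * Y w) ^ 4 + (1 * X w + (-1) * Y w) ^ 4)"
    by (rule Bochner_Integration.integral_add[symmetric]) (rule i)+
  also have "\<dots> = expectation (\<lambda>w. 2 * X w ^ 4 + 2 * Y w ^ 4 + 12 * ((X w)\<^sup>2 * (Y w)\<^sup>2))"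
    by (intro Bochner_Integration.integral_cong) (auto simp: power4_eq_xxxx power2_eq_square algebra_simps)
  also have "\<dots> = 2 * expectation (\<lambda>w. X w ^ 4) + 2 * expectation (\<lambda>w. Y w ^ 4) + 12 * expectation (\<lambda>w. (X w)\<^sup>2 * (Y w)\<^sup>2)"
    using i(1-3) by simp
  also have "\<dots> = 6 * a\<^sup>2 + 6 * b\<^sup>2 + 12 * expectation (\<lambda>w. (X w)\<^sup>2 * (Y w)\<^sup>2)"
    by (simp add: glim_moments(2)[OF X] glim_moments(2)[OF Y] a_def b_def)
  finally have "3 * (a + b + 2 * c)\<^sup>2 + 3 * (a + b - 2 * c)\<^sup>2 = 6 * a\<^sup>2 + 6 * b\<^sup>2 + 12 * expectation (\<lambda>w. (X w)\<^sup>2 * (Y w)\<^sup>2)"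
    unfolding p m .
  then show ?thesis unfolding a_def[symmetric] b_def[symmetric] c_def[symmetric] by (simp add: power2_eq_square algebra_simps)
qed

end

subsection \<open>Lebesgue measure on an interval\<close>

text \<open>A finite measure on the full Borel line, so that products, Fubini and dominated
  convergence apply to integrands without cutting them off.\<close>

definition ivl :: "real \<Rightarrow> real \<Rightarrow> real measure" where
  "ivl a b = density lborel (\<lambda>x. ennreal (indicator {a..b} x))"

lemma sets_ivl [simp, measurable_cong]: "sets (ivl a b) = sets borel"
  by (simp add: ivl_def)

lemma space_ivl [simp]: "space (ivl a b) = UNIV"
  by (simp add: ivl_def)

lemma AE_ivl: "AE x in ivl a b. x \<in> {a..b}"
  unfolding ivl_def by (subst AE_density) (auto simp: indicator_def)

lemma emeasure_ivl: "a \<le> b \<Longrightarrow> emeasure (ivl a b) UNIV = ennreal (b - a)"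
  unfolding ivl_def
  by (subst emeasure_density) (auto simp: emeasure_lborel_Icc nn_integral_indicator ennreal_indicator)

lemma finite_measure_ivl: "finite_measure (ivl a b)"
proof (rule finite_measureI)
  show "emeasure (ivl a b) (space (ivl a b)) \<noteq> \<infinity>"
    using emeasure_ivl[of a b] by (cases "a \<le> b") (auto simp: ivl_def emeasure_density)
qed

interpretation ivl: finite_measure "ivl a b" for a b by (rule finite_measure_ivl)

lemma measure_ivl: "a \<le> b \<Longrightarrow> measure (ivl a b) UNIV = b - a"
  by (simp add: measure_def emeasure_ivl)

lemma integral_ivl:
  fixes f :: "real \<Rightarrow> real"
  assumes "f \<in> borel_measurable borel"
  shows "(\<integral>x. f x \<partial>ivl a b) = (\<integral>x. indicator {a..b} x * f x \<partial>lborel)"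
  unfolding ivl_def using assms by (subst integral_density) auto

lemma integrable_ivl_iff:
  fixes f :: "real \<Rightarrow> real"
  assumes "f \<in> borel_measurable borel"
  shows "integrable (ivl a b) f \<longleftrightarrow> integrable lborel (\<lambda>x. indicator {a..b} x * f x)"
  unfolding ivl_def using assms by (subst integrable_density) auto

lemma ivl_continuous:
  fixes f :: "real \<Rightarrow> real"
  assumes f: "continuous_on UNIV f"
  shows "integrable (ivl a b) f" "(\<integral>x. f x \<partial>ivl a b) = integral {a..b} f"
proof -
  have [measurable]: "f \<in> borel_measurable borel" using f by (rule borel_measurable_continuous_onI)
  have s: "set_integrable lborel {a..b} f"
    using borel_integrable_atLeastAtMost'[OF continuous_on_subset[OF f]] by auto
  then show "integrable (ivl a b) f" by (subst integrable_ivl_iff) (auto simp: set_integrable_def)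
  show "(\<integral>x. f x \<partial>ivl a b) = integral {a..b} f"
    using set_borel_integral_eq_integral(2)[OF s] by (subst integral_ivl) (auto simp: set_lebesgue_integral_def)
qed

abbreviation "ivl2 a b c d \<equiv> ivl a b \<Otimes>\<^sub>M ivl c d"

interpretation ivl2: pair_sigma_finite "ivl a b" "ivl c d" for a b c d ..

lemma finite_measure_ivl2: "finite_measure (ivl2 a b c d)"
  by (intro finite_measure_pair_measure finite_measure_ivl)

lemma AE_ivl2: "AE p in ivl2 a b c d. fst p \<in> {a..b} \<and> snd p \<in> {c..d}"
proof (rule ivl2.AE_pair_measure)
  show "{p \<in> space (ivl2 a b c d). fst p \<in> {a..b} \<and> snd p \<in> {c..d}} \<in> sets (ivl2 a b c d)" by measurable
  show "AE x in ivl a b. AE y in ivl c d. fst (x, y) \<in> {a..b} \<and> snd (x, y) \<in> {c..d}"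
    using AE_ivl[of a b] AE_ivl[of c d] by (auto elim: eventually_mono)
qed

lemma measure_ivl2: "a \<le> b \<Longrightarrow> c \<le> d \<Longrightarrow> measure (ivl2 a b c d) UNIV = (b - a) * (d - c)"
proof -
  assume "a \<le> b" "c \<le> d"
  then have "emeasure (ivl2 a b c d) (UNIV \<times> UNIV) = ennreal ((b - a) * (d - c))"
    by (subst ivl.emeasure_pair_measure_Times) (auto simp: emeasure_ivl ennreal_mult)
  then show ?thesis using \<open>a \<le> b\<close> \<open>c \<le> d\<close> by (simp add: measure_def)
qed

lemma ivl2_bounded:
  fixes f :: "real \<times> real \<Rightarrow> real"
  assumes f [measurable]: "f \<in> borel_measurable (borel \<Otimes>\<^sub>M borel)" and ab: "a \<le> b" "c \<le> d"
    and bd: "\<And>x y. x \<in> {a..b} \<Longrightarrow> y \<in> {c..d} \<Longrightarrow> \<bar>f (x, y)\<bar> \<le> C"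
  shows "integrable (ivl2 a b c d) f" "\<bar>\<integral>p. f p \<partial>ivl2 a b c d\<bar> \<le> C * ((b - a) * (d - c))"
proof -
  interpret I: finite_measure "ivl2 a b c d" by (rule finite_measure_ivl2)
  have ae: "AE p in ivl2 a b c d. \<bar>f p\<bar> \<le> C" using AE_ivl2[of a b c d] by eventually_elim (use bd in auto)
  show i: "integrable (ivl2 a b c d) f" using ae by (intro I.integrable_const_bound[where B=C]) auto
  have "\<bar>\<integral>p. f p \<partial>ivl2 a b c d\<bar> \<le> (\<integral>p. \<bar>f p\<bar> \<partial>ivl2 a b c d)" by (rule integral_abs_bound)
  also have "\<dots> \<le> (\<integral>p. C \<partial>ivl2 a b c d)" using ae i by (intro integral_mono_AE) auto
  also have "\<dots> = C * ((b - a) * (d - c))" using measure_ivl2[OF ab] by (simp add: space_pair_measure)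
  finally show "\<bar>\<integral>p. f p \<partial>ivl2 a b c d\<bar> \<le> C * ((b - a) * (d - c))" .
qed

lemma ivl2_continuous_integrable:
  fixes f :: "real \<times> real \<Rightarrow> real"
  assumes f: "continuous_on UNIV f"
  shows "integrable (ivl2 a b c d) f"
proof -
  interpret I: finite_measure "ivl2 a b c d" by (rule finite_measure_ivl2)
  have [measurable]: "f \<in> borel_measurable (borel \<Otimes>\<^sub>M borel)"
    using borel_measurable_continuous_onI[OF f] by (simp add: borel_prod)
  have "compact (f ` ({a..b} \<times> {c..d}))"
    by (intro compact_continuous_image continuous_on_subset[OF f] compact_Times) auto
  then obtain C where C: "\<And>p. p \<in> {a..b} \<times> {c..d} \<Longrightarrow> \<bar>f p\<bar> \<le> C"
    unfolding compact_eq_bounded_closed bounded_iff by auto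
  have "AE p in ivl2 a b c d. \<bar>f p\<bar> \<le> C" using AE_ivl2[of a b c d] by eventually_elim (use C in \<open>auto simp: mem_Times_iff\<close>)
  then show ?thesis by (intro I.integrable_const_bound[where B=C]) auto
qed

lemma ivl2_integral_iterated:
  fixes f :: "real \<times> real \<Rightarrow> real"
  assumes "integrable (ivl2 a b c d) f"
  shows "(\<integral>p. f p \<partial>ivl2 a b c d) = (\<integral>x. \<integral>y. f (x, y) \<partial>ivl c d \<partial>ivl a b)"
  using ivl2.integral_fst'[OF assms] by simp

lemma ivl2_product:
  fixes f g :: "real \<Rightarrow> real"
  assumes f: "integrable (ivl a b) f" and g: "integrable (ivl c d) g"
  shows "(\<integral>x. f x \<partial>ivl a b) * (\<integral>x. g x \<partial>ivl c d) = (\<integral>p. f (fst p) * g (snd p) \<partial>ivl2 a b c d)"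
proof -
  have [measurable]: "f \<in> borel_measurable borel" "g \<in> borel_measurable borel"
    using borel_measurable_integrable[OF f] borel_measurable_integrable[OF g] by auto
  have "integrable (ivl2 a b c d) (\<lambda>p. f (fst p) * g (snd p))"
  proof (rule ivl2.Fubini_integrable)
    have "integrable (ivl a b) (\<lambda>x. \<bar>f x\<bar> * (\<integral>y. \<bar>g y\<bar> \<partial>ivl c d))" using f by auto
    then show "integrable (ivl a b) (\<lambda>x. \<integral>y. norm (f (fst (x, y)) * g (snd (x, y))) \<partial>ivl c d)"
      by (simp add: abs_mult)
    show "AE x in ivl a b. integrable (ivl c d) (\<lambda>y. f (fst (x, y)) * g (snd (x, y)))" using g by auto
  qed measurable
  from ivl2_integral_iterated[OF this] show ?thesis by simp
qed

context prob_space
begin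

text \<open>Integrability on the product follows from an integrable bound \<open>g\<close> on the
  first absolute moments, which is what Gaussian second moments provide. The third conclusion is the
  resulting L1 estimate.\<close>

lemma fubini_expectation:
  fixes f :: "'a \<Rightarrow> 'b \<Rightarrow> real"
  assumes N: "sigma_finite_measure N"
    and f [measurable]: "(\<lambda>(w, x). f w x) \<in> borel_measurable (M \<Otimes>\<^sub>M N)"
    and bd: "AE x in N. integrable M (\<lambda>w. f w x) \<and> expectation (\<lambda>w. \<bar>f w x\<bar>) \<le> g x"
    and g [measurable]: "integrable N g"
  shows "integrable M (\<lambda>w. \<integral>x. f w x \<partial>N)"
    and "expectation (\<lambda>w. \<integral>x. f w x \<partial>N) = (\<integral>x. expectation (\<lambda>w. f w x) \<partial>N)"
    and "expectation (\<lambda>w. \<bar>\<integral>x. f w x \<partial>N\<bar>) \<le> (\<integral>x. g x \<partial>N)"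
    and "AE w in M. integrable N (f w)"
    and "(\<lambda>x. expectation (\<lambda>w. f w x)) \<in> borel_measurable N"
proof -
  interpret N: sigma_finite_measure N by fact
  interpret pair_sigma_finite M N ..
  have nn: "(\<integral>\<^sup>+z. ennreal (norm (case z of (w, x) \<Rightarrow> f w x)) \<partial>(M \<Otimes>\<^sub>M N)) \<le> ennreal (\<integral>x. g x \<partial>N)"
  proof -
    have "(\<integral>\<^sup>+z. ennreal (norm (case z of (w, x) \<Rightarrow> f w x)) \<partial>(M \<Otimes>\<^sub>M N)) = (\<integral>\<^sup>+x. \<integral>\<^sup>+w. ennreal \<bar>f w x\<bar> \<partial>M \<partial>N)"
      by (subst nn_integral_snd[symmetric]) (auto simp: case_prod_beta)
    also have "\<dots> \<le> (\<integral>\<^sup>+x. ennreal (g x) \<partial>N)"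
    proof (intro nn_integral_mono_AE, use bd in eventually_elim)
      fix x assume x: "integrable M (\<lambda>w. f w x) \<and> expectation (\<lambda>w. \<bar>f w x\<bar>) \<le> g x"
      then have "(\<integral>\<^sup>+w. ennreal \<bar>f w x\<bar> \<partial>M) = ennreal (expectation (\<lambda>w. \<bar>f w x\<bar>))"
        by (intro nn_integral_eq_integral) auto
      with x show "(\<integral>\<^sup>+w. ennreal \<bar>f w x\<bar> \<partial>M) \<le> ennreal (g x)" by (simp add: ennreal_leI)
    qed
    also have "\<dots> = ennreal (\<integral>x. g x \<partial>N)"
    proof (rule nn_integral_eq_integral[OF g])
      show "AE x in N. 0 \<le> g x" using bd
      proof eventually_elim
        fix x assume "integrable M (\<lambda>w. f w x) \<and> expectation (\<lambda>w. \<bar>f w x\<bar>) \<le> g x"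
        moreover have "0 \<le> expectation (\<lambda>w. \<bar>f w x\<bar>)" by (intro integral_nonneg_AE) auto
        ultimately show "0 \<le> g x" by linarith
      qed
    qed
    finally show ?thesis .
  qed
  have i: "integrable (M \<Otimes>\<^sub>M N) (\<lambda>(w, x). f w x)"
    using nn by (intro integrableI_bounded) (auto simp: less_top[symmetric] top_unique)
  show "integrable M (\<lambda>w. \<integral>x. f w x \<partial>N)" by (rule integrable_fst[OF i])
  show "expectation (\<lambda>w. \<integral>x. f w x \<partial>N) = (\<integral>x. expectation (\<lambda>w. f w x) \<partial>N)"
    unfolding integral_fst[OF i] integral_snd[OF i] ..
  show "AE w in M. integrable N (f w)" using AE_integrable_fst[OF i] .
  show "(\<lambda>x. expectation (\<lambda>w. f w x)) \<in> borel_measurable N"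
    using integrable_snd[OF i] by (rule borel_measurable_integrable)
  have i': "integrable (M \<Otimes>\<^sub>M N) (\<lambda>(w, x). \<bar>f w x\<bar>)" using integrable_abs[OF i] by (simp add: case_prod_beta')
  have "expectation (\<lambda>w. \<bar>\<integral>x. f w x \<partial>N\<bar>) \<le> expectation (\<lambda>w. \<integral>x. \<bar>f w x\<bar> \<partial>N)"
    using integrable_fst[OF i] integrable_fst[OF i'] by (intro integral_mono integrable_abs integral_abs_bound) auto
  also have "\<dots> = (\<integral>x. expectation (\<lambda>w. \<bar>f w x\<bar>) \<partial>N)"
    unfolding integral_fst[OF i'] integral_snd[OF i'] ..
  also have "\<dots> \<le> (\<integral>x. g x \<partial>N)"
    using integrable_snd[OF i'] g bd by (intro integral_mono_AE) auto
  finally show "expectation (\<lambda>w. \<bar>\<integral>x. f w x \<partial>N\<bar>) \<le> (\<integral>x. g x \<partial>N)" .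
qed

end

lemma borel_measurable_ivl_integral:
  fixes f :: "real \<Rightarrow> 'a \<Rightarrow> real"
  assumes f: "\<And>t. f t \<in> borel_measurable M" and c: "\<And>w. w \<in> space M \<Longrightarrow> continuous_on UNIV (\<lambda>t. f t w)"
  shows "(\<lambda>w. \<integral>t. f t w \<partial>ivl a b) \<in> borel_measurable M"
proof -
  have "(\<lambda>z. f (snd z) (fst z)) \<in> borel_measurable (M \<Otimes>\<^sub>M borel)"
    using measurable_compose_caratheodory[of "\<lambda>w t. f t w" M fst "M \<Otimes>\<^sub>M borel" snd] f c by auto
  then have "(\<lambda>(w, t). f t w) \<in> borel_measurable (M \<Otimes>\<^sub>M ivl a b)" by (simp add: case_prod_beta cong: measurable_cong_sets)
  then show ?thesis by (rule ivl.borel_measurable_lebesgue_integral)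
qed

subsection \<open>Kernel estimates\<close>

text \<open>After dividing by \<open>a + b\<close> both fractions lie in \<open>[0, 1]\<close>,
  where \<open>x \<le> x powr p\<close>.\<close>

lemma powr_subadditive:
  fixes a b p :: real
  assumes "0 \<le> a" "0 \<le> b" "0 < p" "p \<le> 1"
  shows "(a + b) powr p \<le> a powr p + b powr p"
proof (cases "a + b = 0")
  case False
  define s where "s = a + b"
  have s: "s > 0" using False assms by (simp add: s_def)
  have le: "x \<le> x powr p" if "0 \<le> x" "x \<le> 1" for x
    using that assms powr_mono'[of p 1 x] by (cases "x = 0") auto
  have "1 = a / s + b / s" using s by (simp add: s_def add_divide_distrib[symmetric])
  also have "\<dots> \<le> (a / s) powr p + (b / s) powr p"
    using assms s by (intro add_mono le) (auto simp: s_def)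
  also have "\<dots> = (a powr p + b powr p) / s powr p"
    using assms s by (simp add: powr_divide add_divide_distrib)
  finally show ?thesis using s by (simp add: s_def[symmetric] field_simps)
qed (use assms in auto)

lemma abs_powr_diff_le:
  fixes x h p :: real
  assumes "0 < p" "p \<le> 1"
  shows "\<bar>\<bar>x + h\<bar> powr p - \<bar>x\<bar> powr p\<bar> \<le> \<bar>h\<bar> powr p"
proof -
  have "\<bar>x + h\<bar> powr p \<le> (\<bar>x\<bar> + \<bar>h\<bar>) powr p" using assms by (intro powr_mono2) auto
  also have "\<dots> \<le> \<bar>x\<bar> powr p + \<bar>h\<bar> powr p" using assms by (intro powr_subadditive) auto
  finally have 1: "\<bar>x + h\<bar> powr p \<le> \<bar>x\<bar> powr p + \<bar>h\<bar> powr p" .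
  have "\<bar>x\<bar> powr p \<le> (\<bar>x + h\<bar> + \<bar>h\<bar>) powr p" using assms by (intro powr_mono2) auto
  also have "\<dots> \<le> \<bar>x + h\<bar> powr p + \<bar>h\<bar> powr p" using assms by (intro powr_subadditive) auto
  finally show ?thesis using 1 by linarith
qed

lemma continuous_on_abs_powr [continuous_intros]:
  fixes f :: "'b::topological_space \<Rightarrow> real"
  assumes "continuous_on S f" "p > 0"
  shows "continuous_on S (\<lambda>x. \<bar>f x\<bar> powr p)"
  using assms by (intro continuous_on_powr' continuous_intros) auto

text \<open>Covariance, at lag \<open>z\<close>, of two increments of length \<open>h\<close> of
  fractional Brownian motion: half the second difference of \<open>|z|^(2*H)\<close>.\<close>

definition incov :: "real \<Rightarrow> real \<Rightarrow> real \<Rightarrow> real" where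
  "incov H h z = (\<bar>z + h\<bar> powr (2*H) + \<bar>z - h\<bar> powr (2*H) - 2 * \<bar>z\<bar> powr (2*H)) / 2"

lemma continuous_on_incov [continuous_intros]:
  assumes "H > 0" "continuous_on S f" "continuous_on S g"
  shows "continuous_on S (\<lambda>x. incov H (f x) (g x))"
  unfolding incov_def using assms by (intro continuous_intros) auto

lemma incov_abs: "incov H h z = incov H \<bar>h\<bar> \<bar>z\<bar>"
proof -
  have h: "incov H (- h) x = incov H h x" for h x by (simp add: incov_def)
  have z: "incov H h (- x) = incov H h x" for h x
  proof -
    have "\<bar>- x + h\<bar> = \<bar>x - h\<bar>" "\<bar>- x - h\<bar> = \<bar>x + h\<bar>" by arith+
    then show ?thesis by (simp add: incov_def)
  qed
  show ?thesis by (simp add: abs_if h z)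
qed

lemma abs_incov_le:
  assumes "0 < H" "H \<le> 1/2"
  shows "\<bar>incov H h z\<bar> \<le> \<bar>h\<bar> powr (2*H)"
  using abs_powr_diff_le[of "2*H" z h] abs_powr_diff_le[of "2*H" z "-h"] assms
  unfolding incov_def by (simp add: abs_le_iff)

text \<open>The mean value theorem, used for the two first differences and then for the derivative,
  leaves the second derivative of \<open>x^(2*H)\<close> at a point above \<open>x/2\<close>. There
  \<open>|2*H*(2*H-1)| \<le> 1\<close>, and halving the argument costs at most the factor 4.\<close>

lemma abs_incov_far:
  assumes H: "0 < H" "H \<le> 1/2" and z: "\<bar>z\<bar> \<ge> 2 * \<bar>h\<bar>"
  shows "\<bar>incov H h z\<bar> \<le> 4 * h\<^sup>2 * \<bar>z\<bar> powr (2*H - 2)"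
proof (cases "h = 0")
  case False
  define k x where "k = \<bar>h\<bar>" and "x = \<bar>z\<bar>"
  have k: "k > 0" and x: "x \<ge> 2 * k" using False z by (auto simp: k_def x_def)
  let ?p = "2 * H"
  let ?f = "\<lambda>t::real. t powr ?p" and ?f' = "\<lambda>t::real. ?p * t powr (?p - 1)"
    and ?f'' = "\<lambda>t::real. ?p * ((?p - 1) * t powr (?p - 2))"
  have d1: "DERIV ?f t :> ?f' t" if "t > 0" for t
    using has_real_derivative_powr[OF that, of ?p] .
  have d2: "DERIV ?f' t :> ?f'' t" if "t > 0" for t
    using DERIV_cmult[OF has_real_derivative_powr[OF that, of "?p - 1"], of ?p] by simp
  obtain a where a: "x < a" "a < x + k" "?f (x + k) - ?f x = (x + k - x) * ?f' a"
    using MVT2[of x "x + k" ?f ?f'] d1 k x by auto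
  obtain b where b: "x - k < b" "b < x" "?f x - ?f (x - k) = (x - (x - k)) * ?f' b"
    using MVT2[of "x - k" x ?f ?f'] d1 k x by auto
  obtain c where c: "b < c" "c < a" "?f' a - ?f' b = (a - b) * ?f'' c"
    using MVT2[of b a ?f' ?f''] d2 a b k x by auto
  have c': "c > x / 2" using b c x by linarith
  have "\<bar>?f'' c\<bar> \<le> 4 * x powr (?p - 2)"
  proof -
    have "\<bar>?f'' c\<bar> = (?p * (1 - ?p)) * c powr (?p - 2)" using H by (simp add: abs_mult)
    also have "\<dots> \<le> 1 * (x / 2) powr (?p - 2)"
    proof (intro mult_mono)
      show "?p * (1 - ?p) \<le> 1" using H mult_mono[of ?p 1 "1 - ?p" 1] by simp
      show "c powr (?p - 2) \<le> (x / 2) powr (?p - 2)" using c' H k x by (intro powr_mono2') auto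
    qed (use H in auto)
    also have "(x / 2) powr (?p - 2) = x powr (?p - 2) * 2 powr (2 - ?p)"
      using k x by (simp add: powr_divide powr_diff field_simps)
    also have "\<dots> \<le> x powr (?p - 2) * 2 powr 2" using H by (intro mult_left_mono powr_mono) auto
    finally show ?thesis by (simp add: mult.commute)
  qed
  moreover have "\<bar>a - b\<bar> \<le> 2 * k" using a b by auto
  ultimately have "\<bar>?f' a - ?f' b\<bar> \<le> (2 * k) * (4 * x powr (?p - 2))"
    unfolding c(3) abs_mult[of "a - b"] using k by (intro mult_mono) auto
  then have "k * \<bar>?f' a - ?f' b\<bar> \<le> k * ((2 * k) * (4 * x powr (?p - 2)))" using k by (intro mult_left_mono) auto
  moreover have eq: "incov H h z = k * (?f' a - ?f' b) / 2"
  proof -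
    have "incov H h z = ((?f (x + k) - ?f x) - (?f x - ?f (x - k))) / 2"
      unfolding incov_abs[of H h z] unfolding incov_def k_def[symmetric] x_def[symmetric] using k x by simp
    also have "\<dots> = k * (?f' a - ?f' b) / 2" unfolding a(3) b(3) by (simp add: algebra_simps)
    finally show ?thesis .
  qed
  moreover have "\<bar>incov H h z\<bar> = k * \<bar>?f' a - ?f' b\<bar> / 2" unfolding eq abs_mult abs_divide using k by simp
  ultimately have "\<bar>incov H h z\<bar> \<le> 4 * k\<^sup>2 * x powr (?p - 2)"
    by (simp add: power2_eq_square)
  then show ?thesis by (simp add: k_def x_def)
qed (simp add: incov_def)

text \<open>Only the origin is delicate: both difference quotients have modulus
  \<open>|h|^(q-1)\<close> there, which tends to 0 because \<open>q > 1\<close>.\<close>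

lemma DERIV_abs_powr:
  fixes t q :: real
  assumes q: "q > 1"
  shows "DERIV (\<lambda>t. \<bar>t\<bar> powr q) t :> q * (sgn t * \<bar>t\<bar> powr (q - 1))"
    and "DERIV (\<lambda>t. sgn t * \<bar>t\<bar> powr q) t :> q * \<bar>t\<bar> powr (q - 1)"
proof -
  consider "t > 0" | "t < 0" | "t = 0" by linarith
  then have "DERIV (\<lambda>t. \<bar>t\<bar> powr q) t :> q * (sgn t * \<bar>t\<bar> powr (q - 1)) \<and>
     DERIV (\<lambda>t. sgn t * \<bar>t\<bar> powr q) t :> q * \<bar>t\<bar> powr (q - 1)"
  proof cases
    case 1
    have d: "DERIV (\<lambda>t. t powr q) t :> q * t powr (q - 1)" by (rule has_real_derivative_powr[OF 1])
    have "DERIV (\<lambda>t. \<bar>t\<bar> powr q) t :> q * t powr (q - 1)"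
      by (rule has_field_derivative_transform_within_open[OF d, of "{0<..}"]) (use 1 in auto)
    moreover have "DERIV (\<lambda>t. sgn t * \<bar>t\<bar> powr q) t :> q * t powr (q - 1)"
      by (rule has_field_derivative_transform_within_open[OF d, of "{0<..}"]) (use 1 in auto)
    ultimately show ?thesis using 1 by simp
  next
    case 2
    have d: "DERIV (\<lambda>t. (- t) powr q) t :> - (q * (- t) powr (q - 1))"
      using DERIV_chain2[OF has_real_derivative_powr[of "- t" q] DERIV_minus[OF DERIV_ident], of UNIV] 2
      by (auto intro!: derivative_eq_intros)
    have "DERIV (\<lambda>t. \<bar>t\<bar> powr q) t :> - (q * (- t) powr (q - 1))"
      by (rule has_field_derivative_transform_within_open[OF d, of "{..<0}"]) (use 2 in auto)
    moreover have "DERIV (\<lambda>t. sgn t * \<bar>t\<bar> powr q) t :> - (- (q * (- t) powr (q - 1)))"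
      by (rule has_field_derivative_transform_within_open[OF DERIV_minus[OF d], of "{..<0}"]) (use 2 in auto)
    ultimately show ?thesis using 2 by simp
  next
    case 3
    have lim: "((\<lambda>h::real. \<bar>h\<bar> powr (q - 1)) \<longlongrightarrow> 0) (at 0)"
    proof -
      have "continuous_on UNIV (\<lambda>h::real. \<bar>h\<bar> powr (q - 1))" using q by (intro continuous_intros) auto
      then have "isCont (\<lambda>h::real. \<bar>h\<bar> powr (q - 1)) 0" by (simp add: continuous_on_eq_continuous_at)
      then show ?thesis using q by (simp add: isCont_def)
    qed
    have eq: "\<bar>h\<bar> powr q / \<bar>h\<bar> = \<bar>h\<bar> powr (q - 1)" if "h \<noteq> 0" for h :: real using that by (simp add: powr_diff)
    have "((\<lambda>h. \<bar>h\<bar> powr q / h) \<longlongrightarrow> 0) (at 0)"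
      by (rule Lim_null_comparison[OF _ lim]) (auto simp: eventually_at_filter eq)
    moreover have "((\<lambda>h. sgn h * \<bar>h\<bar> powr q / h) \<longlongrightarrow> 0) (at 0)"
      by (rule Lim_null_comparison[OF _ lim]) (auto simp: eventually_at_filter eq abs_mult abs_sgn_eq)
    ultimately show ?thesis using 3 q by (auto simp: has_field_derivative_iff)
  qed
  then show "DERIV (\<lambda>t. \<bar>t\<bar> powr q) t :> q * (sgn t * \<bar>t\<bar> powr (q - 1))"
    "DERIV (\<lambda>t. sgn t * \<bar>t\<bar> powr q) t :> q * \<bar>t\<bar> powr (q - 1)" by auto
qed

lemma DERIV_sgn_powr_antiderivative:
  fixes p t :: real
  assumes "p > 0"
  shows "DERIV (\<lambda>t. sgn t * \<bar>t\<bar> powr (p + 1) / (p + 1)) t :> \<bar>t\<bar> powr p"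
  using DERIV_cdivide[OF DERIV_abs_powr(2)[of "p + 1" t], of "p + 1"] assms by simp

lemma continuous_on_sgn_powr:
  assumes "p > 0"
  shows "continuous_on UNIV (\<lambda>t::real. sgn t * \<bar>t\<bar> powr p)"
proof -
  have "(\<lambda>t::real. sgn t * \<bar>t\<bar> powr p) = (\<lambda>t. \<bar>max t 0\<bar> powr p - \<bar>max (- t) 0\<bar> powr p)"
    by (auto simp: fun_eq_iff sgn_if max_def)
  then show ?thesis using assms by (simp only:) (intro continuous_intros; simp)
qed

lemma ivl_FTC:
  fixes F f :: "real \<Rightarrow> real"
  assumes "a \<le> b" "\<And>x. DERIV F x :> f x" "continuous_on UNIV f"
  shows "(\<integral>x. f x \<partial>ivl a b) = F b - F a"
proof -
  have "(f has_integral (F b - F a)) {a..b}"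
    using assms by (intro fundamental_theorem_of_calculus)
      (auto simp: has_real_derivative_iff_has_vector_derivative[symmetric] intro: has_field_derivative_at_within)
  then show ?thesis unfolding ivl_continuous(2)[OF assms(3)] by (rule integral_unique)
qed

text \<open>\<open>sgn t |t|\<^sup>p\<close> is the variation function of \<open>|t|\<^sup>p\<close>, so it dominates its increments.\<close>

lemma abs_powr_increment_le:
  fixes t e p :: real
  assumes "e \<ge> 0" "p > 0"
  shows "\<bar>\<bar>t + e\<bar> powr p - \<bar>t\<bar> powr p\<bar> \<le> sgn (t + e) * \<bar>t + e\<bar> powr p - sgn t * \<bar>t\<bar> powr p"
proof -
  consider "t \<ge> 0" | "t < 0" "t + e \<le> 0" | "t < 0" "t + e > 0" by linarith
  then show ?thesis
  proof cases
    case 1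
    then have "t powr p \<le> (t + e) powr p" using assms by (intro powr_mono2) auto
    then show ?thesis using 1 assms by (cases "t = 0"; cases "e = 0") auto
  next
    case 2
    then have "(- (t + e)) powr p \<le> (- t) powr p" using assms by (intro powr_mono2) auto
    then show ?thesis using 2 assms by (cases "t + e = 0") auto
  next
    case 3
    have "(t + e) powr p \<ge> 0" "(- t) powr p \<ge> 0" by auto
    then have "\<bar>(t + e) powr p - (- t) powr p\<bar> \<le> (t + e) powr p + (- t) powr p" by linarith
    then show ?thesis using 3 by simp
  qed
qed

text \<open>Gains a full factor \<open>e\<close> where the pointwise bound has only
  \<open>e^p\<close>: the increments are dominated by those of a monotone function, whose integral
  collapses to two boundary terms over intervals of length \<open>e\<close>.\<close>

lemma integral_abs_powr_increment_le:
  fixes a b e p R s :: real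
  assumes ab: "a \<le> b" and e: "e > 0" and p: "p > 0" and R: "\<bar>a + s\<bar> + e \<le> R" "\<bar>b + s\<bar> + e \<le> R"
  shows "(\<integral>t. \<bar>\<bar>t + s + e\<bar> powr p - \<bar>t + s\<bar> powr p\<bar> \<partial>ivl a b) \<le> 2 * e * R powr p"
proof -
  let ?s = "\<lambda>t::real. sgn t * \<bar>t\<bar> powr p"
  let ?G = "\<lambda>t::real. \<bar>t\<bar> powr (p + 1) / (p + 1)"
  have sc: "continuous_on UNIV ?s" by (rule continuous_on_sgn_powr[OF p])
  have G: "DERIV ?G t :> ?s t" for t
    using DERIV_cdivide[OF DERIV_abs_powr(1)[of "p + 1" t], of "p + 1"] p by simp
  have Ge: "DERIV (\<lambda>t. ?G (t + s + e)) t :> ?s (t + s + e)" "DERIV (\<lambda>t. ?G (t + s)) t :> ?s (t + s)" for t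
    using DERIV_shift[of ?G "?s (t + (s + e))" t "s + e"] DERIV_shift[of ?G "?s (t + s)" t s] G by (simp_all add: add.assoc)
  have sce: "continuous_on UNIV (\<lambda>t. ?s (t + s + e))" "continuous_on UNIV (\<lambda>t. ?s (t + s))"
    by (intro continuous_on_compose2[OF sc] continuous_intros subset_UNIV)+
  have "(\<integral>t. \<bar>\<bar>t + s + e\<bar> powr p - \<bar>t + s\<bar> powr p\<bar> \<partial>ivl a b) \<le> (\<integral>t. ?s (t + s + e) - ?s (t + s) \<partial>ivl a b)"
  proof (intro integral_mono ivl_continuous(1))
    show "continuous_on UNIV (\<lambda>t. \<bar>\<bar>t + s + e\<bar> powr p - \<bar>t + s\<bar> powr p\<bar>)"
      using p by (intro continuous_on_rabs continuous_on_diff continuous_on_abs_powr continuous_on_add continuous_on_id continuous_on_const)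
    show "continuous_on UNIV (\<lambda>t. ?s (t + s + e) - ?s (t + s))" by (rule continuous_on_diff[OF sce])
  qed (use abs_powr_increment_le[of e p] e p in auto)
  also have "\<dots> = (?G (b + s + e) - ?G (b + s)) - (?G (a + s + e) - ?G (a + s))"
  proof -
    have "DERIV (\<lambda>t. ?G (t + s + e) - ?G (t + s)) t :> ?s (t + s + e) - ?s (t + s)" for t by (intro DERIV_diff Ge)
    from ivl_FTC[OF ab this] sce show ?thesis by (simp add: continuous_on_diff)
  qed
  also have "\<dots> \<le> e * R powr p + e * R powr p"
  proof -
    have *: "\<bar>?G (x + e) - ?G x\<bar> \<le> e * R powr p" if x: "\<bar>x\<bar> + e \<le> R" for x
    proof -
      obtain y where y: "x < y" "y < x + e" "?G (x + e) - ?G x = (x + e - x) * ?s y"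
        using MVT2[of x "x + e" ?G ?s] G e by auto
      have "\<bar>?s y\<bar> \<le> R powr p"
      proof -
        have "\<bar>?s y\<bar> \<le> \<bar>y\<bar> powr p" by (auto simp: abs_mult abs_sgn_eq)
        also have "\<dots> \<le> R powr p" using y x p by (intro powr_mono2) auto
        finally show ?thesis .
      qed
      then show ?thesis unfolding y(3) using e by (simp add: abs_mult)
    qed
    show ?thesis using *[OF R(1)] *[OF R(2)] by linarith
  qed
  finally show ?thesis by simp
qed

text \<open>Covariance, at lag \<open>z\<close>, of two increments over \<open>h\<close> of the moving average over \<open>e\<close> of the motion.\<close>

definition avg_incov :: "real \<Rightarrow> real \<Rightarrow> real \<Rightarrow> real \<Rightarrow> real" where
  "avg_incov H e h z = (\<integral>p. incov H h (z + fst p - snd p) \<partial>ivl2 0 e 0 e) / e\<^sup>2"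

lemma abs_avg_incov_le_if:
  assumes H: "0 < H" and e: "e > 0"
    and C: "\<And>x. \<bar>x - z\<bar> \<le> e \<Longrightarrow> \<bar>incov H h x\<bar> \<le> C"
  shows "\<bar>avg_incov H e h z\<bar> \<le> C"
proof -
  have m: "(\<lambda>p. incov H h (z + fst p - snd p)) \<in> borel_measurable (borel \<Otimes>\<^sub>M borel)"
    unfolding incov_def by measurable
  have "\<bar>\<integral>p. incov H h (z + fst p - snd p) \<partial>ivl2 0 e 0 e\<bar> \<le> C * ((e - 0) * (e - 0))"
    by (rule ivl2_bounded(2)[OF m]) (use e C in auto)
  then have "\<bar>\<integral>p. incov H h (z + fst p - snd p) \<partial>ivl2 0 e 0 e\<bar> / e\<^sup>2 \<le> C"
    using e by (simp add: field_simps power2_eq_square)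
  then show ?thesis by (simp add: avg_incov_def)
qed

lemma abs_avg_incov_le:
  assumes "0 < H" "H \<le> 1/2" "e > 0"
  shows "\<bar>avg_incov H e h z\<bar> \<le> \<bar>h\<bar> powr (2*H)"
  using assms by (intro abs_avg_incov_le_if abs_incov_le)

text \<open>The covariance decays at least like \<open>1/|z|\<close> in units of \<open>m\<close>;
  the square is put in Cauchy form so that its integral is an arctangent. For
  \<open>|z| < 4*m\<close> the trivial bound suffices. Beyond that, averaging over
  \<open>e \<le> m\<close> keeps the lag above \<open>|z|/2\<close> and \<open>abs_incov_far\<close>
  applies.\<close>

lemma avg_incov_sq_le:
  assumes H: "0 < H" "H \<le> 1/2" and e: "e > 0" and m: "m \<ge> \<bar>h\<bar>" "m \<ge> e"
  shows "(avg_incov H e h z)\<^sup>2 \<le> 128 * m powr (4*H) / (1 + (z / m)\<^sup>2)"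
proof -
  have m0: "m > 0" using e m by linarith
  have mH: "(m powr (2*H))\<^sup>2 = m powr (4*H)" by (simp add: power2_eq_square powr_add[symmetric])
  show ?thesis
  proof (cases "\<bar>z\<bar> < 4 * m")
    case True
    have "\<bar>avg_incov H e h z\<bar> \<le> m powr (2*H)"
      using abs_avg_incov_le[OF H e, of h z] powr_mono2[of "2*H" "\<bar>h\<bar>" m] H m by simp
    then have v: "(avg_incov H e h z)\<^sup>2 \<le> m powr (4*H)"
      unfolding mH[symmetric] by (metis abs_ge_zero power2_abs power_mono)
    have "(z / m)\<^sup>2 \<le> 16"
    proof -
      have "\<bar>z / m\<bar> \<le> 4" using True m0 by (simp add: field_simps)
      then have "\<bar>z / m\<bar>\<^sup>2 \<le> 4\<^sup>2" by (intro power_mono) auto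
      then have "(z / m)\<^sup>2 \<le> 4\<^sup>2" by (simp only: power2_abs)
      then show ?thesis by simp
    qed
    then have "m powr (4*H) * (1 + (z / m)\<^sup>2) \<le> m powr (4*H) * 128" by (intro mult_left_mono) auto
    moreover have "1 + (z / m)\<^sup>2 > 0" by (simp add: add_pos_nonneg)
    ultimately have "m powr (4*H) \<le> 128 * m powr (4*H) / (1 + (z / m)\<^sup>2)"
      by (subst pos_le_divide_eq) (auto simp: mult.commute)
    then show ?thesis using v by linarith
  next
    case False
    then have z: "\<bar>z\<bar> \<ge> 4 * m" by simp
    \<comment> \<open>Half the lag in units of \<open>m\<close>, so that \<open>|z|/2 = m*y\<close>.
      The constant 128 arises as \<open>16 * 8\<close>, from squaring the factor 4 and from
      \<open>1 + (z/m)^2 \<le> 8*y^2\<close>.\<close>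
    define y where "y = \<bar>z\<bar> / (2 * m)"
    have y: "y \<ge> 2" using z m0 by (simp add: y_def field_simps)
    have "\<bar>avg_incov H e h z\<bar> \<le> 4 * m\<^sup>2 * (\<bar>z\<bar> / 2) powr (2*H - 2)"
    proof (rule abs_avg_incov_le_if)
      fix x assume "\<bar>x - z\<bar> \<le> e"
      then have x: "\<bar>x\<bar> \<ge> \<bar>z\<bar> / 2" using z m m0 by linarith
      then have "\<bar>x\<bar> \<ge> 2 * \<bar>h\<bar>" using z m by linarith
      from abs_incov_far[OF H this] have "\<bar>incov H h x\<bar> \<le> 4 * h\<^sup>2 * \<bar>x\<bar> powr (2*H - 2)" .
      also have "\<dots> \<le> 4 * m\<^sup>2 * (\<bar>z\<bar> / 2) powr (2*H - 2)"
      proof (intro mult_mono)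
        show "h\<^sup>2 \<le> m\<^sup>2" using m(1) by (metis abs_ge_zero power2_abs power_mono)
        show "\<bar>x\<bar> powr (2*H - 2) \<le> (\<bar>z\<bar> / 2) powr (2*H - 2)" using x H z m0 by (intro powr_mono2') auto
      qed auto
      finally show "\<bar>incov H h x\<bar> \<le> 4 * m\<^sup>2 * (\<bar>z\<bar> / 2) powr (2*H - 2)" .
    qed (use H e in auto)
    also have "\<dots> = 4 * m powr (2*H) * y powr (2*H - 2)"
    proof -
      have "\<bar>z\<bar> / 2 = m * y" using m0 by (simp add: y_def)
      then have "(\<bar>z\<bar> / 2) powr (2*H - 2) = m powr (2*H - 2) * y powr (2*H - 2)" using m0 y by (simp add: powr_mult)
      moreover have "m\<^sup>2 * m powr (2*H - 2) = m powr (2*H)"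
        using m0 powr_add[of m 2 "2*H - 2"] by simp
      ultimately show ?thesis by (simp add: mult.assoc[symmetric])
    qed
    also have "\<dots> \<le> 4 * m powr (2*H) * y powr (- 1)"
      using y H by (intro mult_left_mono powr_mono) auto
    also have "\<dots> = 4 * m powr (2*H) / y" using y by (simp add: powr_minus field_simps)
    finally have "\<bar>avg_incov H e h z\<bar> \<le> 4 * m powr (2*H) / y" .
    then have "(avg_incov H e h z)\<^sup>2 \<le> (4 * m powr (2*H) / y)\<^sup>2" by (metis abs_ge_zero power2_abs power_mono)
    also have "\<dots> = 16 * m powr (4*H) / y\<^sup>2" by (simp add: power_divide power_mult_distrib mH)
    also have "\<dots> \<le> 128 * m powr (4*H) / (1 + (z / m)\<^sup>2)"
    proof -
      have "(z / m)\<^sup>2 = 4 * y\<^sup>2" using m0 by (simp add: y_def power_divide power_mult_distrib)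
      moreover have "1 \<le> 4 * y\<^sup>2" using power_mono[of 2 y 2] y by simp
      ultimately have "1 + (z / m)\<^sup>2 \<le> 8 * y\<^sup>2" by simp
      moreover have "1 + (z / m)\<^sup>2 > 0" by (simp add: add_pos_nonneg)
      moreover have "8 * y\<^sup>2 > 0" using y by simp
      ultimately have "128 * m powr (4*H) / (8 * y\<^sup>2) \<le> 128 * m powr (4*H) / (1 + (z / m)\<^sup>2)"
        by (intro divide_left_mono mult_pos_pos) auto
      then show ?thesis by simp
    qed
    finally show ?thesis .
  qed
qed

lemma integral_arctan_kernel_le:
  fixes m v T :: real
  assumes m: "m > 0" and T: "T \<ge> 0"
  shows "(\<integral>u. 1 / (1 + ((u - v) / m)\<^sup>2) \<partial>ivl 0 T) \<le> m * pi"
proof -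
  have pos: "1 + x\<^sup>2 \<noteq> (0::real)" for x using zero_le_power2[of x] by linarith
  have d: "DERIV (\<lambda>u. m * arctan ((u - v) / m)) u :> 1 / (1 + ((u - v) / m)\<^sup>2)" for u
  proof -
    have "DERIV (\<lambda>u. (u - v) / m) u :> 1 / m" using m by (auto intro!: derivative_eq_intros)
    moreover have "m * (inverse (1 + ((u - v) / m)\<^sup>2) * (1 / m)) = 1 / (1 + ((u - v) / m)\<^sup>2)"
      using m by (simp add: inverse_eq_divide)
    ultimately show ?thesis using DERIV_cmult[OF DERIV_chain2[OF DERIV_arctan], of "\<lambda>u. (u - v) / m" "1 / m" u UNIV m] by (simp only:)
  qed
  have "(\<integral>u. 1 / (1 + ((u - v) / m)\<^sup>2) \<partial>ivl 0 T) = m * arctan ((T - v) / m) - m * arctan ((0 - v) / m)"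
  proof (rule ivl_FTC[OF T d])
    show "continuous_on UNIV (\<lambda>u. 1 / (1 + ((u - v) / m)\<^sup>2))"
      using m pos by (intro continuous_on_divide continuous_on_add continuous_on_power continuous_on_diff
         continuous_on_const continuous_on_id) auto
  qed
  also have "\<dots> = m * (arctan ((T - v) / m) - arctan ((0 - v) / m))" by (simp add: algebra_simps)
  also have "\<dots> \<le> m * pi"
    using arctan_ubound[of "(T - v) / m"] arctan_lbound[of "(0 - v) / m"] m by (intro mult_left_mono) linarith+
  finally show ?thesis .
qed

text \<open>Averaging over the square integrates \<open>|t|^(2*H)\<close> twice, so each term
  becomes a second difference of the double primitive \<open>f2\<close>. This is the origin of the
  exponent \<open>2*H+2\<close> and of the factor \<open>(2*H+1)*(2*H+2)\<close> in the limit
  variance.\<close>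

lemma avg_incov_0_eq:
  assumes H: "0 < H" and e: "e > 0"
  shows "avg_incov H e h 0 = (\<bar>h + e\<bar> powr (2*H+2) + \<bar>h - e\<bar> powr (2*H+2) - 2 * \<bar>h\<bar> powr (2*H+2) - 2 * e powr (2*H+2))
     / ((2*H+1) * (2*H+2) * e\<^sup>2)"
proof -
  let ?p = "2*H"
  let ?f1 = "\<lambda>t::real. sgn t * \<bar>t\<bar> powr (?p + 1) / (?p + 1)"
  define f2 where "f2 = (\<lambda>t::real. \<bar>t\<bar> powr (?p + 2) / ((?p + 1) * (?p + 2)))"
  have d1: "DERIV ?f1 t :> \<bar>t\<bar> powr ?p" for t
    using DERIV_sgn_powr_antiderivative[of ?p t] H by simp
  have d2: "DERIV f2 t :> ?f1 t" for t
  proof -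
    have c: "a \<noteq> 0 \<Longrightarrow> a * x / (b * a) = x / b" for a b x :: real by simp
    have "?p + 2 \<noteq> 0" "?p + 2 - 1 = ?p + 1" using H by auto
    then show ?thesis
      using DERIV_cdivide[OF DERIV_abs_powr(1)[of "?p + 2" t], of "(?p + 1) * (?p + 2)"] H unfolding f2_def by (simp only: c) simp
  qed
  have c1: "continuous_on UNIV ?f1"
    using continuous_on_sgn_powr[of "?p + 1"] H by (intro continuous_on_divide continuous_on_const) auto
  have D: "(\<integral>p. \<bar>z + fst p - snd p\<bar> powr ?p \<partial>ivl2 0 e 0 e) = f2 (z + e) + f2 (z - e) - 2 * f2 z" for z
  proof -
    have "(\<integral>p. \<bar>z + fst p - snd p\<bar> powr ?p \<partial>ivl2 0 e 0 e) = (\<integral>a. \<integral>b. \<bar>z + a - b\<bar> powr ?p \<partial>ivl 0 e \<partial>ivl 0 e)"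
      by (subst ivl2_integral_iterated) (use H in \<open>auto intro!: ivl2_continuous_integrable continuous_intros\<close>)
    also have "\<dots> = (\<integral>a. ?f1 (z + a) - ?f1 (z + a - e) \<partial>ivl 0 e)"
    proof -
      have "(\<integral>b. \<bar>z + a - b\<bar> powr ?p \<partial>ivl 0 e) = (- ?f1 (z + a - e)) - (- ?f1 (z + a - 0))" for a
      proof (rule ivl_FTC)
        show "DERIV (\<lambda>b. - ?f1 (z + a - b)) b :> \<bar>z + a - b\<bar> powr ?p" for b
        proof -
          have "DERIV (\<lambda>b. z + a - b) b :> -1" by (auto intro!: derivative_eq_intros)
          from DERIV_minus[OF DERIV_chain2[OF d1 this]] show ?thesis by simp
        qed
      qed (use e H in \<open>auto intro!: continuous_intros\<close>)
      then show ?thesis by simp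
    qed
    also have "\<dots> = (f2 (z + e) - f2 (z + e - e)) - (f2 (z + 0) - f2 (z + 0 - e))"
    proof (rule ivl_FTC)
      show "DERIV (\<lambda>a. f2 (z + a) - f2 (z + a - e)) a :> ?f1 (z + a) - ?f1 (z + a - e)" for a
      proof -
        have "DERIV (\<lambda>a. z + a) a :> 1" "DERIV (\<lambda>a. z + a - e) a :> 1" by (auto intro!: derivative_eq_intros)
        from DERIV_diff[OF DERIV_chain2[OF d2 this(1)] DERIV_chain2[OF d2 this(2)]] show ?thesis by simp
      qed
      show "continuous_on UNIV (\<lambda>a. ?f1 (z + a) - ?f1 (z + a - e))"
        by (intro continuous_on_diff continuous_on_compose2[OF c1] continuous_intros) auto
    qed (use e in auto)
    finally show ?thesis by simp
  qed
  have i: "integrable (ivl2 0 e 0 e) (\<lambda>p. \<bar>z + fst p - snd p\<bar> powr ?p)" for z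
    using H by (intro ivl2_continuous_integrable continuous_intros) auto
  have "(\<integral>p. incov H h (0 + fst p - snd p) \<partial>ivl2 0 e 0 e) =
     (\<integral>p. (\<bar>h + fst p - snd p\<bar> powr ?p + \<bar>- h + fst p - snd p\<bar> powr ?p - 2 * \<bar>0 + fst p - snd p\<bar> powr ?p) / 2 \<partial>ivl2 0 e 0 e)"
    by (intro Bochner_Integration.integral_cong) (auto simp: incov_def algebra_simps)
  also have "\<dots> = ((\<integral>p. \<bar>h + fst p - snd p\<bar> powr ?p \<partial>ivl2 0 e 0 e) + (\<integral>p. \<bar>- h + fst p - snd p\<bar> powr ?p \<partial>ivl2 0 e 0 e)
      - 2 * (\<integral>p. \<bar>0 + fst p - snd p\<bar> powr ?p \<partial>ivl2 0 e 0 e)) / 2"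
    using i[of h] i[of "-h"] i[of 0] by simp
  also have "\<dots> = f2 (h + e) + f2 (h - e) - 2 * f2 h - 2 * f2 e"
  proof -
    have "f2 (- h + e) = f2 (h - e)" "f2 (- h - e) = f2 (h + e)" "f2 (- h) = f2 h" "f2 (0 + e) = f2 e" "f2 (0 - e) = f2 e" "f2 0 = 0"
      using H by (simp_all add: f2_def abs_minus_commute abs_minus_cancel[of "h + e", symmetric] del: abs_minus_cancel)
    then show ?thesis unfolding D by simp
  qed
  finally have "avg_incov H e h 0 = (f2 (h + e) + f2 (h - e) - 2 * f2 h - 2 * f2 e) / e\<^sup>2" by (simp add: avg_incov_def)
  also have "f2 (h + e) + f2 (h - e) - 2 * f2 h - 2 * f2 e =
     (\<bar>h + e\<bar> powr (2*H+2) + \<bar>h - e\<bar> powr (2*H+2) - 2 * \<bar>h\<bar> powr (2*H+2) - 2 * e powr (2*H+2)) / ((2*H+1) * (2*H+2))"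
    using e by (simp add: f2_def add_divide_distrib diff_divide_distrib)
  finally show ?thesis by simp
qed

subsection \<open>Second-order structure of fractional Brownian motion\<close>

lemma (in gaussian_process) glim_cong:
  assumes "glim X" "\<And>w. w \<in> space M \<Longrightarrow> X w = X' w" shows "glim X'"
  using assms unfolding glim_def by auto

lemma (in gaussian_process) glim_expectation_abs_prod_le:
  assumes "glim X" "glim Y"
  shows "expectation (\<lambda>w. \<bar>X w * Y w\<bar>) \<le> (expectation (\<lambda>w. (X w)\<^sup>2) + expectation (\<lambda>w. (Y w)\<^sup>2)) / 2"
proof -
  have "expectation (\<lambda>w. \<bar>X w * Y w\<bar>) \<le> expectation (\<lambda>w. ((X w)\<^sup>2 + (Y w)\<^sup>2) / 2)"
  proof (rule integral_mono)
    show "\<bar>X w * Y w\<bar> \<le> ((X w)\<^sup>2 + (Y w)\<^sup>2) / 2" for w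
      using sum_squares_bound[of "\<bar>X w\<bar>" "\<bar>Y w\<bar>"] by (simp add: abs_mult)
  qed (use assms in \<open>auto intro!: integrable_abs glim_prod_integrable glim_moments\<close>)
  also have "\<dots> = (expectation (\<lambda>w. (X w)\<^sup>2) + expectation (\<lambda>w. (Y w)\<^sup>2)) / 2"
    using glim_moments(1)[OF assms(1), of 2] glim_moments(1)[OF assms(2), of 2] by simp
  finally show ?thesis .
qed

text \<open>Squaring Gaussians squares their covariance, so moderate decay of correlations becomes
  integrable decay; this drives the concentration of squared increments.\<close>

lemma (in gaussian_process) glim_wick_centered:
  assumes X: "glim X" and Y: "glim Y"
    and V: "expectation (\<lambda>w. (X w)\<^sup>2) = V" "expectation (\<lambda>w. (Y w)\<^sup>2) = V"
  shows "integrable M (\<lambda>w. ((X w)\<^sup>2 - V) * ((Y w)\<^sup>2 - V))"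
    and "expectation (\<lambda>w. ((X w)\<^sup>2 - V) * ((Y w)\<^sup>2 - V)) = 2 * (expectation (\<lambda>w. X w * Y w))\<^sup>2"
    and "expectation (\<lambda>w. \<bar>((X w)\<^sup>2 - V) * ((Y w)\<^sup>2 - V)\<bar>) \<le> 2 * V\<^sup>2"
proof -
  have *: "integrable M (\<lambda>w. ((X w)\<^sup>2 - V) * ((Y w)\<^sup>2 - V)) \<and>
     expectation (\<lambda>w. ((X w)\<^sup>2 - V) * ((Y w)\<^sup>2 - V)) = 2 * (expectation (\<lambda>w. X w * Y w))\<^sup>2"
    if X: "glim X" and Y: "glim Y"
    and V: "expectation (\<lambda>w. (X w)\<^sup>2) = V" "expectation (\<lambda>w. (Y w)\<^sup>2) = V" for X Y
  proof -
    have i: "integrable M (\<lambda>w. (X w)\<^sup>2)" "integrable M (\<lambda>w. (Y w)\<^sup>2)" "integrable M (\<lambda>w. (X w)\<^sup>2 * (Y w)\<^sup>2)"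
      using X Y by (auto intro: glim_moments glim_prod_integrable)
    have eq: "(\<lambda>w. ((X w)\<^sup>2 - V) * ((Y w)\<^sup>2 - V)) = (\<lambda>w. (X w)\<^sup>2 * (Y w)\<^sup>2 - V * (X w)\<^sup>2 - V * (Y w)\<^sup>2 + V * V)"
      by (auto simp: algebra_simps)
    have "expectation (\<lambda>w. (X w)\<^sup>2 * (Y w)\<^sup>2 - V * (X w)\<^sup>2 - V * (Y w)\<^sup>2 + V * V)
        = expectation (\<lambda>w. (X w)\<^sup>2 * (Y w)\<^sup>2) - V * V - V * V + V * V"
      using i V by (simp add: prob_space)
    then show ?thesis unfolding eq using i glim_wick[OF X Y] V by simp
  qed
  show i: "integrable M (\<lambda>w. ((X w)\<^sup>2 - V) * ((Y w)\<^sup>2 - V))"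
    "expectation (\<lambda>w. ((X w)\<^sup>2 - V) * ((Y w)\<^sup>2 - V)) = 2 * (expectation (\<lambda>w. X w * Y w))\<^sup>2"
    using *[OF X Y V] by auto
  have sq: "integrable M (\<lambda>w. ((Z w)\<^sup>2 - V) * ((Z w)\<^sup>2 - V))" "expectation (\<lambda>w. ((Z w)\<^sup>2 - V) * ((Z w)\<^sup>2 - V)) = 2 * V\<^sup>2"
    if "glim Z" "expectation (\<lambda>w. (Z w)\<^sup>2) = V" for Z
    using *[OF that(1) that(1) that(2) that(2)] that(2) by (auto simp: power2_eq_square)
  have "expectation (\<lambda>w. \<bar>((X w)\<^sup>2 - V) * ((Y w)\<^sup>2 - V)\<bar>) \<le>
     expectation (\<lambda>w. (((X w)\<^sup>2 - V) * ((X w)\<^sup>2 - V) + ((Y w)\<^sup>2 - V) * ((Y w)\<^sup>2 - V)) / 2)"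
  proof (rule integral_mono)
    show "\<bar>((X w)\<^sup>2 - V) * ((Y w)\<^sup>2 - V)\<bar> \<le> (((X w)\<^sup>2 - V) * ((X w)\<^sup>2 - V) + ((Y w)\<^sup>2 - V) * ((Y w)\<^sup>2 - V)) / 2" for w
      using sum_squares_bound[of "\<bar>(X w)\<^sup>2 - V\<bar>" "\<bar>(Y w)\<^sup>2 - V\<bar>"] by (simp add: abs_mult power2_eq_square[symmetric])
  qed (use i(1) sq(1)[OF X V(1)] sq(1)[OF Y V(2)] in \<open>auto intro!: integrable_abs Bochner_Integration.integrable_add\<close>)
  also have "\<dots> = 2 * V\<^sup>2" using sq[OF X V(1)] sq[OF Y V(2)] by simp
  finally show "expectation (\<lambda>w. \<bar>((X w)\<^sup>2 - V) * ((Y w)\<^sup>2 - V)\<bar>) \<le> 2 * V\<^sup>2" .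
qed

lemma avg_incov_measurable [measurable]: "(\<lambda>z. avg_incov H e h z) \<in> borel_measurable borel"
proof -
  interpret I: finite_measure "ivl2 0 e 0 e" by (rule finite_measure_ivl2)
  have "(\<lambda>(z, p). incov H h (z + fst p - snd p)) \<in> borel_measurable (borel \<Otimes>\<^sub>M ivl2 0 e 0 e)"
    unfolding incov_def by measurable
  from ivl2.P.borel_measurable_lebesgue_integral[OF this] show ?thesis unfolding avg_incov_def by simp
qed

text \<open>The functional sees the motion through increments, and their variances determine the
  covariances by polarization (\<open>W_increment_cov\<close>).\<close>

locale fbm = gaussian_process M W for M :: "'a measure" and W :: "real \<Rightarrow> 'a \<Rightarrow> real" +
  fixes H :: real
  assumes H_pos: "0 < H" and H_le: "H \<le> 1/4"
    and W_var: "\<And>s t. s \<ge> 0 \<Longrightarrow> t \<ge> 0 \<Longrightarrow> expectation (\<lambda>w. (W t w - W s w)\<^sup>2) = \<bar>t - s\<bar> powr (2*H)"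
begin

lemma H_half: "H \<le> 1/2" using H_le by simp

lemma glim_W: "t \<ge> 0 \<Longrightarrow> glim (W t)"
  by (rule glim_lincomb[OF lincomb_W])

lemma W_joint [measurable (raw)]:
  assumes "g \<in> measurable K M" "X \<in> borel_measurable K"
  shows "(\<lambda>z. W (X z) (g z)) \<in> borel_measurable K"
  using measurable_compose_caratheodory[of "\<lambda>w t. W t w" M g K X] W_continuous assms by auto

lemma W_increment_cov:
  assumes nn: "a \<ge> 0" "b \<ge> 0" "c \<ge> 0" "d \<ge> 0"
  shows "expectation (\<lambda>w. (W a w - W b w) * (W c w - W d w)) =
    (\<bar>a - d\<bar> powr (2*H) + \<bar>b - c\<bar> powr (2*H) - \<bar>a - c\<bar> powr (2*H) - \<bar>b - d\<bar> powr (2*H)) / 2"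
proof -
  have i: "integrable M (\<lambda>w. (W s w - W t w)\<^sup>2)" if "s \<ge> 0" "t \<ge> 0" for s t
    using glim_moments(1)[OF glim_diff[OF glim_W glim_W], of s t 2] that by simp
  have "expectation (\<lambda>w. (W a w - W b w) * (W c w - W d w)) =
    expectation (\<lambda>w. ((W a w - W d w)\<^sup>2 + (W b w - W c w)\<^sup>2 - (W a w - W c w)\<^sup>2 - (W b w - W d w)\<^sup>2) / 2)"
    by (intro Bochner_Integration.integral_cong) (auto simp: power2_eq_square algebra_simps)
  also have "\<dots> = (expectation (\<lambda>w. (W a w - W d w)\<^sup>2) + expectation (\<lambda>w. (W b w - W c w)\<^sup>2)
      - expectation (\<lambda>w. (W a w - W c w)\<^sup>2) - expectation (\<lambda>w. (W b w - W d w)\<^sup>2)) / 2"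
    using i nn by simp
  also have "\<dots> = (\<bar>a - d\<bar> powr (2*H) + \<bar>b - c\<bar> powr (2*H) - \<bar>a - c\<bar> powr (2*H) - \<bar>b - d\<bar> powr (2*H)) / 2"
    using nn by (simp add: W_var abs_minus_commute)
  finally show ?thesis .
qed

lemma W_increment_cov_incov:
  assumes "u \<ge> 0" "v \<ge> 0" "u + h \<ge> 0" "v + h \<ge> 0"
  shows "expectation (\<lambda>w. (W (u + h) w - W u w) * (W (v + h) w - W v w)) = incov H h (u - v)"
  using W_increment_cov[of "u + h" u "v + h" v] assms by (simp add: incov_def algebra_simps)

text \<open>The difference of the values at \<open>u\<close> and 0 is the inner integral of
  \<open>G_breve\<close>, see \<open>integral_increment_eq\<close>.\<close>

definition moving_avg :: "real \<Rightarrow> real \<Rightarrow> 'a \<Rightarrow> real" where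
  "moving_avg e u w = (\<integral>a. W (u + a) w \<partial>ivl 0 e) / e"

lemma W_shift_continuous:
  assumes "w \<in> space M" shows "continuous_on UNIV (\<lambda>a. W (u + a) w)"
  by (intro continuous_on_compose2[OF W_continuous[OF assms]] continuous_intros) auto

lemma moving_avg_continuous:
  assumes w: "w \<in> space M" shows "continuous_on UNIV (\<lambda>u. moving_avg e u w)"
proof -
  have "continuous_on (UNIV \<times> cbox 0 e) (\<lambda>(u, a). W (u + a) w)"
    unfolding case_prod_beta by (intro continuous_on_compose2[OF W_continuous[OF w]] continuous_intros) auto
  from integral_continuous_on_param[OF this]
  have "continuous_on UNIV (\<lambda>u. integral {0..e} (\<lambda>a. W (u + a) w))" by simp
  then show ?thesis unfolding moving_avg_def ivl_continuous(2)[OF W_shift_continuous[OF w]]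
    by (cases "e = 0") (auto intro!: continuous_intros)
qed

lemma moving_avg_measurable [measurable]: "moving_avg e u \<in> borel_measurable M"
  unfolding moving_avg_def
  by (intro borel_measurable_divide borel_measurable_ivl_integral W_measurable W_shift_continuous) auto

lemma moving_avg_joint [measurable (raw)]:
  assumes "g \<in> measurable K M" "X \<in> borel_measurable K"
  shows "(\<lambda>z. moving_avg e (X z) (g z)) \<in> borel_measurable K"
  using measurable_compose_caratheodory[of "\<lambda>w u. moving_avg e u w" M g K X] moving_avg_continuous assms by auto

lemma glim_moving_avg:
  assumes "u \<ge> 0" "e > 0" shows "glim (moving_avg e u)"
proof -
  have "glim (\<lambda>w. integral {0..e} (\<lambda>a. 1 * W (u + a) w))"
    using assms by (intro glim_integral lincomb_W continuous_on_subset[OF W_shift_continuous]) auto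
  from glim_scale[OF this, of "1 / e"] show ?thesis
    by (rule glim_cong) (simp add: moving_avg_def ivl_continuous(2)[OF W_shift_continuous])
qed

lemma moving_avg_increment_cov:
  assumes e: "e > 0" and nn: "u \<ge> 0" "v \<ge> 0" "u + h \<ge> 0" "v + h \<ge> 0"
  shows "expectation (\<lambda>w. (moving_avg e (u + h) w - moving_avg e u w) * (moving_avg e (v + h) w - moving_avg e v w)) = avg_incov H e h (u - v)"
proof -
  let ?f = "\<lambda>w p. (W (u + h + fst p) w - W (u + fst p) w) * (W (v + h + snd p) w - W (v + snd p) w)"
  interpret I: finite_measure "ivl2 0 e 0 e" by (rule finite_measure_ivl2)
  have bd: "integrable M (\<lambda>w. ?f w p) \<and> expectation (\<lambda>w. \<bar>?f w p\<bar>) \<le> \<bar>h\<bar> powr (2*H) \<and>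
     expectation (\<lambda>w. ?f w p) = incov H h (u - v + fst p - snd p)"
    if p: "fst p \<in> {0..e} \<and> snd p \<in> {0..e}" for p
  proof -
    have g: "glim (\<lambda>w. W (u + h + fst p) w - W (u + fst p) w)" "glim (\<lambda>w. W (v + h + snd p) w - W (v + snd p) w)"
      using p nn by (auto intro!: glim_diff glim_W)
    have "expectation (\<lambda>w. \<bar>?f w p\<bar>) \<le> (\<bar>h\<bar> powr (2*H) + \<bar>h\<bar> powr (2*H)) / 2"
      using glim_expectation_abs_prod_le[OF g] p nn by (simp add: W_var)
    moreover have "expectation (\<lambda>w. ?f w p) = incov H h (u - v + fst p - snd p)"
      using W_increment_cov_incov[of "u + fst p" "v + snd p" h] p nn by (simp add: algebra_simps)
    ultimately show ?thesis using glim_prod_integrable(1)[OF g] by simp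
  qed
  have ae: "AE p in ivl2 0 e 0 e. integrable M (\<lambda>w. ?f w p) \<and> expectation (\<lambda>w. \<bar>?f w p\<bar>) \<le> \<bar>h\<bar> powr (2*H)"
    using AE_ivl2[of 0 e 0 e] by eventually_elim (use bd in blast)
  have ae': "AE p in ivl2 0 e 0 e. expectation (\<lambda>w. ?f w p) = incov H h (u - v + fst p - snd p)"
    using AE_ivl2[of 0 e 0 e] by eventually_elim (use bd in blast)
  have m: "(\<lambda>(w, p). ?f w p) \<in> borel_measurable (M \<Otimes>\<^sub>M ivl2 0 e 0 e)" by measurable
  note fub = fubini_expectation[OF ivl2.P.sigma_finite_measure_axioms m ae I.integrable_const]
  have prod: "(moving_avg e (u + h) w - moving_avg e u w) * (moving_avg e (v + h) w - moving_avg e v w) = (\<integral>p. ?f w p \<partial>ivl2 0 e 0 e) / e\<^sup>2"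
    if w: "w \<in> space M" for w
  proof -
    have d: "moving_avg e (x + h) w - moving_avg e x w = (\<integral>a. W (x + h + a) w - W (x + a) w \<partial>ivl 0 e) / e" for x
      unfolding moving_avg_def using ivl_continuous(1)[OF W_shift_continuous[OF w]] by (simp add: diff_divide_distrib)
    have i: "integrable (ivl 0 e) (\<lambda>a. W (x + h + a) w - W (x + a) w)" for x
      by (intro Bochner_Integration.integrable_diff ivl_continuous(1) W_shift_continuous w)
    show ?thesis unfolding d using ivl2_product[OF i i, of u v] by (simp add: power2_eq_square)
  qed
  have "expectation (\<lambda>w. (moving_avg e (u + h) w - moving_avg e u w) * (moving_avg e (v + h) w - moving_avg e v w)) =
      expectation (\<lambda>w. (\<integral>p. ?f w p \<partial>ivl2 0 e 0 e) / e\<^sup>2)"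
    by (intro Bochner_Integration.integral_cong) (auto simp: prod)
  also have "\<dots> = (\<integral>p. expectation (\<lambda>w. ?f w p) \<partial>ivl2 0 e 0 e) / e\<^sup>2" using fub(2) by simp
  also have "(\<integral>p. expectation (\<lambda>w. ?f w p) \<partial>ivl2 0 e 0 e) = (\<integral>p. incov H h (u - v + fst p - snd p) \<partial>ivl2 0 e 0 e)"
    by (rule integral_cong_AE[OF fub(5) _ ae']) (unfold incov_def, measurable)
  finally show ?thesis by (simp add: avg_incov_def)
qed

lemma moving_avg_increment_var:
  assumes "e > 0" "u \<ge> 0" "u + h \<ge> 0"
  shows "expectation (\<lambda>w. (moving_avg e (u + h) w - moving_avg e u w)\<^sup>2) = avg_incov H e h 0"
  using moving_avg_increment_cov[of e u u h] assms by (simp add: power2_eq_square)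

text \<open>Centered time integral of squared increments at lag \<open>h\<close>. The indicator is
  the domain that remains when the square \<open>[0,T] x [0,T]\<close> is written in terms of base
  point and lag.\<close>

definition increment_fluct :: "real \<Rightarrow> real \<Rightarrow> real \<Rightarrow> 'a \<Rightarrow> real" where
  "increment_fluct T e h w = (\<integral>u. indicator {0..T} (u + h) * ((moving_avg e (u + h) w - moving_avg e u w)\<^sup>2 - avg_incov H e h 0) \<partial>ivl 0 T)"

lemma increment_fluct_joint [measurable (raw)]:
  assumes [measurable]: "g \<in> measurable K M" "X \<in> borel_measurable K"
  shows "(\<lambda>z. increment_fluct T e (X z) (g z)) \<in> borel_measurable K"
proof -
  have V: "(\<lambda>h. avg_incov H e h 0) \<in> borel_measurable borel"
  proof -
    interpret I: finite_measure "ivl2 0 e 0 e" by (rule finite_measure_ivl2)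
    have "(\<lambda>(h, p). incov H h (0 + fst p - snd p)) \<in> borel_measurable (borel \<Otimes>\<^sub>M ivl2 0 e 0 e)"
      unfolding incov_def by measurable
    from ivl2.P.borel_measurable_lebesgue_integral[OF this] show ?thesis unfolding avg_incov_def by simp
  qed
  note [measurable] = V
  have "(\<lambda>(z, u). indicator {0..T} (u + X z) * ((moving_avg e (u + X z) (g z) - moving_avg e u (g z))\<^sup>2 - avg_incov H e (X z) 0))
     \<in> borel_measurable (K \<Otimes>\<^sub>M ivl 0 T)"
    by measurable
  from ivl.borel_measurable_lebesgue_integral[OF this] show ?thesis unfolding increment_fluct_def .
qed

text \<open>By Wick's formula the second moment is a double integral of
  \<open>2 * avg_incov^2\<close>, and integrating the Cauchy kernel in one variable yields a factor
  \<open>m * pi\<close>. The extra \<open>m^(1/2)\<close> over the trivial order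
  \<open>m^(2*H)\<close> is the decorrelation gain. The constant 16 is the square root of
  \<open>2 * 128\<close>.\<close>

lemma increment_fluct_bound:
  fixes e T h :: real
  assumes e: "e > 0" and T: "T > 0"
  defines "m \<equiv> max \<bar>h\<bar> e"
  shows "integrable M (\<lambda>w. increment_fluct T e h w)"
    and "expectation (\<lambda>w. \<bar>increment_fluct T e h w\<bar>) \<le> 16 * sqrt (pi * T) * m powr (2*H + 1/2)"
proof -
  let ?i = "\<lambda>u. indicator {0..T} (u + h) :: real"
  let ?V = "avg_incov H e h 0"
  let ?Z = "\<lambda>u w. (moving_avg e (u + h) w - moving_avg e u w)\<^sup>2 - ?V"
  let ?f = "\<lambda>w p. (?i (fst p) * ?Z (fst p) w) * (?i (snd p) * ?Z (snd p) w)"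
  interpret I: finite_measure "ivl2 0 T 0 T" by (rule finite_measure_ivl2)
  have m: "m > 0" "\<bar>h\<bar> \<le> m" "e \<le> m" using e by (auto simp: m_def)
  have bd: "integrable M (\<lambda>w. ?f w p) \<and> expectation (\<lambda>w. \<bar>?f w p\<bar>) \<le> 2 * ?V\<^sup>2 \<and>
     expectation (\<lambda>w. ?f w p) = ?i (fst p) * ?i (snd p) * (2 * (avg_incov H e h (fst p - snd p))\<^sup>2)"
    if p: "fst p \<in> {0..T} \<and> snd p \<in> {0..T}" for p
  proof (cases "fst p + h \<in> {0..T} \<and> snd p + h \<in> {0..T}")
    case True
    let ?Zu = "\<lambda>u w. moving_avg e (u + h) w - moving_avg e u w"
    have g: "glim (?Zu (fst p))" "glim (?Zu (snd p))" using True p e by (auto intro!: glim_diff glim_moving_avg)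
    have v: "expectation (\<lambda>w. (?Zu (fst p) w)\<^sup>2) = ?V" "expectation (\<lambda>w. (?Zu (snd p) w)\<^sup>2) = ?V"
      using True p e by (auto intro!: moving_avg_increment_var)
    have c: "expectation (\<lambda>w. ?Zu (fst p) w * ?Zu (snd p) w) = avg_incov H e h (fst p - snd p)"
      using True p e by (intro moving_avg_increment_cov) auto
    show ?thesis using glim_wick_centered[OF g v] True c by simp
  qed (auto simp: indicator_def)
  have ae: "AE p in ivl2 0 T 0 T. integrable M (\<lambda>w. ?f w p) \<and> expectation (\<lambda>w. \<bar>?f w p\<bar>) \<le> 2 * ?V\<^sup>2"
    using AE_ivl2[of 0 T 0 T] by eventually_elim (use bd in blast)
  have ae': "AE p in ivl2 0 T 0 T. expectation (\<lambda>w. ?f w p) = ?i (fst p) * ?i (snd p) * (2 * (avg_incov H e h (fst p - snd p))\<^sup>2)"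
    using AE_ivl2[of 0 T 0 T] by eventually_elim (use bd in blast)
  have fm: "(\<lambda>(w, p). ?f w p) \<in> borel_measurable (M \<Otimes>\<^sub>M ivl2 0 T 0 T)" by measurable
  note fub = fubini_expectation[OF ivl2.P.sigma_finite_measure_axioms fm ae I.integrable_const]
  have sq: "(increment_fluct T e h w)\<^sup>2 = (\<integral>p. ?f w p \<partial>ivl2 0 T 0 T)" if w: "w \<in> space M" for w
  proof -
    have c: "continuous_on UNIV (\<lambda>u. ?Z u w)"
      by (intro continuous_intros moving_avg_continuous[OF w] continuous_on_compose2[OF moving_avg_continuous[OF w]]) auto
    have "integrable (ivl 0 T) (\<lambda>u. indicator {u. u + h \<in> {0..T}} u *\<^sub>R ?Z u w)"
      by (rule integrable_mult_indicator) (auto intro: ivl_continuous(1)[OF c])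
    then have i: "integrable (ivl 0 T) (\<lambda>u. ?i u * ?Z u w)" by (simp add: indicator_def)
    show ?thesis unfolding increment_fluct_def power2_eq_square[of "integral\<^sup>L _ _"] using ivl2_product[OF i i] by simp
  qed
  have i2: "integrable M (\<lambda>w. (increment_fluct T e h w)\<^sup>2)"
  proof -
    have "integrable M (\<lambda>w. (increment_fluct T e h w)\<^sup>2) \<longleftrightarrow> integrable M (\<lambda>w. \<integral>p. ?f w p \<partial>ivl2 0 T 0 T)"
      by (intro Bochner_Integration.integrable_cong refl sq)
    with fub(1) show ?thesis by blast
  qed
  have im: "(\<lambda>p. ?i (fst p) * ?i (snd p) * (2 * (avg_incov H e h (fst p - snd p))\<^sup>2)) \<in> borel_measurable (borel \<Otimes>\<^sub>M borel)"
    by measurable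
  have km: "continuous_on UNIV (\<lambda>p. 256 * m powr (4*H) * (1 / (1 + ((snd p - fst p) / m)\<^sup>2)))"
  proof -
    have "1 + x\<^sup>2 \<noteq> (0::real)" for x using zero_le_power2[of x] by linarith
    then show ?thesis using m(1)
      by (intro continuous_on_mult continuous_on_divide continuous_on_add continuous_on_power continuous_on_diff
         continuous_on_const continuous_on_fst continuous_on_snd continuous_on_id) auto
  qed
  have "expectation (\<lambda>w. (increment_fluct T e h w)\<^sup>2) = expectation (\<lambda>w. \<integral>p. ?f w p \<partial>ivl2 0 T 0 T)"
    by (intro Bochner_Integration.integral_cong) (auto simp: sq)
  also have "\<dots> = (\<integral>p. expectation (\<lambda>w. ?f w p) \<partial>ivl2 0 T 0 T)" by (rule fub(2))
  also have "\<dots> = (\<integral>p. ?i (fst p) * ?i (snd p) * (2 * (avg_incov H e h (fst p - snd p))\<^sup>2) \<partial>ivl2 0 T 0 T)"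
    by (rule integral_cong_AE[OF fub(5) _ ae']) measurable
  also have "\<dots> \<le> (\<integral>p. 256 * m powr (4*H) * (1 / (1 + ((snd p - fst p) / m)\<^sup>2)) \<partial>ivl2 0 T 0 T)"
  proof (rule integral_mono)
    show "integrable (ivl2 0 T 0 T) (\<lambda>p. ?i (fst p) * ?i (snd p) * (2 * (avg_incov H e h (fst p - snd p))\<^sup>2))"
    proof (rule ivl2_bounded(1)[OF im])
      fix x y
      have "(avg_incov H e h (x - y))\<^sup>2 \<le> (\<bar>h\<bar> powr (2*H))\<^sup>2"
        using abs_avg_incov_le[OF H_pos H_half e, of h "x - y"] by (metis abs_ge_zero power2_abs power_mono)
      then show "\<bar>?i (fst (x, y)) * ?i (snd (x, y)) * (2 * (avg_incov H e h (fst (x, y) - snd (x, y)))\<^sup>2)\<bar> \<le> 2 * (\<bar>h\<bar> powr (2*H))\<^sup>2"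
        by (auto simp: indicator_def)
    qed (use T in auto)
    show "integrable (ivl2 0 T 0 T) (\<lambda>p. 256 * m powr (4*H) * (1 / (1 + ((snd p - fst p) / m)\<^sup>2)))"
      by (rule ivl2_continuous_integrable[OF km])
    fix p :: "real \<times> real"
    have "?i (fst p) * ?i (snd p) * (2 * (avg_incov H e h (fst p - snd p))\<^sup>2) \<le> 2 * (avg_incov H e h (fst p - snd p))\<^sup>2"
      by (auto simp: indicator_def)
    also have "\<dots> \<le> 2 * (128 * m powr (4*H) / (1 + ((fst p - snd p) / m)\<^sup>2))"
      using avg_incov_sq_le[OF H_pos H_half e m(2,3)] by (intro mult_left_mono) auto
    also have "((fst p - snd p) / m)\<^sup>2 = ((snd p - fst p) / m)\<^sup>2" by (simp add: power_divide power2_commute)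
    finally show "?i (fst p) * ?i (snd p) * (2 * (avg_incov H e h (fst p - snd p))\<^sup>2) \<le> 256 * m powr (4*H) * (1 / (1 + ((snd p - fst p) / m)\<^sup>2))"
      by simp
  qed
  also have "\<dots> = 256 * m powr (4*H) * (\<integral>x. \<integral>y. 1 / (1 + ((y - x) / m)\<^sup>2) \<partial>ivl 0 T \<partial>ivl 0 T)"
    by (subst ivl2_integral_iterated[OF ivl2_continuous_integrable[OF km]]) (simp del: times_divide_eq_right)
  also have "\<dots> \<le> 256 * m powr (4*H) * (\<integral>x. m * pi \<partial>ivl 0 T)"
  proof (rule mult_left_mono)
    have "integrable (ivl2 0 T 0 T) (\<lambda>p. 1 / (1 + ((snd p - fst p) / m)\<^sup>2))"
      using ivl2_continuous_integrable[OF km, of 0 T 0 T] m(1) by (simp del: times_divide_eq_right)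
    from ivl2.integrable_fst'[OF this]
    have "integrable (ivl 0 T) (\<lambda>x. \<integral>y. 1 / (1 + ((y - x) / m)\<^sup>2) \<partial>ivl 0 T)" by simp
    then show "(\<integral>x. \<integral>y. 1 / (1 + ((y - x) / m)\<^sup>2) \<partial>ivl 0 T \<partial>ivl 0 T) \<le> (\<integral>x. m * pi \<partial>ivl 0 T)"
      using m(1) T by (intro integral_mono integral_arctan_kernel_le) auto
  qed simp
  also have "\<dots> = 256 * (pi * T) * (m powr (4*H) * m)" using T by (simp add: measure_ivl)
  also have "m powr (4*H) * m = (m powr (2*H + 1/2))\<^sup>2"
  proof -
    have "m powr (4*H) * m = m powr (4*H + 1)" using m(1) by (simp add: powr_add)
    then show ?thesis by (simp add: power2_eq_square powr_add[symmetric])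
  qed
  finally have E2: "expectation (\<lambda>w. (increment_fluct T e h w)\<^sup>2) \<le> (16 * sqrt (pi * T) * m powr (2*H + 1/2))\<^sup>2"
    using T by (simp add: power_mult_distrib)
  \<comment> \<open>Square root of the second-moment bound: with this choice the expectation of
    \<open>(x\<^sup>2 / c + c) / 2\<close> is again at most \<open>c\<close>.\<close>
  define c where "c = 16 * sqrt (pi * T) * m powr (2*H + 1/2)"
  have c: "c > 0" using T m(1) by (simp add: c_def)
  have le: "\<bar>x\<bar> \<le> (x\<^sup>2 / c + c) / 2" for x
  proof -
    have "2 * \<bar>x\<bar> * c \<le> x\<^sup>2 + c\<^sup>2" using sum_squares_bound[of "\<bar>x\<bar>" c] by simp
    then show ?thesis using c by (simp add: field_simps power2_eq_square)
  qed
  have Sm: "increment_fluct T e h \<in> borel_measurable M" using increment_fluct_joint[of "\<lambda>w. w" M "\<lambda>_. h" T e] by simp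
  have ib: "integrable M (\<lambda>w. ((increment_fluct T e h w)\<^sup>2 / c + c) / 2)" using i2 by simp
  show i1: "integrable M (\<lambda>w. increment_fluct T e h w)"
    by (rule Bochner_Integration.integrable_bound[OF ib Sm]) (use le c in \<open>auto intro!: AE_I2 order_trans[OF le]\<close>)
  have "expectation (\<lambda>w. \<bar>increment_fluct T e h w\<bar>) \<le> expectation (\<lambda>w. ((increment_fluct T e h w)\<^sup>2 / c + c) / 2)"
    using i1 ib le by (intro integral_mono integrable_abs) auto
  also have "\<dots> = (expectation (\<lambda>w. (increment_fluct T e h w)\<^sup>2) / c + c) / 2" using i2 by (simp add: prob_space)
  also have "\<dots> \<le> (c\<^sup>2 / c + c) / 2" using E2 c unfolding c_def[symmetric] by (intro divide_right_mono add_mono) auto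
  also have "\<dots> = c" using c by (simp add: power2_eq_square)
  finally show "expectation (\<lambda>w. \<bar>increment_fluct T e h w\<bar>) \<le> 16 * sqrt (pi * T) * m powr (2*H + 1/2)" by (simp add: c_def)
qed

end

section \<open>Kernels of the quadratic form\<close>

lemma ivl2_integral_iterated_swap:
  fixes f :: "real \<times> real \<Rightarrow> real"
  assumes "integrable (ivl2 a b c d) f"
  shows "(\<integral>p. f p \<partial>ivl2 a b c d) = (\<integral>y. \<integral>x. f (x, y) \<partial>ivl a b \<partial>ivl c d)"
    and "integrable (ivl c d) (\<lambda>y. \<integral>x. f (x, y) \<partial>ivl a b)"
proof -
  have i: "integrable (ivl2 a b c d) (case_prod (\<lambda>x y. f (x, y)))" using assms by simp
  show "(\<integral>p. f p \<partial>ivl2 a b c d) = (\<integral>y. \<integral>x. f (x, y) \<partial>ivl a b \<partial>ivl c d)"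
    using ivl2.integral_snd[OF i] by simp
  show "integrable (ivl c d) (\<lambda>y. \<integral>x. f (x, y) \<partial>ivl a b)" using ivl2.integrable_snd[OF i] .
qed

text \<open>Covariance of the difference quotients of the motion over \<open>[u, u+e]\<close> and
  \<open>[v, v+d]\<close>, at \<open>z = u - v\<close>.\<close>

definition increment_kernel :: "real \<Rightarrow> real \<Rightarrow> real \<Rightarrow> real \<Rightarrow> real" where
  "increment_kernel H e d z = (\<bar>z + e\<bar> powr (2*H) + \<bar>z - d\<bar> powr (2*H) - \<bar>z + e - d\<bar> powr (2*H) - \<bar>z\<bar> powr (2*H)) / (2 * e * d)"

lemma increment_kernel_diag: "increment_kernel H e e z = incov H e z / e\<^sup>2"
  by (simp add: increment_kernel_def incov_def power2_eq_square)

lemma increment_kernel_diag_even: "increment_kernel H e e (- z) = increment_kernel H e e z"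
  unfolding increment_kernel_diag using incov_abs[of H e "- z"] incov_abs[of H e z] by simp

lemma continuous_on_increment_kernel:
  assumes "H > 0" "continuous_on S f"
  shows "continuous_on S (\<lambda>x. increment_kernel H e d (f x))"
  unfolding increment_kernel_def divide_inverse using assms
  by (intro continuous_on_mult continuous_on_diff continuous_on_add continuous_on_abs_powr continuous_on_const) auto

lemma increment_kernel_measurable [measurable]: "increment_kernel H e d \<in> borel_measurable borel"
  unfolding increment_kernel_def[abs_def] by measurable

text \<open>The second-derivative bound applies from distance \<open>2*e\<close> on; closer to the
  diagonal the crude bound loses a factor \<open>2^(2-2*H) \<le> 4\<close>. Writing the result in
  \<open>max \<bar>h\<bar> e\<close> unites the two ranges.\<close>

lemma abs_increment_kernel_diag_le:
  assumes H: "0 < H" "H \<le> 1/2" and e: "e > 0"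
  shows "\<bar>increment_kernel H e e h\<bar> \<le> 4 * (max \<bar>h\<bar> e) powr (2*H - 2)"
proof (cases "\<bar>h\<bar> \<ge> 2 * e")
  case True
  then have "\<bar>incov H e h\<bar> \<le> 4 * e\<^sup>2 * \<bar>h\<bar> powr (2*H - 2)" using abs_incov_far[OF H, of e h] e by simp
  then have "\<bar>incov H e h\<bar> / e\<^sup>2 \<le> 4 * \<bar>h\<bar> powr (2*H - 2)" using e by (subst pos_divide_le_eq) (auto simp: algebra_simps)
  moreover have "max \<bar>h\<bar> e = \<bar>h\<bar>" using True e by simp
  ultimately show ?thesis by (simp add: increment_kernel_diag)
next
  case False
  define m where "m = max \<bar>h\<bar> e"
  have m: "m > 0" "m \<le> 2 * e" "e \<le> m" using False e by (auto simp: m_def)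
  have "\<bar>incov H e h\<bar> / e\<^sup>2 \<le> e powr (2*H) / e\<^sup>2" using abs_incov_le[OF H, of e h] e by (intro divide_right_mono) auto
  also have "\<dots> = e powr (2*H - 2)" using e by (simp add: powr_diff)
  also have "\<dots> \<le> (m / 2) powr (2*H - 2)" using m e H by (intro powr_mono2') auto
  also have "\<dots> = m powr (2*H - 2) * 2 powr (2 - 2*H)" using m by (simp add: powr_divide powr_diff field_simps)
  also have "\<dots> \<le> m powr (2*H - 2) * 2 powr 2" using H by (intro mult_left_mono powr_mono) auto
  finally show ?thesis by (simp add: increment_kernel_diag m_def)
qed

text \<open>Uniform in \<open>e\<close> for fixed \<open>d\<close>: in the variable \<open>v\<close>
  the numerator consists of two increments over \<open>e\<close> of \<open>|t|^(2*H)\<close>, and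
  integrating them cancels the \<open>e\<close> in the denominator. The blow-up in \<open>d\<close>
  is harmless because \<open>d\<close> stays fixed in the mixing argument.\<close>

lemma integral_abs_increment_kernel_le:
  assumes H: "0 < H" and e: "0 < e" "e \<le> 1" and d: "d > 0" and u: "u \<in> {0..T}"
  shows "(\<integral>v. \<bar>increment_kernel H e d (u - v)\<bar> \<partial>ivl 0 T) \<le> 2 * (T + d + 2) powr (2*H) / d"
proof -
  let ?p = "2*H" and ?R = "T + d + 2"
  let ?g1 = "\<lambda>v. \<bar>\<bar>v + (- u - e) + e\<bar> powr ?p - \<bar>v + (- u - e)\<bar> powr ?p\<bar>"
  let ?g2 = "\<lambda>v. \<bar>\<bar>v + (- u + d - e) + e\<bar> powr ?p - \<bar>v + (- u + d - e)\<bar> powr ?p\<bar>"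
  have T: "0 \<le> T" using u by auto
  have c: "continuous_on UNIV ?g1" "continuous_on UNIV ?g2"
    using H by (intro continuous_on_rabs continuous_on_diff continuous_on_abs_powr continuous_on_add continuous_on_id continuous_on_const; simp)+
  have pw: "\<bar>increment_kernel H e d (u - v)\<bar> \<le> (?g1 v + ?g2 v) / (2 * e * d)" for v
  proof -
    have eqs: "\<bar>u - v + e\<bar> = \<bar>v + (- u - e)\<bar>" "\<bar>u - v - d\<bar> = \<bar>v + (- u + d - e) + e\<bar>"
      "\<bar>u - v + e - d\<bar> = \<bar>v + (- u + d - e)\<bar>" "\<bar>u - v\<bar> = \<bar>v + (- u - e) + e\<bar>" by arith+
    have "\<bar>\<bar>u - v + e\<bar> powr ?p + \<bar>u - v - d\<bar> powr ?p - \<bar>u - v + e - d\<bar> powr ?p - \<bar>u - v\<bar> powr ?p\<bar> \<le> ?g1 v + ?g2 v"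
      unfolding eqs by linarith
    then show ?thesis using e d by (simp add: increment_kernel_def abs_mult divide_right_mono)
  qed
  have "(\<integral>v. \<bar>increment_kernel H e d (u - v)\<bar> \<partial>ivl 0 T) \<le> (\<integral>v. (?g1 v + ?g2 v) / (2 * e * d) \<partial>ivl 0 T)"
  proof (rule integral_mono[OF _ _ pw])
    show "integrable (ivl 0 T) (\<lambda>v. \<bar>increment_kernel H e d (u - v)\<bar>)"
      by (intro ivl_continuous(1) continuous_on_rabs continuous_on_increment_kernel H continuous_on_diff continuous_on_const continuous_on_id)
    show "integrable (ivl 0 T) (\<lambda>v. (?g1 v + ?g2 v) / (2 * e * d))" using ivl_continuous(1)[OF c(1)] ivl_continuous(1)[OF c(2)] by auto
  qed
  also have "\<dots> = ((\<integral>v. ?g1 v \<partial>ivl 0 T) + (\<integral>v. ?g2 v \<partial>ivl 0 T)) / (2 * e * d)"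
    using ivl_continuous(1)[OF c(1)] ivl_continuous(1)[OF c(2)] by simp
  also have "\<dots> \<le> (2 * e * ?R powr ?p + 2 * e * ?R powr ?p) / (2 * e * d)"
  proof -
    have "(\<integral>v. ?g1 v \<partial>ivl 0 T) \<le> 2 * e * ?R powr ?p"
      by (rule integral_abs_powr_increment_le) (use T H e d u in \<open>auto simp: abs_le_iff\<close>)
    moreover have "(\<integral>v. ?g2 v \<partial>ivl 0 T) \<le> 2 * e * ?R powr ?p"
      by (rule integral_abs_powr_increment_le) (use T H e d u in \<open>auto simp: abs_le_iff abs_if\<close>)
    ultimately show ?thesis using e d by (intro divide_right_mono add_mono) auto
  qed
  also have "\<dots> = 2 * ?R powr ?p / d" using e d by (simp add: field_simps)
  finally show ?thesis .
qed

definition kernel_marginal :: "real \<Rightarrow> real \<Rightarrow> real \<Rightarrow> real \<Rightarrow> real" where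
  "kernel_marginal H T e u = (\<integral>v. increment_kernel H e e (u - v) \<partial>ivl 0 T)"

lemma kernel_marginal_integrable: "H > 0 \<Longrightarrow> integrable (ivl a b) (kernel_marginal H T e)"
  unfolding kernel_marginal_def
  using ivl2.integrable_fst'[OF ivl2_continuous_integrable[OF continuous_on_increment_kernel[of H UNIV "\<lambda>p. fst p - snd p" e e]], of a b 0 T]
  by (simp add: continuous_on_diff continuous_on_fst continuous_on_snd)

text \<open>Integrating the kernel in \<open>v\<close> and then in \<open>u\<close> supplies two
  factors \<open>e\<close> against the denominator \<open>e\<^sup>2\<close>. Hence the part of the
  quadratic form weighted by the squared path stays bounded in L1 as \<open>e\<close> tends to
  0.\<close>

lemma integral_abs_kernel_marginal_le:
  assumes H: "0 < H" and e: "0 < e" "e \<le> 1" and T: "T \<ge> 0"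
  shows "(\<integral>u. \<bar>kernel_marginal H T e u\<bar> \<partial>ivl 0 T) \<le> 2 * (T + 2) powr (2*H)"
proof -
  let ?p = "2*H" and ?R = "T + 2"
  define f1 where "f1 = (\<lambda>t::real. sgn t * \<bar>t\<bar> powr (?p + 1) / (?p + 1))"
  have d1: "DERIV f1 t :> \<bar>t\<bar> powr ?p" for t
    unfolding f1_def using DERIV_sgn_powr_antiderivative[of ?p t] H by simp
  define \<kappa> where "\<kappa> z = (f1 (z + e) + f1 (z - e) - 2 * f1 z) / (2 * e\<^sup>2)" for z
  have kb: "kernel_marginal H T e u = \<kappa> u - \<kappa> (u - T)" for u
  proof -
    have "kernel_marginal H T e u = (- \<kappa> (u - T)) - (- \<kappa> (u - 0))" unfolding kernel_marginal_def
    proof (rule ivl_FTC[OF T])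
      fix v
      have s: "DERIV (\<lambda>v. u - v + c) v :> -1" for c by (auto intro!: derivative_eq_intros)
      have "DERIV (\<lambda>v. - ((f1 (u - v + e) + f1 (u - v + (- e)) - 2 * f1 (u - v + 0)) / (2 * e\<^sup>2))) v :>
        - ((\<bar>u - v + e\<bar> powr ?p * -1 + \<bar>u - v + (- e)\<bar> powr ?p * -1 - 2 * (\<bar>u - v + 0\<bar> powr ?p * -1)) / (2 * e\<^sup>2))"
        by (intro DERIV_minus DERIV_cdivide DERIV_diff DERIV_add DERIV_cmult DERIV_chain2[OF d1] s)
      moreover have "- ((\<bar>u - v + e\<bar> powr ?p * -1 + \<bar>u - v + (- e)\<bar> powr ?p * -1 - 2 * (\<bar>u - v + 0\<bar> powr ?p * -1)) / (2 * e\<^sup>2)) = increment_kernel H e e (u - v)"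
        unfolding increment_kernel_diag incov_def using e by (simp add: field_simps)
      ultimately show "DERIV (\<lambda>v. - \<kappa> (u - v)) v :> increment_kernel H e e (u - v)" unfolding \<kappa>_def by simp
    qed (intro continuous_on_increment_kernel H continuous_on_diff continuous_on_const continuous_on_id)
    then show ?thesis by simp
  qed
  let ?g = "\<lambda>z a. \<bar>\<bar>z + (a - e) + e\<bar> powr ?p - \<bar>z + (a - e)\<bar> powr ?p\<bar>"
  \<comment> \<open>A second difference of \<open>f1\<close> is an integral over one step
    \<open>e\<close> of first differences of its derivative \<open>|t|^(2*H)\<close>; after
    exchanging integrals, \<open>integral_abs_powr_increment_le\<close> handles the latter.\<close>
  have \<kappa>b: "\<bar>\<kappa> z\<bar> \<le> (\<integral>a. ?g z a \<partial>ivl 0 e) / (2 * e\<^sup>2)" for z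
  proof -
    let ?h = "\<lambda>a. \<bar>z + (a - e) + e\<bar> powr ?p - \<bar>z + (a - e)\<bar> powr ?p"
    have "(\<integral>a. ?h a \<partial>ivl 0 e) = (f1 (z + (e - e) + e) - f1 (z + (e - e))) - (f1 (z + (0 - e) + e) - f1 (z + (0 - e)))"
    proof (rule ivl_FTC)
      fix a
      have s: "DERIV (\<lambda>a. z + (a - e) + e) a :> 1" "DERIV (\<lambda>a. z + (a - e)) a :> 1" by (auto intro!: derivative_eq_intros)
      have "DERIV (\<lambda>a. f1 (z + (a - e) + e) - f1 (z + (a - e))) a :> \<bar>z + (a - e) + e\<bar> powr ?p * 1 - \<bar>z + (a - e)\<bar> powr ?p * 1"
        by (intro DERIV_diff DERIV_chain2[OF d1] s)
      then show "DERIV (\<lambda>a. f1 (z + (a - e) + e) - f1 (z + (a - e))) a :> ?h a" by simp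
    next
      show "continuous_on UNIV ?h" using H
        by (intro continuous_on_diff continuous_on_abs_powr continuous_on_add continuous_on_id continuous_on_const) auto
    qed (use e in auto)
    then have "\<kappa> z = (\<integral>a. ?h a \<partial>ivl 0 e) / (2 * e\<^sup>2)" unfolding \<kappa>_def by (simp add: algebra_simps)
    then have "\<bar>\<kappa> z\<bar> = \<bar>\<integral>a. ?h a \<partial>ivl 0 e\<bar> / (2 * e\<^sup>2)" by simp
    also have "\<dots> \<le> (\<integral>a. \<bar>?h a\<bar> \<partial>ivl 0 e) / (2 * e\<^sup>2)" using integral_abs_bound by (intro divide_right_mono) auto
    finally show ?thesis .
  qed
  have \<kappa>c: "continuous_on UNIV \<kappa>"
  proof -
    have c: "continuous_on UNIV f1" using d1 by (intro DERIV_continuous_on) (auto intro: has_field_derivative_at_within)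
    have c1: "continuous_on UNIV (\<lambda>z. f1 (z + e))" "continuous_on UNIV (\<lambda>z. f1 (z - e))"
      by (rule continuous_on_compose2[OF c]; intro continuous_intros subset_UNIV)+
    show ?thesis unfolding \<kappa>_def using e
      by (intro continuous_on_divide continuous_on_diff continuous_on_add continuous_on_mult continuous_on_const c c1) auto
  qed
  have \<kappa>I: "(\<integral>u. \<bar>\<kappa> (u - c)\<bar> \<partial>ivl 0 T) \<le> ?R powr ?p" if c: "0 \<le> c" "c \<le> T" for c
  proof -
    have qc: "continuous_on UNIV (\<lambda>p. ?g (fst p - c) (snd p))" using H
      by (intro continuous_on_rabs continuous_on_diff continuous_on_abs_powr continuous_on_add continuous_on_id continuous_on_const continuous_on_fst continuous_on_snd) auto
    note qi = ivl2_continuous_integrable[OF qc]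
    have "(\<integral>u. \<bar>\<kappa> (u - c)\<bar> \<partial>ivl 0 T) \<le> (\<integral>u. (\<integral>a. ?g (u - c) a \<partial>ivl 0 e) / (2 * e\<^sup>2) \<partial>ivl 0 T)"
    proof (rule integral_mono[OF _ _ \<kappa>b])
      show "integrable (ivl 0 T) (\<lambda>u. \<bar>\<kappa> (u - c)\<bar>)"
        by (intro ivl_continuous(1) continuous_on_rabs continuous_on_compose2[OF \<kappa>c] continuous_on_diff continuous_on_const continuous_on_id) auto
      show "integrable (ivl 0 T) (\<lambda>u. (\<integral>a. ?g (u - c) a \<partial>ivl 0 e) / (2 * e\<^sup>2))"
        using ivl2.integrable_fst'[OF qi, of 0 T 0 e] by simp
    qed
    also have "\<dots> = (\<integral>u. (\<integral>a. ?g (u - c) a \<partial>ivl 0 e) \<partial>ivl 0 T) / (2 * e\<^sup>2)" by simp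
    also have "(\<integral>u. (\<integral>a. ?g (u - c) a \<partial>ivl 0 e) \<partial>ivl 0 T) = (\<integral>a. (\<integral>u. ?g (u - c) a \<partial>ivl 0 T) \<partial>ivl 0 e)"
      using ivl2_integral_iterated[OF qi, of 0 T 0 e] ivl2_integral_iterated_swap(1)[OF qi, of 0 T 0 e] by simp
    also have "\<dots> \<le> (\<integral>a. 2 * e * ?R powr ?p \<partial>ivl 0 e)"
    proof (rule integral_mono_AE)
      show "integrable (ivl 0 e) (\<lambda>a. \<integral>u. ?g (u - c) a \<partial>ivl 0 T)"
        using ivl2_integral_iterated_swap(2)[OF qi, of 0 e 0 T] by simp
      show "AE a in ivl 0 e. (\<integral>u. ?g (u - c) a \<partial>ivl 0 T) \<le> 2 * e * ?R powr ?p"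
        using AE_ivl[of 0 e]
      proof eventually_elim
        fix a assume a: "a \<in> {0..e}"
        have "(\<integral>u. \<bar>\<bar>u + (a - e - c) + e\<bar> powr ?p - \<bar>u + (a - e - c)\<bar> powr ?p\<bar> \<partial>ivl 0 T) \<le> 2 * e * ?R powr ?p"
          by (rule integral_abs_powr_increment_le) (use T H e a c in \<open>auto simp: abs_le_iff abs_if\<close>)
        then show "(\<integral>u. ?g (u - c) a \<partial>ivl 0 T) \<le> 2 * e * ?R powr ?p" by (simp add: algebra_simps)
      qed
    qed auto
    also have "\<dots> = 2 * e\<^sup>2 * ?R powr ?p" using e by (simp add: measure_ivl power2_eq_square)
    finally show ?thesis using e by (simp add: divide_right_mono)
  qed
  have ki: "integrable (ivl 0 T) (\<lambda>u. \<bar>\<kappa> (u - c)\<bar>)" for c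
    by (intro ivl_continuous(1) continuous_on_rabs continuous_on_compose2[OF \<kappa>c] continuous_on_diff continuous_on_const continuous_on_id) auto
  have "(\<integral>u. \<bar>kernel_marginal H T e u\<bar> \<partial>ivl 0 T) \<le> (\<integral>u. \<bar>\<kappa> (u - 0)\<bar> + \<bar>\<kappa> (u - T)\<bar> \<partial>ivl 0 T)"
  proof (rule integral_mono)
    show "integrable (ivl 0 T) (\<lambda>u. \<bar>kernel_marginal H T e u\<bar>)" using kernel_marginal_integrable[OF H] by auto
    show "integrable (ivl 0 T) (\<lambda>u. \<bar>\<kappa> (u - 0)\<bar> + \<bar>\<kappa> (u - T)\<bar>)" by (intro Bochner_Integration.integrable_add ki)
  qed (auto simp: kb)
  also have "\<dots> = (\<integral>u. \<bar>\<kappa> (u - 0)\<bar> \<partial>ivl 0 T) + (\<integral>u. \<bar>\<kappa> (u - T)\<bar> \<partial>ivl 0 T)" by (intro Bochner_Integration.integral_add ki)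
  also have "\<dots> \<le> ?R powr ?p + ?R powr ?p" using T by (intro add_mono \<kappa>I) auto
  finally show ?thesis by simp
qed

text \<open>Passes to base point \<open>u\<close> and lag \<open>h = v - u\<close>: a translation in
  the inner integral for each \<open>u\<close>, then Fubini.\<close>

lemma ivl2_shear:
  fixes q :: "real \<times> real \<Rightarrow> real"
  assumes q: "continuous_on UNIV q" and T: "T > 0"
  shows "(\<integral>p. q p \<partial>ivl2 0 T 0 T) = (\<integral>h. (\<integral>u. indicator {0..T} (u + h) * q (u, u + h) \<partial>ivl 0 T) \<partial>ivl (-T) T)"
    and "integrable (ivl (-T) T) (\<lambda>h. \<integral>u. indicator {0..T} (u + h) * q (u, u + h) \<partial>ivl 0 T)"
proof -
  let ?i = "\<lambda>x. indicator {0..T} x :: real"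
  have [measurable]: "q \<in> borel_measurable (borel \<Otimes>\<^sub>M borel)"
    using borel_measurable_continuous_onI[OF q] by (simp add: borel_prod)
  have "compact (q ` ({0..T} \<times> {0..T}))"
    by (intro compact_continuous_image continuous_on_subset[OF q] compact_Times) auto
  then obtain C where C: "\<And>p. p \<in> {0..T} \<times> {0..T} \<Longrightarrow> \<bar>q p\<bar> \<le> C"
    unfolding compact_eq_bounded_closed bounded_iff by auto
  have C0: "C \<ge> 0" using C[of "(0, 0)"] T by auto
  have i: "integrable (ivl2 0 T (-T) T) (\<lambda>p. ?i (fst p + snd p) * q (fst p, fst p + snd p))"
    by (rule ivl2_bounded(1)[where C = C]) (use C C0 T in \<open>auto simp: indicator_def\<close>)
  have inner: "(\<integral>v. q (u, v) \<partial>ivl 0 T) = (\<integral>h. ?i (u + h) * q (u, u + h) \<partial>ivl (-T) T)" if u: "u \<in> {0..T}" for u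
  proof -
    have "(\<integral>v. q (u, v) \<partial>ivl 0 T) = (\<integral>v. ?i v * q (u, v) \<partial>lborel)" by (rule integral_ivl) measurable
    also have "\<dots> = (\<integral>h. ?i (u + h) * q (u, u + h) \<partial>lborel)"
      using lborel_integral_real_affine[of 1 "\<lambda>v. ?i v * q (u, v)" u] by simp
    also have "\<dots> = (\<integral>h. indicator {-T..T} h * (?i (u + h) * q (u, u + h)) \<partial>lborel)"
      using u by (intro Bochner_Integration.integral_cong) (auto simp: indicator_def)
    also have "\<dots> = (\<integral>h. ?i (u + h) * q (u, u + h) \<partial>ivl (-T) T)" by (rule integral_ivl[symmetric]) measurable
    finally show ?thesis .
  qed
  have "(\<integral>p. q p \<partial>ivl2 0 T 0 T) = (\<integral>u. \<integral>v. q (u, v) \<partial>ivl 0 T \<partial>ivl 0 T)"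
    by (rule ivl2_integral_iterated[OF ivl2_continuous_integrable[OF q]])
  also have "\<dots> = (\<integral>u. \<integral>h. ?i (u + h) * q (u, u + h) \<partial>ivl (-T) T \<partial>ivl 0 T)"
  proof (rule integral_cong_AE)
    show "(\<lambda>u. \<integral>v. q (u, v) \<partial>ivl 0 T) \<in> borel_measurable (ivl 0 T)"
      by (rule ivl.borel_measurable_lebesgue_integral) measurable
    show "(\<lambda>u. \<integral>h. ?i (u + h) * q (u, u + h) \<partial>ivl (-T) T) \<in> borel_measurable (ivl 0 T)"
      by (rule ivl.borel_measurable_lebesgue_integral) measurable
    show "AE u in ivl 0 T. (\<integral>v. q (u, v) \<partial>ivl 0 T) = (\<integral>h. ?i (u + h) * q (u, u + h) \<partial>ivl (-T) T)"
      using AE_ivl[of 0 T] by eventually_elim (rule inner)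
  qed
  also have "\<dots> = (\<integral>h. \<integral>u. ?i (u + h) * q (u, u + h) \<partial>ivl 0 T \<partial>ivl (-T) T)"
    using ivl2_integral_iterated[OF i] ivl2_integral_iterated_swap(1)[OF i] by simp
  finally show "(\<integral>p. q p \<partial>ivl2 0 T 0 T) = (\<integral>h. (\<integral>u. ?i (u + h) * q (u, u + h) \<partial>ivl 0 T) \<partial>ivl (-T) T)" .
  show "integrable (ivl (-T) T) (\<lambda>h. \<integral>u. ?i (u + h) * q (u, u + h) \<partial>ivl 0 T)"
    using ivl2_integral_iterated_swap(2)[OF i] by simp
qed

text \<open>Polarization \<open>xy = (x\<^sup>2 + y\<^sup>2 - (x - y)\<^sup>2) / 2\<close> isolates the part of the quadratic form
  that only sees increments.\<close>

lemma quadratic_form_decomposition: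
  fixes y :: "real \<Rightarrow> real"
  assumes H: "H > 0" and y: "continuous_on UNIV y" and T: "T > 0"
  shows "(\<integral>p. (y (fst p) - c) * (y (snd p) - c) * increment_kernel H e e (fst p - snd p) \<partial>ivl2 0 T 0 T) =
     (\<integral>u. (y u - c)\<^sup>2 * kernel_marginal H T e u \<partial>ivl 0 T)
     - (\<integral>h. increment_kernel H e e h * (\<integral>u. indicator {0..T} (u + h) * (y (u + h) - y u)\<^sup>2 \<partial>ivl 0 T) \<partial>ivl (-T) T) / 2"
    and "integrable (ivl (-T) T) (\<lambda>h. increment_kernel H e e h * (\<integral>u. indicator {0..T} (u + h) * (y (u + h) - y u)\<^sup>2 \<partial>ivl 0 T))"
proof -
  let ?K = "increment_kernel H e e"
  have Kc: "continuous_on UNIV (\<lambda>p. ?K (fst p - snd p))"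
    by (intro continuous_on_increment_kernel H continuous_intros)
  have yf: "continuous_on UNIV (\<lambda>p :: real \<times> real. y (fst p))" and ys: "continuous_on UNIV (\<lambda>p :: real \<times> real. y (snd p))"
    by (intro continuous_on_compose2[OF y] continuous_intros subset_UNIV)+
  have i1: "integrable (ivl2 0 T 0 T) (\<lambda>p. (y (fst p) - c)\<^sup>2 * ?K (fst p - snd p))"
    and i2: "integrable (ivl2 0 T 0 T) (\<lambda>p. (y (snd p) - c)\<^sup>2 * ?K (fst p - snd p))"
    by (intro ivl2_continuous_integrable continuous_intros Kc yf ys)+
  have qc: "continuous_on UNIV (\<lambda>p. (y (snd p) - y (fst p))\<^sup>2 * ?K (fst p - snd p))"
    by (intro continuous_intros Kc yf ys)
  note i3 = ivl2_continuous_integrable[OF qc]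
  have "(\<integral>p. (y (fst p) - c) * (y (snd p) - c) * ?K (fst p - snd p) \<partial>ivl2 0 T 0 T) =
    (\<integral>p. ((y (fst p) - c)\<^sup>2 * ?K (fst p - snd p) + (y (snd p) - c)\<^sup>2 * ?K (fst p - snd p)
      - (y (snd p) - y (fst p))\<^sup>2 * ?K (fst p - snd p)) / 2 \<partial>ivl2 0 T 0 T)"
    by (intro Bochner_Integration.integral_cong) (auto simp: power2_eq_square algebra_simps)
  also have "\<dots> = ((\<integral>p. (y (fst p) - c)\<^sup>2 * ?K (fst p - snd p) \<partial>ivl2 0 T 0 T)
     + (\<integral>p. (y (snd p) - c)\<^sup>2 * ?K (fst p - snd p) \<partial>ivl2 0 T 0 T)
     - (\<integral>p. (y (snd p) - y (fst p))\<^sup>2 * ?K (fst p - snd p) \<partial>ivl2 0 T 0 T)) / 2"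
    using i1 i2 i3 by simp
  also have "(\<integral>p. (y (fst p) - c)\<^sup>2 * ?K (fst p - snd p) \<partial>ivl2 0 T 0 T) = (\<integral>u. (y u - c)\<^sup>2 * kernel_marginal H T e u \<partial>ivl 0 T)"
    unfolding ivl2_integral_iterated[OF i1] kernel_marginal_def by simp
  also have "(\<integral>p. (y (snd p) - c)\<^sup>2 * ?K (fst p - snd p) \<partial>ivl2 0 T 0 T) = (\<integral>u. (y u - c)\<^sup>2 * kernel_marginal H T e u \<partial>ivl 0 T)"
  proof -
    have "(\<integral>p. (y (snd p) - c)\<^sup>2 * ?K (fst p - snd p) \<partial>ivl2 0 T 0 T) =
        (\<integral>v. \<integral>u. (y v - c)\<^sup>2 * ?K (u - v) \<partial>ivl 0 T \<partial>ivl 0 T)"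
      using ivl2_integral_iterated_swap(1)[OF i2] by simp
    also have "\<dots> = (\<integral>v. (y v - c)\<^sup>2 * kernel_marginal H T e v \<partial>ivl 0 T)"
    proof (intro Bochner_Integration.integral_cong refl)
      fix v
      have "?K (u - v) = ?K (v - u)" for u using increment_kernel_diag_even[of H e "v - u"] by simp
      then show "(\<integral>u. (y v - c)\<^sup>2 * ?K (u - v) \<partial>ivl 0 T) = (y v - c)\<^sup>2 * kernel_marginal H T e v" by (simp add: kernel_marginal_def)
    qed
    finally show ?thesis .
  qed
  finally have main: "(\<integral>p. (y (fst p) - c) * (y (snd p) - c) * ?K (fst p - snd p) \<partial>ivl2 0 T 0 T) =
     (\<integral>u. (y u - c)\<^sup>2 * kernel_marginal H T e u \<partial>ivl 0 T) - (\<integral>p. (y (snd p) - y (fst p))\<^sup>2 * ?K (fst p - snd p) \<partial>ivl2 0 T 0 T) / 2"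
    by simp
  have eq: "(\<integral>u. indicator {0..T} (u + h) * ((y (snd (u, u + h)) - y (fst (u, u + h)))\<^sup>2 * ?K (fst (u, u + h) - snd (u, u + h))) \<partial>ivl 0 T)
     = ?K h * (\<integral>u. indicator {0..T} (u + h) * (y (u + h) - y u)\<^sup>2 \<partial>ivl 0 T)" for h
  proof -
    have "(\<integral>u. indicator {0..T} (u + h) * ((y (snd (u, u + h)) - y (fst (u, u + h)))\<^sup>2 * ?K (fst (u, u + h) - snd (u, u + h))) \<partial>ivl 0 T)
      = (\<integral>u. ?K h * (indicator {0..T} (u + h) * (y (u + h) - y u)\<^sup>2) \<partial>ivl 0 T)"
      using increment_kernel_diag_even[of H e h] by (intro Bochner_Integration.integral_cong) (auto simp: algebra_simps)
    then show ?thesis by simp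
  qed
  show "(\<integral>p. (y (fst p) - c) * (y (snd p) - c) * ?K (fst p - snd p) \<partial>ivl2 0 T 0 T) =
     (\<integral>u. (y u - c)\<^sup>2 * kernel_marginal H T e u \<partial>ivl 0 T)
     - (\<integral>h. ?K h * (\<integral>u. indicator {0..T} (u + h) * (y (u + h) - y u)\<^sup>2 \<partial>ivl 0 T) \<partial>ivl (-T) T) / 2"
    unfolding main ivl2_shear(1)[OF qc T] eq ..
  show "integrable (ivl (-T) T) (\<lambda>h. ?K h * (\<integral>u. indicator {0..T} (u + h) * (y (u + h) - y u)\<^sup>2 \<partial>ivl 0 T))"
    using ivl2_shear(2)[OF qc T] unfolding eq .
qed

lemma continuous_on_avg_incov_0:
  assumes "0 < H" "e > 0"
  shows "continuous_on UNIV (\<lambda>h. avg_incov H e h 0)"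
  unfolding avg_incov_0_eq[OF assms] divide_inverse using assms
  by (intro continuous_on_mult continuous_on_diff continuous_on_add continuous_on_abs_powr continuous_on_const continuous_on_id) auto

lemma integral_ivl_indicator_shift:
  assumes T: "T > 0" and h: "h \<in> {-T..T}"
  shows "(\<integral>u. indicator {0..T} (u + h) \<partial>ivl 0 T) = T - \<bar>h\<bar>"
proof -
  have "(\<integral>u. indicator {0..T} (u + h) \<partial>ivl 0 T) = (\<integral>u. indicator {0..T} u * indicator {0..T} (u + h) \<partial>lborel :: real)"
    by (rule integral_ivl) measurable
  also have "\<dots> = (\<integral>u. indicator {max 0 (-h)..min T (T - h)} u \<partial>lborel)"
    by (intro Bochner_Integration.integral_cong) (auto simp: indicator_def)
  also have "\<dots> = T - \<bar>h\<bar>" using T h by (auto simp: max_def min_def)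
  finally show ?thesis .
qed

lemma integrable_abs_powr_ivl:
  assumes q: "q > -1" and T: "T > 0"
  shows "integrable (ivl (-T) T) (\<lambda>h. \<bar>h\<bar> powr q)"
proof -
  have "(\<lambda>x. x powr q) absolutely_integrable_on {0..T}"
    using integrable_on_powr_from_0[OF q, of T] T by (intro nonnegative_absolutely_integrable_1) auto
  then have "set_integrable lebesgue {0..T} (\<lambda>x. x powr q)" .
  then have i: "integrable lborel (\<lambda>x. indicator {0..T} x * x powr q)"
    unfolding set_integrable_def by (subst (asm) integrable_completion) auto
  have i': "integrable lborel (\<lambda>x. indicator {0..T} (- x) * (- x) powr q)"
    using lborel_integrable_real_affine[OF i, of "-1" 0] by simp
  have "integrable lborel (\<lambda>x. indicator {0..T} x * x powr q + indicator {0..T} (- x) * (- x) powr q)"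
    by (rule Bochner_Integration.integrable_add[OF i i'])
  moreover have "(\<lambda>x. indicator {0..T} x * x powr q + indicator {0..T} (- x) * (- x) powr q) = (\<lambda>x. indicator {-T..T} x * \<bar>x\<bar> powr q)"
  proof
    fix x :: real
    show "indicator {0..T} x * x powr q + indicator {0..T} (- x) * (- x) powr q = indicator {-T..T} x * \<bar>x\<bar> powr q"
      by (cases "x = 0"; cases "x > 0") (auto simp: indicator_def)
  qed
  ultimately show ?thesis by (subst integrable_ivl_iff) auto
qed

section \<open>L1 estimates for the conditional covariance\<close>

text \<open>Mean of the lag integral in \<open>quadratic_form_decomposition\<close>: the squared
  increment is replaced by its variance, and \<open>T - \<bar>h\<bar>\<close> is the length of the
  admissible base points. It enters the conditional variance with the factor -1/2.\<close>

definition mean_form :: "real \<Rightarrow> real \<Rightarrow> real \<Rightarrow> real" where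
  "mean_form H T e = (\<integral>h. increment_kernel H e e h * avg_incov H e h 0 * (T - \<bar>h\<bar>) \<partial>ivl (-T) T)"

context fbm
begin

text \<open>Covariance, conditional on this motion, of the functionals at scales \<open>e\<close>
  and \<open>d\<close>; \<open>weighted_increments_cov\<close> with frozen weights produces this
  formula.\<close>

definition cond_cov :: "real \<Rightarrow> real \<Rightarrow> real \<Rightarrow> 'a \<Rightarrow> real" where
  "cond_cov T e d w = (\<integral>p. (moving_avg e (fst p) w - moving_avg e 0 w) * (moving_avg d (snd p) w - moving_avg d 0 w) * increment_kernel H e d (fst p - snd p) \<partial>ivl2 0 T 0 T)"

lemma moving_avg_from_0_var_le:
  assumes "e > 0" "u \<in> {0..T}"
  shows "expectation (\<lambda>w. (moving_avg e u w - moving_avg e 0 w)\<^sup>2) \<le> T powr (2*H)"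
proof -
  have "expectation (\<lambda>w. (moving_avg e u w - moving_avg e 0 w)\<^sup>2) = avg_incov H e u 0" using moving_avg_increment_var[of e 0 u] assms by simp
  also have "\<dots> \<le> \<bar>u\<bar> powr (2*H)" using abs_avg_incov_le[OF H_pos H_half assms(1), of u 0] by linarith
  also have "\<dots> \<le> T powr (2*H)" using assms H_pos by (intro powr_mono2) auto
  finally show ?thesis .
qed

text \<open>The bound does not involve \<open>e\<close>, so multiplication by the vanishing
  normalization sends the mixed term to 0 for each fixed \<open>d\<close>.\<close>

lemma cond_cov_cross:
  assumes e: "0 < e" "e \<le> 1" and d: "d > 0" and T: "T > 0"
  shows "integrable M (cond_cov T e d)"
    and "expectation (\<lambda>w. \<bar>cond_cov T e d w\<bar>) \<le> T powr (2*H) * (T * (2 * (T + d + 2) powr (2*H) / d))"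
proof -
  let ?f = "\<lambda>w p. (moving_avg e (fst p) w - moving_avg e 0 w) * (moving_avg d (snd p) w - moving_avg d 0 w) * increment_kernel H e d (fst p - snd p)"
  have Kc: "continuous_on UNIV (\<lambda>p. \<bar>increment_kernel H e d (fst p - snd p)\<bar>)"
    by (intro continuous_on_rabs continuous_on_increment_kernel H_pos continuous_intros)
  have gi: "integrable (ivl2 0 T 0 T) (\<lambda>p. T powr (2*H) * \<bar>increment_kernel H e d (fst p - snd p)\<bar>)"
    by (intro integrable_mult_right ivl2_continuous_integrable Kc)
  have fm: "(\<lambda>(w, p). ?f w p) \<in> borel_measurable (M \<Otimes>\<^sub>M ivl2 0 T 0 T)" by measurable
  have bd: "integrable M (\<lambda>w. ?f w p) \<and> expectation (\<lambda>w. \<bar>?f w p\<bar>) \<le> T powr (2*H) * \<bar>increment_kernel H e d (fst p - snd p)\<bar>"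
    if p: "fst p \<in> {0..T} \<and> snd p \<in> {0..T}" for p
  proof -
    have g: "glim (\<lambda>w. moving_avg e (fst p) w - moving_avg e 0 w)" "glim (\<lambda>w. moving_avg d (snd p) w - moving_avg d 0 w)"
      using p e d by (auto intro!: glim_diff glim_moving_avg)
    have "expectation (\<lambda>w. \<bar>(moving_avg e (fst p) w - moving_avg e 0 w) * (moving_avg d (snd p) w - moving_avg d 0 w)\<bar>) \<le> T powr (2*H)"
      using glim_expectation_abs_prod_le[OF g] moving_avg_from_0_var_le[of e "fst p" T] moving_avg_from_0_var_le[of d "snd p" T] p e d by simp
    moreover have "expectation (\<lambda>w. \<bar>?f w p\<bar>) =
        expectation (\<lambda>w. \<bar>(moving_avg e (fst p) w - moving_avg e 0 w) * (moving_avg d (snd p) w - moving_avg d 0 w)\<bar>) * \<bar>increment_kernel H e d (fst p - snd p)\<bar>"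
      by (subst abs_mult) simp
    ultimately show ?thesis using glim_prod_integrable(1)[OF g] by (simp add: mult_right_mono)
  qed
  have ae: "AE p in ivl2 0 T 0 T. integrable M (\<lambda>w. ?f w p) \<and> expectation (\<lambda>w. \<bar>?f w p\<bar>) \<le> T powr (2*H) * \<bar>increment_kernel H e d (fst p - snd p)\<bar>"
    using AE_ivl2[of 0 T 0 T] by eventually_elim (rule bd)
  note fub = fubini_expectation[OF ivl2.P.sigma_finite_measure_axioms fm ae gi]
  show "integrable M (cond_cov T e d)" unfolding cond_cov_def[abs_def] by (rule fub(1))
  have "expectation (\<lambda>w. \<bar>cond_cov T e d w\<bar>) \<le> (\<integral>p. T powr (2*H) * \<bar>increment_kernel H e d (fst p - snd p)\<bar> \<partial>ivl2 0 T 0 T)"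
    unfolding cond_cov_def by (rule fub(3))
  also have "\<dots> = T powr (2*H) * (\<integral>x. \<integral>y. \<bar>increment_kernel H e d (x - y)\<bar> \<partial>ivl 0 T \<partial>ivl 0 T)"
    using ivl2_integral_iterated[OF ivl2_continuous_integrable[OF Kc], of 0 T 0 T] by simp
  also have "\<dots> \<le> T powr (2*H) * (\<integral>x. 2 * (T + d + 2) powr (2*H) / d \<partial>ivl 0 T)"
  proof (intro mult_left_mono integral_mono_AE)
    show "integrable (ivl 0 T) (\<lambda>x. \<integral>y. \<bar>increment_kernel H e d (x - y)\<bar> \<partial>ivl 0 T)"
      using ivl2.integrable_fst'[OF ivl2_continuous_integrable[OF Kc], of 0 T 0 T] by simp
    show "AE x in ivl 0 T. (\<integral>y. \<bar>increment_kernel H e d (x - y)\<bar> \<partial>ivl 0 T) \<le> 2 * (T + d + 2) powr (2*H) / d"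
      using AE_ivl[of 0 T] by eventually_elim (rule integral_abs_increment_kernel_le[OF H_pos e d])
  qed auto
  also have "\<dots> = T powr (2*H) * (T * (2 * (T + d + 2) powr (2*H) / d))" using T by (simp add: measure_ivl)
  finally show "expectation (\<lambda>w. \<bar>cond_cov T e d w\<bar>) \<le> T powr (2*H) * (T * (2 * (T + d + 2) powr (2*H) / d))" .
qed

text \<open>The three summands estimate the marginal part \<open>P1\<close>, the fluctuation part
  \<open>P2\<close>, and the deterministic distance of the normalized mean from its target
  \<open>v\<close>.\<close>

lemma cond_cov_diag:
  assumes e: "0 < e" "e \<le> 1" and T: "T > 0" and s: "s \<ge> 0"
  shows "expectation (\<lambda>w. \<bar>s * cond_cov T e e w - v\<bar>) \<le> s * (T powr (2*H) * (2 * (T + 2) powr (2*H)))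
    + s * (\<integral>h. \<bar>increment_kernel H e e h\<bar> * (16 * sqrt (pi * T) * (max \<bar>h\<bar> e) powr (2*H + 1/2)) \<partial>ivl (-T) T)
    + \<bar>s * (- mean_form H T e / 2) - v\<bar>"
proof -
  let ?K = "increment_kernel H e e"
  let ?c = "\<lambda>h. 16 * sqrt (pi * T) * (max \<bar>h\<bar> e) powr (2*H + 1/2)"
  define P1 where "P1 w = (\<integral>u. (moving_avg e u w - moving_avg e 0 w)\<^sup>2 * kernel_marginal H T e u \<partial>ivl 0 T)" for w
  define P2 where "P2 w = (\<integral>h. ?K h * increment_fluct T e h w \<partial>ivl (-T) T)" for w
  have Kc: "continuous_on UNIV ?K" by (intro continuous_on_increment_kernel H_pos continuous_on_id)
  have Dc: "continuous_on UNIV (\<lambda>h. ?K h * avg_incov H e h 0 * (T - \<bar>h\<bar>))"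
    by (intro continuous_on_mult continuous_on_diff continuous_on_rabs continuous_on_const continuous_on_id Kc continuous_on_avg_incov_0 H_pos e)
  \<comment> \<open>Holds for every outcome: polarization of the quadratic form, followed by
    splitting the squared increments into fluctuation and mean.\<close>
  have path: "cond_cov T e e w = P1 w - (P2 w + mean_form H T e) / 2" if w: "w \<in> space M" for w
  proof -
    note y = moving_avg_continuous[OF w, of e]
    have sc: "continuous_on UNIV (\<lambda>u. (moving_avg e (u + h) w - moving_avg e u w)\<^sup>2)" for h
      by (intro continuous_on_power continuous_on_diff y continuous_on_compose2[OF y] continuous_intros subset_UNIV)
    have in1: "integrable (ivl 0 T) (\<lambda>u. indicator {0..T} (u + h) * (moving_avg e (u + h) w - moving_avg e u w)\<^sup>2)" for h
    proof -
      have "integrable (ivl 0 T) (\<lambda>u. indicator {u. u + h \<in> {0..T}} u *\<^sub>R (moving_avg e (u + h) w - moving_avg e u w)\<^sup>2)"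
        by (rule integrable_mult_indicator) (auto intro: ivl_continuous(1)[OF sc])
      then show ?thesis by (simp add: indicator_def)
    qed
    have in2: "integrable (ivl 0 T) (\<lambda>u. indicator {0..T} (u + h) :: real)" for h
      by (rule ivl.integrable_const_bound[where B=1]) (auto simp: indicator_def)
    have S: "(\<integral>u. indicator {0..T} (u + h) * (moving_avg e (u + h) w - moving_avg e u w)\<^sup>2 \<partial>ivl 0 T) = increment_fluct T e h w + avg_incov H e h 0 * (T - \<bar>h\<bar>)"
      if h: "h \<in> {-T..T}" for h
    proof -
      have "increment_fluct T e h w = (\<integral>u. indicator {0..T} (u + h) * (moving_avg e (u + h) w - moving_avg e u w)\<^sup>2 - avg_incov H e h 0 * indicator {0..T} (u + h) \<partial>ivl 0 T)"
        unfolding increment_fluct_def by (intro Bochner_Integration.integral_cong) (auto simp: algebra_simps)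
      also have "\<dots> = (\<integral>u. indicator {0..T} (u + h) * (moving_avg e (u + h) w - moving_avg e u w)\<^sup>2 \<partial>ivl 0 T) - avg_incov H e h 0 * (T - \<bar>h\<bar>)"
        using in1[of h] in2[of h] integral_ivl_indicator_shift[OF T h] by simp
      finally show ?thesis by simp
    qed
    note qd = quadratic_form_decomposition[OF H_pos y T, where e = e]
    let ?J = "\<lambda>h. ?K h * (\<integral>u. indicator {0..T} (u + h) * (moving_avg e (u + h) w - moving_avg e u w)\<^sup>2 \<partial>ivl 0 T)"
    have Sm: "(\<lambda>h. ?K h * increment_fluct T e h w) \<in> borel_measurable borel"
      using increment_fluct_joint[of "\<lambda>_. w" borel "\<lambda>h. h" T e] w by measurable
    have Jm: "?J \<in> borel_measurable borel" using borel_measurable_integrable[OF qd(2)] by simp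
    have mean_form: "(\<lambda>h. ?K h * avg_incov H e h 0 * (T - \<bar>h\<bar>)) \<in> borel_measurable borel" by (rule borel_measurable_continuous_onI[OF Dc])
    have aeq: "AE h in ivl (-T) T. ?K h * increment_fluct T e h w = ?J h - ?K h * avg_incov H e h 0 * (T - \<bar>h\<bar>)"
      using AE_ivl[of "-T" T]
    proof eventually_elim
      fix h assume "h \<in> {-T..T}"
      from S[OF this] show "?K h * increment_fluct T e h w = ?J h - ?K h * avg_incov H e h 0 * (T - \<bar>h\<bar>)" by (simp only:) (simp add: algebra_simps)
    qed
    have "P2 w = (\<integral>h. ?J h - ?K h * avg_incov H e h 0 * (T - \<bar>h\<bar>) \<partial>ivl (-T) T)"
      unfolding P2_def using Sm Jm mean_form by (intro integral_cong_AE aeq) auto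
    also have "\<dots> = (\<integral>h. ?J h \<partial>ivl (-T) T) - mean_form H T e"
      unfolding mean_form_def by (intro Bochner_Integration.integral_diff qd(2) ivl_continuous(1)[OF Dc])
    finally have "(\<integral>h. ?J h \<partial>ivl (-T) T) = P2 w + mean_form H T e" by simp
    then show ?thesis unfolding cond_cov_def qd(1) P1_def by simp
  qed
  have kb: "kernel_marginal H T e \<in> borel_measurable borel"
    using borel_measurable_integrable[OF kernel_marginal_integrable[OF H_pos, of 0 0 T e]] by simp
  note [measurable] = kb
  have P1b: "integrable M P1" "expectation (\<lambda>w. \<bar>P1 w\<bar>) \<le> T powr (2*H) * (2 * (T + 2) powr (2*H))"
  proof -
    let ?f = "\<lambda>w u. (moving_avg e u w - moving_avg e 0 w)\<^sup>2 * kernel_marginal H T e u"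
    have fm: "(\<lambda>(w, u). ?f w u) \<in> borel_measurable (M \<Otimes>\<^sub>M ivl 0 T)" by measurable
    have gi: "integrable (ivl 0 T) (\<lambda>u. T powr (2*H) * \<bar>kernel_marginal H T e u\<bar>)" using kernel_marginal_integrable[OF H_pos] by auto
    have ae: "AE u in ivl 0 T. integrable M (\<lambda>w. ?f w u) \<and> expectation (\<lambda>w. \<bar>?f w u\<bar>) \<le> T powr (2*H) * \<bar>kernel_marginal H T e u\<bar>"
      using AE_ivl[of 0 T]
    proof eventually_elim
      fix u assume u: "u \<in> {0..T}"
      have g: "glim (\<lambda>w. moving_avg e u w - moving_avg e 0 w)" using u e by (auto intro!: glim_diff glim_moving_avg)
      have "expectation (\<lambda>w. \<bar>?f w u\<bar>) = expectation (\<lambda>w. (moving_avg e u w - moving_avg e 0 w)\<^sup>2) * \<bar>kernel_marginal H T e u\<bar>" by (simp add: abs_mult)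
      also have "\<dots> \<le> T powr (2*H) * \<bar>kernel_marginal H T e u\<bar>" using moving_avg_from_0_var_le[OF e(1) u] by (intro mult_right_mono) auto
      finally show "integrable M (\<lambda>w. ?f w u) \<and> expectation (\<lambda>w. \<bar>?f w u\<bar>) \<le> T powr (2*H) * \<bar>kernel_marginal H T e u\<bar>"
        using glim_moments(1)[OF g, of 2] by simp
    qed
    note fub = fubini_expectation[OF ivl.sigma_finite_measure_axioms fm ae gi]
    show "integrable M P1" unfolding P1_def[abs_def] by (rule fub(1))
    have "expectation (\<lambda>w. \<bar>P1 w\<bar>) \<le> (\<integral>u. T powr (2*H) * \<bar>kernel_marginal H T e u\<bar> \<partial>ivl 0 T)" unfolding P1_def by (rule fub(3))
    also have "\<dots> = T powr (2*H) * (\<integral>u. \<bar>kernel_marginal H T e u\<bar> \<partial>ivl 0 T)" by simp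
    also have "\<dots> \<le> T powr (2*H) * (2 * (T + 2) powr (2*H))"
      using integral_abs_kernel_marginal_le[OF H_pos e, of T] T by (intro mult_left_mono) auto
    finally show "expectation (\<lambda>w. \<bar>P1 w\<bar>) \<le> T powr (2*H) * (2 * (T + 2) powr (2*H))" .
  qed
  have P2b: "integrable M P2" "expectation (\<lambda>w. \<bar>P2 w\<bar>) \<le> (\<integral>h. \<bar>?K h\<bar> * ?c h \<partial>ivl (-T) T)"
  proof -
    let ?f = "\<lambda>w h. ?K h * increment_fluct T e h w"
    have fm: "(\<lambda>(w, h). ?f w h) \<in> borel_measurable (M \<Otimes>\<^sub>M ivl (-T) T)" by measurable
    have "continuous_on UNIV (\<lambda>h. \<bar>?K h\<bar> * ?c h)"
    proof -
      have "continuous_on UNIV (\<lambda>h. max \<bar>h\<bar> e powr (2*H + 1/2))"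
        using e H_pos by (intro continuous_on_powr' continuous_on_max continuous_on_rabs continuous_on_id continuous_on_const) auto
      then show ?thesis by (intro continuous_on_mult continuous_on_rabs Kc continuous_on_const)
    qed
    then have gi: "integrable (ivl (-T) T) (\<lambda>h. \<bar>?K h\<bar> * ?c h)" by (rule ivl_continuous(1))
    have ae: "AE h in ivl (-T) T. integrable M (\<lambda>w. ?f w h) \<and> expectation (\<lambda>w. \<bar>?f w h\<bar>) \<le> \<bar>?K h\<bar> * ?c h"
    proof (rule AE_I2)
      fix h
      have "expectation (\<lambda>w. \<bar>?f w h\<bar>) = \<bar>?K h\<bar> * expectation (\<lambda>w. \<bar>increment_fluct T e h w\<bar>)" by (simp add: abs_mult)
      also have "\<dots> \<le> \<bar>?K h\<bar> * ?c h" using increment_fluct_bound(2)[OF e(1) T, of h] by (intro mult_left_mono) auto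
      finally show "integrable M (\<lambda>w. ?f w h) \<and> expectation (\<lambda>w. \<bar>?f w h\<bar>) \<le> \<bar>?K h\<bar> * ?c h"
        using increment_fluct_bound(1)[OF e(1) T, of h] by simp
    qed
    note fub = fubini_expectation[OF ivl.sigma_finite_measure_axioms fm ae gi]
    show "integrable M P2" unfolding P2_def[abs_def] by (rule fub(1))
    show "expectation (\<lambda>w. \<bar>P2 w\<bar>) \<le> (\<integral>h. \<bar>?K h\<bar> * ?c h \<partial>ivl (-T) T)" unfolding P2_def by (rule fub(3))
  qed
  have "expectation (\<lambda>w. \<bar>s * cond_cov T e e w - v\<bar>) \<le> expectation (\<lambda>w. s * \<bar>P1 w\<bar> + s * \<bar>P2 w\<bar> + \<bar>s * (- mean_form H T e / 2) - v\<bar>)"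
  proof (rule integral_mono)
    show "integrable M (\<lambda>w. \<bar>s * cond_cov T e e w - v\<bar>)" using cond_cov_cross(1)[OF e e(1) T] by auto
    show "integrable M (\<lambda>w. s * \<bar>P1 w\<bar> + s * \<bar>P2 w\<bar> + \<bar>s * (- mean_form H T e / 2) - v\<bar>)" using P1b(1) P2b(1) by auto
    fix w assume w: "w \<in> space M"
    have eq: "s * cond_cov T e e w - v = s * P1 w + - (s * P2 w / 2) + (s * (- mean_form H T e / 2) - v)"
      unfolding path[OF w] by (simp add: algebra_simps add_divide_distrib)
    have "\<bar>s * P1 w\<bar> = s * \<bar>P1 w\<bar>" "\<bar>s * P2 w / 2\<bar> \<le> s * \<bar>P2 w\<bar>" using s by (auto simp: abs_mult)
    then show "\<bar>s * cond_cov T e e w - v\<bar> \<le> s * \<bar>P1 w\<bar> + s * \<bar>P2 w\<bar> + \<bar>s * (- mean_form H T e / 2) - v\<bar>"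
      unfolding eq by linarith
  qed
  also have "\<dots> = s * expectation (\<lambda>w. \<bar>P1 w\<bar>) + s * expectation (\<lambda>w. \<bar>P2 w\<bar>) + \<bar>s * (- mean_form H T e / 2) - v\<bar>"
    using P1b(1) P2b(1) by (simp add: prob_space)
  also have "\<dots> \<le> s * (T powr (2*H) * (2 * (T + 2) powr (2*H))) + s * (\<integral>h. \<bar>?K h\<bar> * ?c h \<partial>ivl (-T) T) + \<bar>s * (- mean_form H T e / 2) - v\<bar>"
    using P1b(2) P2b(2) s by (intro add_mono mult_left_mono) auto
  finally show ?thesis .
qed

text \<open>The hypothesis \<open>sC\<close> is the common feature of both normalizations: it
  absorbs the power \<open>4*H - 1\<close> and leaves the integrable majorant
  \<open>|h|^(-1/2)\<close>, so fluctuations vanish by dominated convergence.\<close>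

lemma cond_cov_limit:
  assumes e: "\<And>n. 0 < e n" "\<And>n. e n \<le> 1" and e0: "e \<longlonglongrightarrow> 0" and T: "T > 0"
    and s: "\<And>n. s n \<ge> 0" and s0: "s \<longlonglongrightarrow> 0"
    and sC: "\<And>n h. s n * (max \<bar>h\<bar> (e n)) powr (4*H - 1) \<le> C"
    and D: "(\<lambda>n. s n * (- mean_form H T (e n) / 2)) \<longlonglongrightarrow> v"
  shows "(\<lambda>n. expectation (\<lambda>w. \<bar>s n * cond_cov T (e n) (e n) w - v\<bar>)) \<longlonglongrightarrow> 0"
proof -
  let ?b = "\<lambda>n. \<integral>h. \<bar>increment_kernel H (e n) (e n) h\<bar> * (16 * sqrt (pi * T) * (max \<bar>h\<bar> (e n)) powr (2*H + 1/2)) \<partial>ivl (-T) T"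
  have mc: "continuous_on UNIV (\<lambda>h. max \<bar>h\<bar> (e n) powr r)" for n r
    using e(1)[of n] by (intro continuous_on_powr continuous_on_max continuous_on_rabs continuous_on_id continuous_on_const) (auto simp: max_def)
  have mm [measurable]: "(\<lambda>h. max \<bar>h\<bar> (e n) powr r) \<in> borel_measurable borel" for n r
    by (rule borel_measurable_continuous_onI[OF mc])
  \<comment> \<open>The exponent adds \<open>2*H - 2\<close> from the kernel and
    \<open>2*H + 1/2\<close> from the fluctuation bound.\<close>
  let ?j = "\<lambda>n h. s n * max \<bar>h\<bar> (e n) powr (4*H - 3/2)"
  have jl: "(\<lambda>n. \<integral>h. ?j n h \<partial>ivl (-T) T) \<longlonglongrightarrow> (\<integral>h. 0 \<partial>ivl (-T) T)"
  proof (rule integral_dominated_convergence[where w = "\<lambda>h. C * \<bar>h\<bar> powr (-1/2)"])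
    show "integrable (ivl (-T) T) (\<lambda>h. C * \<bar>h\<bar> powr (-1/2))"
      using integrable_abs_powr_ivl[of "-1/2" T] T by auto
    have nz: "AE h in ivl (-T) T. h \<noteq> 0"
      unfolding ivl_def by (subst AE_density) (auto intro: eventually_mono[OF AE_lborel_singleton[of 0]])
    show "AE h in ivl (-T) T. (\<lambda>n. ?j n h) \<longlonglongrightarrow> 0" using nz
    proof eventually_elim
      fix h :: real assume h: "h \<noteq> 0"
      have "(\<lambda>n. max \<bar>h\<bar> (e n)) \<longlonglongrightarrow> max \<bar>h\<bar> 0" by (intro tendsto_max tendsto_const e0)
      then have "(\<lambda>n. ?j n h) \<longlonglongrightarrow> 0 * max \<bar>h\<bar> 0 powr (4*H - 3/2)"
        using h by (intro tendsto_mult s0 tendsto_powr tendsto_const) auto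
      then show "(\<lambda>n. ?j n h) \<longlonglongrightarrow> 0" by simp
    qed
    show "AE h in ivl (-T) T. norm (?j n h) \<le> C * \<bar>h\<bar> powr (-1/2)" for n using nz
    proof eventually_elim
      fix h :: real assume h: "h \<noteq> 0"
      let ?m = "max \<bar>h\<bar> (e n)"
      have "?j n h = (s n * ?m powr (4*H - 1)) * ?m powr (-1/2)"
      proof -
        have "?m powr (4*H - 3/2) = ?m powr (4*H - 1) * ?m powr (-1/2)" by (simp add: powr_add[symmetric])
        then show ?thesis by simp
      qed
      also have "\<dots> \<le> C * \<bar>h\<bar> powr (-1/2)"
        using h e(1)[of n] s[of n] sC[of n h] by (intro mult_mono powr_mono2') (auto intro: order_trans[of 0 "s n * ?m powr (4*H - 1)"])
      finally show "norm (?j n h) \<le> C * \<bar>h\<bar> powr (-1/2)" using s[of n] by simp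
    qed
  qed auto
  have bj: "s n * ?b n \<le> 64 * sqrt (pi * T) * (\<integral>h. ?j n h \<partial>ivl (-T) T)" for n
  proof -
    have "?b n \<le> (\<integral>h. 64 * sqrt (pi * T) * max \<bar>h\<bar> (e n) powr (4*H - 3/2) \<partial>ivl (-T) T)"
    proof (rule integral_mono)
      have Kc: "continuous_on UNIV (increment_kernel H (e n) (e n))" by (intro continuous_on_increment_kernel H_pos continuous_on_id)
      show "integrable (ivl (-T) T) (\<lambda>h. \<bar>increment_kernel H (e n) (e n) h\<bar> * (16 * sqrt (pi * T) * (max \<bar>h\<bar> (e n)) powr (2*H + 1/2)))"
        by (intro ivl_continuous(1) continuous_on_mult continuous_on_rabs Kc continuous_on_const mc)
      show "integrable (ivl (-T) T) (\<lambda>h. 64 * sqrt (pi * T) * max \<bar>h\<bar> (e n) powr (4*H - 3/2))"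
        by (intro ivl_continuous(1) continuous_on_mult continuous_on_const mc)
      fix h :: real
      let ?m = "max \<bar>h\<bar> (e n)"
      have "\<bar>increment_kernel H (e n) (e n) h\<bar> * (16 * sqrt (pi * T) * ?m powr (2*H + 1/2)) \<le> (4 * ?m powr (2*H - 2)) * (16 * sqrt (pi * T) * ?m powr (2*H + 1/2))"
        using T by (intro mult_right_mono abs_increment_kernel_diag_le H_pos H_half e) auto
      also have "\<dots> = 64 * sqrt (pi * T) * (?m powr (2*H - 2) * ?m powr (2*H + 1/2))" by simp
      also have "?m powr (2*H - 2) * ?m powr (2*H + 1/2) = ?m powr (4*H - 3/2)" by (simp add: powr_add[symmetric])
      finally show "\<bar>increment_kernel H (e n) (e n) h\<bar> * (16 * sqrt (pi * T) * ?m powr (2*H + 1/2)) \<le> 64 * sqrt (pi * T) * ?m powr (4*H - 3/2)" .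
    qed
    then have "s n * ?b n \<le> s n * (\<integral>h. 64 * sqrt (pi * T) * max \<bar>h\<bar> (e n) powr (4*H - 3/2) \<partial>ivl (-T) T)"
      using s by (rule mult_left_mono)
    then show ?thesis by (simp add: mult.left_commute)
  qed
  let ?u = "\<lambda>n. s n * (T powr (2*H) * (2 * (T + 2) powr (2*H))) + 64 * sqrt (pi * T) * (\<integral>h. ?j n h \<partial>ivl (-T) T)
     + \<bar>s n * (- mean_form H T (e n) / 2) - v\<bar>"
  have "?u \<longlonglongrightarrow> 0 * (T powr (2*H) * (2 * (T + 2) powr (2*H))) + 64 * sqrt (pi * T) * (\<integral>h. 0 \<partial>ivl (-T) T) + \<bar>v - v\<bar>"
    by (intro tendsto_add tendsto_mult tendsto_rabs tendsto_diff tendsto_const s0 jl D)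
  then have u: "?u \<longlonglongrightarrow> 0" by simp
  show ?thesis
  proof (rule tendsto_sandwich[OF _ _ tendsto_const u])
    show "\<forall>\<^sub>F n in sequentially. 0 \<le> expectation (\<lambda>w. \<bar>s n * cond_cov T (e n) (e n) w - v\<bar>)"
      by (auto intro!: always_eventually integral_nonneg_AE)
    show "\<forall>\<^sub>F n in sequentially. expectation (\<lambda>w. \<bar>s n * cond_cov T (e n) (e n) w - v\<bar>) \<le> ?u n"
    proof (intro always_eventually allI)
      fix n
      show "expectation (\<lambda>w. \<bar>s n * cond_cov T (e n) (e n) w - v\<bar>) \<le> ?u n"
        using cond_cov_diag[OF e(1)[of n] e(2)[of n] T s[of n], of v] bj[of n] by linarith
    qed
  qed
qed

end

subsection \<open>Asymptotics of the mean\<close>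

lemma increment_kernel_scale:
  assumes "e > 0" shows "increment_kernel H e e (e * x) = e powr (2*H - 2) * incov H 1 x"
proof -
  have "\<bar>e * x + e\<bar> = e * \<bar>x + 1\<bar>" "\<bar>e * x - e\<bar> = e * \<bar>x - 1\<bar>" "\<bar>e * x\<bar> = e * \<bar>x\<bar>"
    using assms abs_mult[of e "x + 1"] abs_mult[of e "x - 1"] by (auto simp: algebra_simps abs_mult)
  then have "incov H e (e * x) = e powr (2*H) * incov H 1 x"
    using assms by (simp add: incov_def powr_mult algebra_simps)
  then show ?thesis using assms by (simp add: increment_kernel_diag powr_diff)
qed

lemma avg_incov_scale:
  assumes "e > 0" "H > 0" shows "avg_incov H e (e * x) 0 = e powr (2*H) * avg_incov H 1 x 0"
proof -
  have "\<bar>e * x + e\<bar> = e * \<bar>x + 1\<bar>" "\<bar>e * x - e\<bar> = e * \<bar>x - 1\<bar>" "\<bar>e * x\<bar> = e * \<bar>x\<bar>"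
    using assms abs_mult[of e "x + 1"] abs_mult[of e "x - 1"] by (auto simp: algebra_simps abs_mult)
  then have "avg_incov H e (e * x) 0 = (e powr (2*H+2) * (\<bar>x + 1\<bar> powr (2*H+2) + \<bar>x - 1\<bar> powr (2*H+2) - 2 * \<bar>x\<bar> powr (2*H+2) - 2))
     / ((2*H+1) * (2*H+2) * e\<^sup>2)"
    using assms by (simp add: avg_incov_0_eq powr_mult algebra_simps)
  also have "\<dots> = (e powr (2*H+2) / e\<^sup>2) * ((\<bar>x + 1\<bar> powr (2*H+2) + \<bar>x - 1\<bar> powr (2*H+2) - 2 * \<bar>x\<bar> powr (2*H+2) - 2)
     / ((2*H+1) * (2*H+2)))" by (simp add: mult.commute)
  also have "e powr (2*H+2) / e\<^sup>2 = e powr (2*H)" using assms by (simp add: powr_add)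
  finally show ?thesis using assms by (simp add: avg_incov_0_eq)
qed

text \<open>Integrand of \<open>mean_form\<close> at unit scale, without the length factor.\<close>

definition mean_density :: "real \<Rightarrow> real \<Rightarrow> real" where
  "mean_density H x = incov H 1 x * avg_incov H 1 x 0"

lemma continuous_on_mean_density: "H > 0 \<Longrightarrow> continuous_on UNIV (mean_density H)"
  unfolding mean_density_def[abs_def]
  by (intro continuous_on_mult continuous_on_avg_incov_0 continuous_on_incov continuous_on_const continuous_on_id) auto

lemma mean_density_measurable: "H > 0 \<Longrightarrow> mean_density H \<in> borel_measurable borel"
  by (rule borel_measurable_continuous_onI[OF continuous_on_mean_density])

lemma mean_density_even: assumes "H > 0" shows "mean_density H (- x) = mean_density H x"
proof -
  have "\<bar>- x + 1\<bar> = \<bar>x - 1\<bar>" "\<bar>- x - 1\<bar> = \<bar>x + 1\<bar>" by arith+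
  then have "incov H 1 (- x) = incov H 1 x" "avg_incov H 1 (- x) 0 = avg_incov H 1 x 0"
    using assms by (auto simp: incov_def avg_incov_0_eq)
  then show ?thesis by (simp add: mean_density_def)
qed

lemma abs_mean_density_le:
  assumes "0 < H" "H \<le> 1/2"
  shows "\<bar>mean_density H x\<bar> \<le> 4 * (max \<bar>x\<bar> 1) powr (4*H - 2)"
proof -
  let ?m = "max \<bar>x\<bar> 1"
  have "\<bar>incov H 1 x\<bar> \<le> 4 * ?m powr (2*H - 2)" using abs_increment_kernel_diag_le[OF assms, of 1 x] by (simp add: increment_kernel_diag)
  moreover have "\<bar>avg_incov H 1 x 0\<bar> \<le> ?m powr (2*H)"
    using abs_avg_incov_le[OF assms, of 1 x 0] powr_mono2[of "2*H" "\<bar>x\<bar>" ?m] assms by simp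
  ultimately have "\<bar>mean_density H x\<bar> \<le> (4 * ?m powr (2*H - 2)) * ?m powr (2*H)"
    unfolding mean_density_def abs_mult by (intro mult_mono) auto
  also have "\<dots> = 4 * ?m powr (4*H - 2)" by (simp add: powr_add[symmetric])
  finally show ?thesis .
qed

lemma integrable_max_powr:
  fixes q :: real
  assumes q: "q < -1"
  shows "integrable lborel (\<lambda>x. (max \<bar>x\<bar> 1) powr q)"
proof -
  have "(\<lambda>x. x powr q) integrable_on {1..}"
    using has_integral_powr_to_inf[of q 1] q by (auto simp: integrable_on_def)
  then have "(\<lambda>x. x powr q) absolutely_integrable_on {1..}"
    by (intro nonnegative_absolutely_integrable_1) auto
  then have i: "integrable lborel (\<lambda>x. indicator {1..} x * x powr q)"
    unfolding set_integrable_def by (subst (asm) integrable_completion) auto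
  have i': "integrable lborel (\<lambda>x. indicator {1..} (- x) * (- x) powr q)"
    using lborel_integrable_real_affine[OF i, of "-1" 0] by simp
  have "integrable lborel (indicator {-1..1} :: real \<Rightarrow> real)" by simp
  then have sum: "integrable lborel (\<lambda>x. indicator {-1..1} x + (indicator {1..} x * x powr q + indicator {1..} (- x) * (- x) powr q))"
    by (intro Bochner_Integration.integrable_add i i')
  show ?thesis
  proof (rule Bochner_Integration.integrable_bound[OF sum])
    show "AE x in lborel. norm (max \<bar>x\<bar> 1 powr q) \<le> norm (indicator {-1..1} x + (indicator {1..} x * x powr q + indicator {1..} (- x) * (- x) powr q))"
    proof (rule AE_I2)
      fix x :: real
      consider "\<bar>x\<bar> \<le> 1" | "x > 1" | "x < -1" by linarith
      then show "norm (max \<bar>x\<bar> 1 powr q) \<le> norm (indicator {-1..1} x + (indicator {1..} x * x powr q + indicator {1..} (- x) * (- x) powr q))"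
        by cases (auto simp: indicator_def max_def)
    qed
  qed measurable
qed

text \<open>Substitution \<open>h = e*x\<close>: the exponents 1 of the differential,
  \<open>2*H - 2\<close> of the kernel and \<open>2*H\<close> of the variance add up to
  \<open>4*H - 1\<close>, the inverse of the squared normalization in the subcritical case.\<close>

lemma mean_form_scaled:
  assumes H: "H > 0" and e: "e > 0" and T: "T > 0"
  shows "mean_form H T e = e powr (4*H - 1) * (\<integral>x. mean_density H x * max 0 (T - e * \<bar>x\<bar>) \<partial>lborel)"
proof -
  let ?g = "\<lambda>h. increment_kernel H e e h * avg_incov H e h 0 * (T - \<bar>h\<bar>)"
  have "continuous_on UNIV ?g"
    by (intro continuous_on_mult continuous_on_diff continuous_on_rabs continuous_on_const continuous_on_id continuous_on_increment_kernel continuous_on_avg_incov_0 H e)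
  then have gm: "?g \<in> borel_measurable borel" by (rule borel_measurable_continuous_onI)
  have "mean_form H T e = (\<integral>h. indicator {-T..T} h * ?g h \<partial>lborel)" unfolding mean_form_def by (rule integral_ivl[OF gm])
  also have "\<dots> = e * (\<integral>x. indicator {-T..T} (e * x) * ?g (e * x) \<partial>lborel)"
    using lborel_integral_real_affine[of e "\<lambda>h. indicator {-T..T} h * ?g h" 0] e by simp
  also have "(\<integral>x. indicator {-T..T} (e * x) * ?g (e * x) \<partial>lborel) =
     (\<integral>x. (e powr (2*H - 2) * e powr (2*H)) * (mean_density H x * max 0 (T - e * \<bar>x\<bar>)) \<partial>lborel)"
  proof (intro Bochner_Integration.integral_cong refl)
    fix x
    have "indicator {-T..T} (e * x) * (T - \<bar>e * x\<bar>) = max 0 (T - e * \<bar>x\<bar>)"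
    proof -
      have 1: "\<bar>e * x\<bar> = e * \<bar>x\<bar>" using e by (simp add: abs_mult)
      have "e * x \<in> {-T..T} \<longleftrightarrow> \<bar>e * x\<bar> \<le> T" unfolding atLeastAtMost_iff abs_le_iff by linarith
      then show ?thesis unfolding 1 by (simp add: indicator_def max_def)
    qed
    moreover have "indicator {-T..T} (e * x) * ?g (e * x) = increment_kernel H e e (e * x) * avg_incov H e (e * x) 0 * (indicator {-T..T} (e * x) * (T - \<bar>e * x\<bar>))"
      by simp
    ultimately show "indicator {-T..T} (e * x) * ?g (e * x) = (e powr (2*H - 2) * e powr (2*H)) * (mean_density H x * max 0 (T - e * \<bar>x\<bar>))"
      by (simp only: increment_kernel_scale[OF e] avg_incov_scale[OF e H] mean_density_def mult.assoc mult.left_commute[of "incov H 1 x" "e powr (2*H)"])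
  qed
  also have "e * \<dots> = (e * (e powr (2*H - 2) * e powr (2*H))) * (\<integral>x. mean_density H x * max 0 (T - e * \<bar>x\<bar>) \<partial>lborel)" by simp
  also have "e * (e powr (2*H - 2) * e powr (2*H)) = e powr (4*H - 1)"
  proof -
    have "e * (e powr (2*H - 2) * e powr (2*H)) = e powr 1 * (e powr (2*H - 2) * e powr (2*H))" using e by simp
    also have "\<dots> = e powr (4*H - 1)" unfolding powr_add[symmetric] by simp
    finally show ?thesis .
  qed
  finally show ?thesis .
qed

text \<open>The primitive \<open>\<kappa>\<close> is odd and tends to 0 for \<open>H < 1/2\<close>:
  increments on the whole line have total covariance 0. This disposes of the constant in
  \<open>sigma_breve_sq_eq\<close>.\<close>

lemma integral_incov_eq_0:
  assumes H: "0 < H" "H < 1/2"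
  shows "integrable lborel (incov H 1)" "(\<integral>x. incov H 1 x \<partial>lborel) = 0"
proof -
  let ?p = "2*H"
  have c: "continuous_on UNIV (incov H 1)" using H continuous_on_incov[of H UNIV "\<lambda>_. 1" "\<lambda>x. x"] by (auto simp: continuous_on_id)
  have m [measurable]: "incov H 1 \<in> borel_measurable borel" by (rule borel_measurable_continuous_onI[OF c])
  show i: "integrable lborel (incov H 1)"
  proof (rule Bochner_Integration.integrable_bound[of lborel "\<lambda>x. 4 * (max \<bar>x\<bar> 1) powr (2*H - 2)"])
    show "integrable lborel (\<lambda>x. 4 * (max \<bar>x\<bar> 1) powr (2*H - 2))" using integrable_max_powr[of "2*H - 2"] H by auto
    show "AE x in lborel. norm (incov H 1 x) \<le> norm (4 * (max \<bar>x\<bar> 1) powr (2*H - 2))"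
      using abs_increment_kernel_diag_le[of H 1] H by (auto simp: increment_kernel_diag)
  qed measurable
  define f1 where "f1 = (\<lambda>t::real. sgn t * \<bar>t\<bar> powr (?p + 1) / (?p + 1))"
  have d1: "DERIV f1 t :> \<bar>t\<bar> powr ?p" for t
    unfolding f1_def using DERIV_sgn_powr_antiderivative[of ?p t] H by simp
  define \<kappa> where "\<kappa> z = (f1 (z + 1) + f1 (z - 1) - 2 * f1 z) / 2" for z
  have \<kappa>d: "DERIV \<kappa> x :> incov H 1 x" for x
  proof -
    have s: "DERIV (\<lambda>z. z + 1) x :> 1" "DERIV (\<lambda>z. z - 1) x :> (1::real)" by (auto intro!: derivative_eq_intros)
    have "DERIV \<kappa> x :> (\<bar>x + 1\<bar> powr ?p * 1 + \<bar>x - 1\<bar> powr ?p * 1 - 2 * \<bar>x\<bar> powr ?p) / 2"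
      unfolding \<kappa>_def[abs_def] by (intro DERIV_cdivide DERIV_diff DERIV_add DERIV_cmult d1 DERIV_chain2[OF d1] s)
    then show ?thesis by (simp add: incov_def)
  qed
  have \<kappa>odd: "\<kappa> (- z) = - \<kappa> z" for z
  proof -
    have f: "f1 (- t) = - f1 t" for t by (simp add: f1_def)
    have "- z + 1 = - (z - 1)" "- z - 1 = - (z + 1)" by auto
    then show ?thesis unfolding \<kappa>_def by (simp only: f) (simp add: field_simps)
  qed
  \<comment> \<open>\<open>\<kappa> n\<close> is half the difference of two values of
    \<open>t^(2*H)\<close> taken in adjacent unit intervals, and such differences vanish because
    \<open>2*H < 1\<close>.\<close>
  have \<kappa>0: "(\<lambda>n. \<kappa> (real n)) \<longlonglongrightarrow> 0"
  proof (rule Lim_null_comparison)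
    show "(\<lambda>n. (real n + 1) powr ?p - (real n - 1) powr ?p) \<longlonglongrightarrow> 0" using H by real_asymp
    show "\<forall>\<^sub>F n in sequentially. norm (\<kappa> (real n)) \<le> (real n + 1) powr ?p - (real n - 1) powr ?p"
      using eventually_gt_at_top[of 1]
    proof eventually_elim
      fix n :: nat assume n: "n > 1"
      obtain a where a: "real n < a" "a < real n + 1" "f1 (real n + 1) - f1 (real n) = (real n + 1 - real n) * \<bar>a\<bar> powr ?p"
        using MVT2[of "real n" "real n + 1" f1 "\<lambda>t. \<bar>t\<bar> powr ?p", OF _ d1] by fastforce
      obtain b where b: "real n - 1 < b" "b < real n" "f1 (real n) - f1 (real n - 1) = (real n - (real n - 1)) * \<bar>b\<bar> powr ?p"
        using MVT2[of "real n - 1" "real n" f1 "\<lambda>t. \<bar>t\<bar> powr ?p", OF _ d1] by fastforce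
      have k: "\<kappa> (real n) = (a powr ?p - b powr ?p) / 2" using a b n by (simp add: \<kappa>_def field_simps)
      have "a powr ?p \<le> (real n + 1) powr ?p" "(real n - 1) powr ?p \<le> b powr ?p" "b powr ?p \<le> a powr ?p"
        using a b n H by (intro powr_mono2; simp)+
      then show "norm (\<kappa> (real n)) \<le> (real n + 1) powr ?p - (real n - 1) powr ?p" unfolding k by simp
    qed
  qed
  have "(\<lambda>n. \<integral>x. indicator {- real n..real n} x * incov H 1 x \<partial>lborel) \<longlonglongrightarrow> (\<integral>x. incov H 1 x \<partial>lborel)"
  proof (rule integral_dominated_convergence[where w = "\<lambda>x. \<bar>incov H 1 x\<bar>"])
    show "AE x in lborel. (\<lambda>n. indicator {- real n..real n} x * incov H 1 x) \<longlonglongrightarrow> incov H 1 x"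
    proof (rule AE_I2)
      fix x :: real
      have "\<forall>\<^sub>F n in sequentially. indicator {- real n..real n} x * incov H 1 x = incov H 1 x"
        using eventually_ge_at_top[of "nat \<lceil>\<bar>x\<bar>\<rceil>"]
      proof eventually_elim
        fix n assume "nat \<lceil>\<bar>x\<bar>\<rceil> \<le> n"
        then have "\<bar>x\<bar> \<le> real n" by linarith
        then show "indicator {- real n..real n} x * incov H 1 x = incov H 1 x" by (auto simp: indicator_def abs_le_iff)
      qed
      then show "(\<lambda>n. indicator {- real n..real n} x * incov H 1 x) \<longlonglongrightarrow> incov H 1 x" by (rule tendsto_eventually)
    qed
    show "integrable lborel (\<lambda>x. \<bar>incov H 1 x\<bar>)" using i by auto
    show "AE x in lborel. norm (indicator {- real n..real n} x * incov H 1 x) \<le> \<bar>incov H 1 x\<bar>" for n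
      by (auto simp: indicator_def)
  qed auto
  moreover have "(\<integral>x. indicator {- real n..real n} x * incov H 1 x \<partial>lborel) = 2 * \<kappa> (real n)" for n
  proof -
    have "(\<integral>x. indicator {- real n..real n} x * incov H 1 x \<partial>lborel) = (\<integral>x. incov H 1 x \<partial>ivl (- real n) (real n))"
      by (rule integral_ivl[symmetric]) measurable
    also have "\<dots> = \<kappa> (real n) - \<kappa> (- real n)" by (rule ivl_FTC[OF _ \<kappa>d c]) simp
    finally show ?thesis by (simp add: \<kappa>odd)
  qed
  ultimately have "(\<lambda>n. 2 * \<kappa> (real n)) \<longlonglongrightarrow> (\<integral>x. incov H 1 x \<partial>lborel)" by simp
  moreover have "(\<lambda>n. 2 * \<kappa> (real n)) \<longlonglongrightarrow> 2 * 0" by (intro tendsto_intros \<kappa>0)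
  ultimately show "(\<integral>x. incov H 1 x \<partial>lborel) = 0" using LIMSEQ_unique[of "\<lambda>n. 2 * \<kappa> (real n)" "\<integral>x. incov H 1 x \<partial>lborel" "2 * 0"] by simp
qed

lemma integrable_mean_density:
  assumes H: "0 < H" "H < 1/4"
  shows "integrable lborel (mean_density H)"
proof (rule Bochner_Integration.integrable_bound[of lborel "\<lambda>x. 4 * (max \<bar>x\<bar> 1) powr (4*H - 2)"])
  show "integrable lborel (\<lambda>x. 4 * (max \<bar>x\<bar> 1) powr (4*H - 2))" using integrable_max_powr[of "4*H - 2"] H by auto
  show "AE x in lborel. norm (mean_density H x) \<le> norm (4 * (max \<bar>x\<bar> 1) powr (4*H - 2))"
    using abs_mean_density_le[of H] H by auto
qed (use mean_density_measurable H in auto)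

text \<open>The second factor of the integrand is, up to sign and normalization,
  \<open>avg_incov H 1 x 0\<close> without its constant -2. The missing constant multiplies the
  integral of \<open>incov H 1\<close>, which is 0.\<close>

lemma sigma_breve_sq_eq:
  assumes H: "0 < H" "H < 1/4"
  shows "sigma_breve_sq H = - (\<integral>x. mean_density H x \<partial>lborel) / 2"
proof -
  let ?c = "(2*H + 1) * (2*H + 2)"
  have c: "?c > 0" using H by simp
  have "(\<integral>x. (\<bar>x + 1\<bar> powr (2*H) + \<bar>x - 1\<bar> powr (2*H) - 2 * \<bar>x\<bar> powr (2*H)) *
          (2 * \<bar>x\<bar> powr (2*H + 2) - \<bar>x + 1\<bar> powr (2*H + 2) - \<bar>x - 1\<bar> powr (2*H + 2)) \<partial>lborel)
     = (\<integral>x. (- 2 * ?c) * mean_density H x + (- 4) * incov H 1 x \<partial>lborel)"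
  proof (intro Bochner_Integration.integral_cong refl)
    fix x :: real
    define A B where "A = \<bar>x + 1\<bar> powr (2*H) + \<bar>x - 1\<bar> powr (2*H) - 2 * \<bar>x\<bar> powr (2*H)"
      and "B = \<bar>x + 1\<bar> powr (2*H + 2) + \<bar>x - 1\<bar> powr (2*H + 2) - 2 * \<bar>x\<bar> powr (2*H + 2)"
    have i: "incov H 1 x = A / 2" by (simp add: incov_def A_def)
    have v: "avg_incov H 1 x 0 = (B - 2) / ?c" using H by (simp add: avg_incov_0_eq B_def)
    have "(- 2 * ?c) * mean_density H x + (- 4) * incov H 1 x = - A * (?c * ((B - 2) / ?c)) - 2 * A"
      unfolding mean_density_def i v by simp
    also have "?c * ((B - 2) / ?c) = B - 2" using c by (metis nonzero_mult_div_cancel_left times_divide_eq_right less_numeral_extra(3))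
    finally have "A * (- B) = (- 2 * ?c) * mean_density H x + (- 4) * incov H 1 x" by (simp add: algebra_simps)
    moreover have "2 * \<bar>x\<bar> powr (2*H + 2) - \<bar>x + 1\<bar> powr (2*H + 2) - \<bar>x - 1\<bar> powr (2*H + 2) = - B" by (simp add: B_def)
    ultimately show "(\<bar>x + 1\<bar> powr (2*H) + \<bar>x - 1\<bar> powr (2*H) - 2 * \<bar>x\<bar> powr (2*H)) *
          (2 * \<bar>x\<bar> powr (2*H + 2) - \<bar>x + 1\<bar> powr (2*H + 2) - \<bar>x - 1\<bar> powr (2*H + 2)) = (- 2 * ?c) * mean_density H x + (- 4) * incov H 1 x"
      unfolding A_def[symmetric] by (simp only:)
  qed
  also have "\<dots> = (- 2 * ?c) * (\<integral>x. mean_density H x \<partial>lborel) + (- 4) * (\<integral>x. incov H 1 x \<partial>lborel)"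
    by (subst Bochner_Integration.integral_add) (use integrable_mean_density[OF H] integral_incov_eq_0(1)[of H] H in auto)
  also have "\<dots> = (- 2 * ?c) * (\<integral>x. mean_density H x \<partial>lborel)" using integral_incov_eq_0(2)[of H] H by simp
  finally have "sigma_breve_sq H = 1 / (4 * ?c) * ((- 2 * ?c) * (\<integral>x. mean_density H x \<partial>lborel))"
    unfolding sigma_breve_sq_def by (simp only: mult.assoc)
  moreover have "1 / (4 * c) * ((- 2 * c) * X) = - X / 2" if "c > 0" for c X :: real using that by (simp add: field_simps)
  ultimately show ?thesis using c by (simp only:)
qed

text \<open>The rescaled length \<open>max 0 (T - e * |x|)\<close> tends to \<open>T\<close> and is
  bounded by it, so integrability of the density allows dominated convergence.\<close>

lemma mean_form_limit_subcritical:
  assumes H: "0 < H" "H < 1/4" and T: "T > 0"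
    and e: "\<And>n. 0 < e n" and e0: "e \<longlonglongrightarrow> 0"
  shows "(\<lambda>n. e n powr (1 - 4*H) * (- mean_form H T (e n) / 2)) \<longlonglongrightarrow> T * sigma_breve_sq H"
proof -
  note [measurable] = mean_density_measurable[OF H(1)]
  have "(\<lambda>n. \<integral>x. mean_density H x * max 0 (T - e n * \<bar>x\<bar>) \<partial>lborel) \<longlonglongrightarrow> (\<integral>x. mean_density H x * max 0 (T - 0 * \<bar>x\<bar>) \<partial>lborel)"
  proof (rule integral_dominated_convergence[where w = "\<lambda>x. \<bar>mean_density H x\<bar> * T"])
    show "integrable lborel (\<lambda>x. \<bar>mean_density H x\<bar> * T)" using integrable_mean_density[OF H] by auto
    show "AE x in lborel. (\<lambda>n. mean_density H x * max 0 (T - e n * \<bar>x\<bar>)) \<longlonglongrightarrow> mean_density H x * max 0 (T - 0 * \<bar>x\<bar>)"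
      by (intro AE_I2 tendsto_mult tendsto_max tendsto_diff tendsto_const e0)
    show "AE x in lborel. norm (mean_density H x * max 0 (T - e n * \<bar>x\<bar>)) \<le> \<bar>mean_density H x\<bar> * T" for n
    proof (rule AE_I2)
      fix x
      have "\<bar>max 0 (T - e n * \<bar>x\<bar>)\<bar> \<le> T" using T e[of n] by (auto simp: max_def)
      then show "norm (mean_density H x * max 0 (T - e n * \<bar>x\<bar>)) \<le> \<bar>mean_density H x\<bar> * T" by (simp add: abs_mult mult_left_mono)
    qed
  qed auto
  then have lim: "(\<lambda>n. - (\<integral>x. mean_density H x * max 0 (T - e n * \<bar>x\<bar>) \<partial>lborel) / 2) \<longlonglongrightarrow> - (\<integral>x. mean_density H x * max 0 (T - 0 * \<bar>x\<bar>) \<partial>lborel) / 2"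
    by (intro tendsto_intros) auto
  have "e n powr (1 - 4*H) * (- mean_form H T (e n) / 2) = - (\<integral>x. mean_density H x * max 0 (T - e n * \<bar>x\<bar>) \<partial>lborel) / 2" for n
  proof -
    have "e n powr (1 - 4*H) * e n powr (4*H - 1) = 1" using e[of n] by (simp add: powr_add[symmetric])
    then show ?thesis unfolding mean_form_scaled[OF H(1) e T] by (simp add: mult.assoc[symmetric])
  qed
  moreover have "- (\<integral>x. mean_density H x * max 0 (T - 0 * \<bar>x\<bar>) \<partial>lborel) / 2 = T * sigma_breve_sq H"
    using T by (simp add: sigma_breve_sq_eq[OF H])
  ultimately show ?thesis using lim by simp
qed

lemma integral_even_ivl:
  fixes g :: "real \<Rightarrow> real"
  assumes g: "continuous_on UNIV g" and ev: "\<And>x. g (- x) = g x" and y: "y \<ge> 0"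
  shows "(\<integral>x. g x \<partial>ivl (- y) y) = 2 * integral {0..y} g"
proof -
  have "g integrable_on {-y..y}" by (intro integrable_continuous_interval continuous_on_subset[OF g]) auto
  then have "integral {-y..0} g + integral {0..y} g = integral {-y..y} g"
    using y by (intro Henstock_Kurzweil_Integration.integral_combine) auto
  moreover have "integral {-y..0} g = integral {0..y} g"
    using Henstock_Kurzweil_Integration.integral_reflect_real[of y 0 g] ev by simp
  ultimately show ?thesis unfolding ivl_continuous(2)[OF g] by simp
qed

text \<open>Since \<open>x * mean_density (1/4) x\<close> tends to -1/8, l'Hospital gives
  \<open>I y\<close> of order \<open>- ln y / 8\<close> and \<open>J y\<close> of order
  \<open>- y / 8\<close>. The length correction \<open>e * J (T / e)\<close> stays bounded and is
  lost against the logarithm; twice \<open>T * I\<close> times -1/2 leaves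
  \<open>T / 8\<close>.\<close>

lemma mean_form_limit_critical:
  assumes T: "T > 0" and e: "\<And>n. 0 < e n" and e0: "e \<longlonglongrightarrow> 0"
  shows "(\<lambda>n. 1 / ln (1 / e n) * (- mean_form (1/4) T (e n) / 2)) \<longlonglongrightarrow> T / 8"
proof -
  let ?r = "mean_density (1/4)"
  have rc: "continuous_on UNIV ?r" by (rule continuous_on_mean_density) simp
  have xc: "continuous_on UNIV (\<lambda>x. x * ?r x)" by (intro continuous_on_mult continuous_on_id rc)
  define I J where "I y = integral {0..y} ?r" and "J y = integral {0..y} (\<lambda>x. x * ?r x)" for y
  have xr: "((\<lambda>x. x * ?r x) \<longlongrightarrow> - 1/8) at_top"
  proof -
    \<comment> \<open>The density for \<open>x > 1\<close> without absolute values;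
      \<open>15/4\<close> is \<open>(2*H+1)*(2*H+2)\<close> at \<open>H = 1/4\<close>. The
      covariance factor behaves like \<open>- x^(-3/2) / 8\<close>, the variance factor like
      \<open>x^(1/2)\<close>.\<close>
    have "((\<lambda>x::real. x * (((x + 1) powr (1/2) + (x - 1) powr (1/2) - 2 * x powr (1/2)) / 2 *
      (((x + 1) powr (5/2) + (x - 1) powr (5/2) - 2 * x powr (5/2) - 2) / (15/4)))) \<longlongrightarrow> - 1/8) at_top"
      by real_asymp
    moreover have "\<forall>\<^sub>F x in at_top. x * (((x + 1) powr (1/2) + (x - 1) powr (1/2) - 2 * x powr (1/2)) / 2 *
      (((x + 1) powr (5/2) + (x - 1) powr (5/2) - 2 * x powr (5/2) - 2) / (15/4))) = x * ?r x"
      using eventually_gt_at_top[of "1::real"] by eventually_elim (simp add: mean_density_def incov_def avg_incov_0_eq)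
    ultimately show ?thesis by (rule Lim_transform_eventually)
  qed
  have deriv: "DERIV (\<lambda>y. integral {0..y} g) x :> g x" if g: "continuous_on UNIV g" and x: "x > 0" for g :: "real \<Rightarrow> real" and x
  proof -
    have "((\<lambda>y. integral {0..y} g) has_real_derivative g x) (at x within {0..x+1})"
      using x by (intro integral_has_real_derivative continuous_on_subset[OF g]) auto
    then have "((\<lambda>y. integral {0..y} g) has_real_derivative g x) (at x within {0<..<x+1})"
      by (rule has_field_derivative_subset) auto
    then show ?thesis using x by (subst (asm) at_within_open) auto
  qed
  have Il: "((\<lambda>y. I y / ln y) \<longlongrightarrow> - 1/8) at_top"
  proof (rule lhospital_at_top_at_top[where f' = ?r and g' = "\<lambda>y. 1 / y"])
    show "LIM x at_top. ln x :> (at_top :: real filter)" by (rule ln_at_top)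
    show "\<forall>\<^sub>F x in at_top. 1 / x \<noteq> (0::real)" using eventually_gt_at_top[of "0::real"] by eventually_elim auto
    show "\<forall>\<^sub>F x in at_top. DERIV I x :> ?r x"
      using eventually_gt_at_top[of "0::real"] unfolding I_def[abs_def] by eventually_elim (rule deriv[OF rc])
    show "\<forall>\<^sub>F x in at_top. DERIV ln x :> 1 / (x::real)"
      using eventually_gt_at_top[of "0::real"] by eventually_elim (auto intro!: derivative_eq_intros)
    show "((\<lambda>x. ?r x / (1 / x)) \<longlongrightarrow> - 1/8) at_top" using xr by (simp add: mult.commute)
  qed
  have Jl: "((\<lambda>y. J y / y) \<longlongrightarrow> - 1/8) at_top"
  proof (rule lhospital_at_top_at_top[where f' = "\<lambda>x. x * ?r x" and g' = "\<lambda>y. 1"])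
    show "\<forall>\<^sub>F x in at_top. DERIV J x :> x * ?r x"
      using eventually_gt_at_top[of "0::real"] unfolding J_def[abs_def] by eventually_elim (rule deriv[OF xc])
  qed (use xr in \<open>auto simp: filterlim_ident\<close>)
  have Deq: "mean_form (1/4) T \<epsilon> = 2 * (T * I (T / \<epsilon>) - \<epsilon> * J (T / \<epsilon>))" if \<epsilon>: "\<epsilon> > 0" for \<epsilon>
  proof -
    let ?y = "T / \<epsilon>"
    let ?g = "\<lambda>x. ?r x * (T - \<epsilon> * \<bar>x\<bar>)"
    have y: "?y \<ge> 0" using T \<epsilon> by simp
    have gc: "continuous_on UNIV ?g" by (intro continuous_on_mult continuous_on_diff continuous_on_rabs continuous_on_const continuous_on_id rc)
    have "mean_form (1/4) T \<epsilon> = (\<integral>x. ?r x * max 0 (T - \<epsilon> * \<bar>x\<bar>) \<partial>lborel)"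
      using mean_form_scaled[of "1/4" \<epsilon> T] \<epsilon> T by simp
    also have "\<dots> = (\<integral>x. indicator {- ?y..?y} x * ?g x \<partial>lborel)"
    proof (intro Bochner_Integration.integral_cong refl)
      fix x :: real
      have "x \<in> {- ?y..?y} \<longleftrightarrow> \<epsilon> * \<bar>x\<bar> \<le> T" 
      proof -
        have "x \<in> {- ?y..?y} \<longleftrightarrow> \<bar>x\<bar> \<le> ?y" by (auto simp: abs_le_iff)
        then show ?thesis using pos_le_divide_eq[OF \<epsilon>, of "\<bar>x\<bar>" T] by (simp add: mult.commute)
      qed
      then show "?r x * max 0 (T - \<epsilon> * \<bar>x\<bar>) = indicator {- ?y..?y} x * ?g x" by (auto simp: indicator_def max_def)
    qed
    also have "\<dots> = (\<integral>x. ?g x \<partial>ivl (- ?y) ?y)" by (rule integral_ivl[OF borel_measurable_continuous_onI[OF gc], symmetric])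
    also have "\<dots> = 2 * integral {0..?y} ?g" by (rule integral_even_ivl[OF gc _ y]) (simp add: mean_density_even)
    also have "integral {0..?y} ?g = integral {0..?y} (\<lambda>x. T * ?r x - \<epsilon> * (x * ?r x))"
      by (intro integral_cong) (auto simp: algebra_simps)
    also have "\<dots> = T * I ?y - \<epsilon> * J ?y"
    proof -
      have "(\<lambda>x. T * ?r x) integrable_on {0..?y}" "(\<lambda>x. \<epsilon> * (x * ?r x)) integrable_on {0..?y}"
        by (rule integrable_continuous_interval, rule continuous_on_mult[OF continuous_on_const], rule continuous_on_subset[OF rc] continuous_on_subset[OF xc], simp)+
      then show ?thesis unfolding I_def J_def
        by (subst Henstock_Kurzweil_Integration.integral_diff) auto
    qed
    finally show ?thesis by simp
  qed
  have y: "filterlim (\<lambda>n. T / e n) at_top sequentially"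
  proof -
    have "filterlim (\<lambda>n. inverse (e n)) at_top sequentially" using e e0 by (intro filterlim_inverse_at_top) auto
    from filterlim_tendsto_pos_mult_at_top[OF tendsto_const T this] show ?thesis by (simp add: divide_inverse)
  qed
  \<comment> \<open>Written in \<open>x = T / e\<close>, where \<open>e = T / x\<close> and
    \<open>ln (1 / e) = ln x - ln T\<close>, and grouped so that \<open>Il\<close> and
    \<open>Jl\<close> apply.\<close>
  let ?\<Phi> = "\<lambda>x. - T * (I x / ln x) * (ln x / (ln x - ln T)) + T * (J x / x) * (1 / (ln x - ln T))"
  have l1: "((\<lambda>x. ln x / (ln x - ln T)) \<longlongrightarrow> 1) at_top" using T by real_asymp
  have l2: "((\<lambda>x. 1 / (ln x - ln T)) \<longlongrightarrow> 0) at_top" using T by real_asymp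
  have "(?\<Phi> \<longlongrightarrow> - T * (- 1/8) * 1 + T * (- 1/8) * 0) at_top"
    by (intro tendsto_add tendsto_mult tendsto_const Il Jl l1 l2)
  then have "(?\<Phi> \<longlongrightarrow> T / 8) at_top" by simp
  from filterlim_compose[OF this y] have lim: "(\<lambda>n. ?\<Phi> (T / e n)) \<longlonglongrightarrow> T / 8" .
  \<comment> \<open>Beyond 1 and \<open>T\<close> neither \<open>ln y\<close> nor
    \<open>ln y - ln T\<close> vanishes.\<close>
  have "\<forall>\<^sub>F n in sequentially. T / e n > max 1 T"
    using y unfolding filterlim_at_top_dense by (rule spec)
  then have "\<forall>\<^sub>F n in sequentially. ?\<Phi> (T / e n) = 1 / ln (1 / e n) * (- mean_form (1/4) T (e n) / 2)"
  proof eventually_elim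
    fix n assume n: "T / e n > max 1 T"
    define y where "y = T / e n"
    have yp: "y > 1" "y > T" using n by (auto simp: y_def)
    have en: "e n = T / y" using e[of n] T by (simp add: y_def)
    have L: "ln (1 / e n) = ln y - ln T" using yp T by (simp add: en ln_div)
    have nz: "ln y \<noteq> 0" "ln y - ln T \<noteq> 0" "y \<noteq> 0" using yp T by auto
    have "1 / ln (1 / e n) * (- mean_form (1/4) T (e n) / 2) = 1 / (ln y - ln T) * (- (2 * (T * I y - e n * J y)) / 2)"
      unfolding L Deq[OF e] y_def[symmetric] ..
    also have "\<dots> = - (T * I y - e n * J y) / (ln y - ln T)"
    proof -
      have "1 / l * (- (2 * z) / 2) = - z / l" for l z :: real by simp
      then show ?thesis .
    qed
    also have "e n * J y = T / y * J y" using en by simp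
    also have "- (T * I y - T / y * J y) / (ln y - ln T) = ?\<Phi> y"
    proof -
      have "- (T * i - T / x * j) / d = - T * (i / l) * (l / d) + T * (j / x) * (1 / d)" if "l \<noteq> 0" for i j l d x :: real
        using that by (cases "d = 0"; cases "x = 0") (simp_all add: field_simps)
      from this[OF nz(1)] show ?thesis .
    qed
    finally show "?\<Phi> (T / e n) = 1 / ln (1 / e n) * (- mean_form (1/4) T (e n) / 2)" unfolding y_def[symmetric] by simp
  qed
  then show ?thesis using lim by (rule Lim_transform_eventually[rotated])
qed

subsection \<open>Conditioning on the first motion\<close>

lemma ivl_shift:
  fixes b :: "real \<Rightarrow> real"
  assumes [measurable]: "b \<in> borel_measurable borel"
  shows "(\<integral>a. b (u + a) \<partial>ivl 0 e) = (\<integral>x. b x \<partial>ivl u (u + e))"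
proof -
  have "(\<integral>x. b x \<partial>ivl u (u + e)) = (\<integral>x. indicator {u..u + e} x * b x \<partial>lborel)" by (rule integral_ivl) measurable
  also have "\<dots> = (\<integral>a. indicator {u..u + e} (u + a) * b (u + a) \<partial>lborel)"
    using lborel_integral_real_affine[of 1 "\<lambda>x. indicator {u..u + e} x * b x" u] by simp
  also have "\<dots> = (\<integral>a. indicator {0..e} a * b (u + a) \<partial>lborel)"
    by (intro Bochner_Integration.integral_cong) (auto simp: indicator_def)
  also have "\<dots> = (\<integral>a. b (u + a) \<partial>ivl 0 e)" by (rule integral_ivl[symmetric]) measurable
  finally show ?thesis by simp
qed

text \<open>Shifting the first term makes the two integrals overlap; what survives is one window of
  length \<open>e\<close> at each end.\<close>

lemma integral_increment_eq:
  fixes b :: "real \<Rightarrow> real"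
  assumes b: "continuous_on UNIV b" and u: "u \<ge> 0" and e: "e > 0"
  shows "integral {0..u} (\<lambda>v. (b (v + e) - b v) / e) = (\<integral>a. b (u + a) \<partial>ivl 0 e) / e - (\<integral>a. b (0 + a) \<partial>ivl 0 e) / e"
proof -
  have bm: "b \<in> borel_measurable borel" by (rule borel_measurable_continuous_onI[OF b])
  have bs: "continuous_on UNIV (\<lambda>v. b (v + e))" by (intro continuous_on_compose2[OF b] continuous_intros subset_UNIV)
  have i: "b integrable_on {x..y}" for x y by (intro integrable_continuous_interval continuous_on_subset[OF b]) auto
  have c: "integral {0..e} b + integral {e..u + e} b = integral {0..u} b + integral {u..u + e} b"
    using u e i Henstock_Kurzweil_Integration.integral_combine[of 0 e "u + e" b]
      Henstock_Kurzweil_Integration.integral_combine[of 0 u "u + e" b] by simp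
  have "integral {0..u} (\<lambda>v. (b (v + e) - b v) / e) = (\<integral>v. (b (v + e) - b v) / e \<partial>ivl 0 u)"
    using e by (intro ivl_continuous(2)[symmetric] continuous_on_divide continuous_on_diff bs b continuous_on_const) auto
  also have "\<dots> = ((\<integral>v. b (v + e) \<partial>ivl 0 u) - (\<integral>v. b v \<partial>ivl 0 u)) / e"
    using ivl_continuous(1)[OF bs] ivl_continuous(1)[OF b] by simp
  also have "(\<integral>v. b (v + e) \<partial>ivl 0 u) = integral {e..u + e} b"
    using ivl_shift[OF bm, where u = e and e = u] by (simp add: add.commute ivl_continuous(2)[OF b])
  also have "(\<integral>v. b v \<partial>ivl 0 u) = integral {0..u} b" by (rule ivl_continuous(2)[OF b])
  also have "integral {e..u + e} b - integral {0..u} b = integral {u..u + e} b - integral {0..e} b" using c by linarith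
  finally show ?thesis unfolding ivl_shift[OF bm] ivl_continuous(2)[OF b] by (simp only: diff_divide_distrib add_0)
qed

context fbm
begin

text \<open>The outer integral of the functional with the first motion frozen into a deterministic
  weight, hence Gaussian in this motion.\<close>

definition weighted_increments :: "real \<Rightarrow> real \<Rightarrow> (real \<Rightarrow> real) \<Rightarrow> 'a \<Rightarrow> real" where
  "weighted_increments T e \<phi> w = (\<integral>u. \<phi> u * ((W (u + e) w - W u w) / e) \<partial>ivl 0 T)"

lemma increment_continuous:
  assumes "w \<in> space M" "e > 0" shows "continuous_on UNIV (\<lambda>u. (W (u + e) w - W u w) / e)"
  using assms(2) W_continuous[OF assms(1)] W_shift_continuous[OF assms(1), of e]
  by (intro continuous_on_divide continuous_on_diff continuous_on_const) (auto simp: add.commute)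

lemma glim_weighted_increments:
  assumes \<phi>: "continuous_on UNIV \<phi>" and e: "e > 0" and T: "T > 0"
  shows "glim (weighted_increments T e \<phi>)"
proof -
  have "glim (\<lambda>w. integral {0..T} (\<lambda>u. \<phi> u * ((W (u + e) w - W u w) / e)))"
  proof (rule glim_integral)
    fix u assume "u \<in> {0..T}"
    then have "lincomb (\<lambda>w. (1 / e) * (W (u + e) w + (-1) * W u w))"
      using e by (intro lincomb_scale lincomb_add lincomb_W) auto
    then show "lincomb (\<lambda>w. (W (u + e) w - W u w) / e)" by simp
  next
    show "continuous_on {0..T} (\<lambda>u. (W (u + e) w - W u w) / e)" if "w \<in> space M" for w
      by (rule continuous_on_subset[OF increment_continuous[OF that e]]) simp
  qed (use T \<phi> in \<open>auto intro: continuous_on_subset\<close>)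
  then show ?thesis
  proof (rule glim_cong)
    fix w assume "w \<in> space M"
    then show "integral {0..T} (\<lambda>u. \<phi> u * ((W (u + e) w - W u w) / e)) = weighted_increments T e \<phi> w"
      unfolding weighted_increments_def by (intro ivl_continuous(2)[symmetric] continuous_on_mult \<phi> increment_continuous e)
  qed
qed

lemma weighted_increments_cov:
  assumes \<phi>: "continuous_on UNIV \<phi>" and \<psi>: "continuous_on UNIV \<psi>" and e: "e > 0" and d: "d > 0" and T: "T > 0"
  shows "expectation (\<lambda>w. weighted_increments T e \<phi> w * weighted_increments T d \<psi> w) = (\<integral>p. \<phi> (fst p) * \<psi> (snd p) * increment_kernel H e d (fst p - snd p) \<partial>ivl2 0 T 0 T)"
proof -
  let ?D = "\<lambda>e u w. (W (u + e) w - W u w) / e"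
  let ?f = "\<lambda>w p. (\<phi> (fst p) * ?D e (fst p) w) * (\<psi> (snd p) * ?D d (snd p) w)"
  let ?C = "(e powr (2*H) / e\<^sup>2 + d powr (2*H) / d\<^sup>2) / 2"
  have [measurable]: "\<phi> \<in> borel_measurable borel" "\<psi> \<in> borel_measurable borel"
    using \<phi> \<psi> by (auto intro: borel_measurable_continuous_onI)
  have \<phi>\<psi>: "continuous_on UNIV (\<lambda>p. \<phi> (fst p) * \<psi> (snd p))"
    by (intro continuous_on_mult continuous_on_compose2[OF \<phi>] continuous_on_compose2[OF \<psi>] continuous_intros subset_UNIV)
  have bd: "integrable M (\<lambda>w. ?f w p) \<and> expectation (\<lambda>w. \<bar>?f w p\<bar>) \<le> \<bar>\<phi> (fst p) * \<psi> (snd p)\<bar> * ?C \<and>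
     expectation (\<lambda>w. ?f w p) = \<phi> (fst p) * \<psi> (snd p) * increment_kernel H e d (fst p - snd p)"
    if p: "fst p \<in> {0..T} \<and> snd p \<in> {0..T}" for p
  proof -
    have gi: "glim (\<lambda>w. W (u + c) w - W u w)" if "u \<ge> 0" "c > 0" for u c using that by (intro glim_diff glim_W) auto
    have g: "glim (?D c u)" if "u \<ge> 0" "c > 0" for u c using glim_scale[OF gi[OF that], of "1 / c"] by simp
    have v: "expectation (\<lambda>w. (?D c u w)\<^sup>2) = c powr (2*H) / c\<^sup>2" if "u \<ge> 0" "c > 0" for u c
      using W_var[of u "u + c"] that by (simp add: power_divide)
    have eq: "?f w p = (\<phi> (fst p) * \<psi> (snd p)) * (?D e (fst p) w * ?D d (snd p) w)" for w by simp
    have c: "expectation (\<lambda>w. ?D e (fst p) w * ?D d (snd p) w) = increment_kernel H e d (fst p - snd p)"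
    proof -
      have "expectation (\<lambda>w. ?D e (fst p) w * ?D d (snd p) w) =
        expectation (\<lambda>w. (W (fst p + e) w - W (fst p) w) * (W (snd p + d) w - W (snd p) w)) / (e * d)" by simp
      also have "\<dots> = increment_kernel H e d (fst p - snd p)"
      proof -
        have eqs: "fst p + e - snd p = fst p - snd p + e" "fst p - (snd p + d) = fst p - snd p - d"
          "fst p + e - (snd p + d) = fst p - snd p + e - d" by simp_all
        have "expectation (\<lambda>w. (W (fst p + e) w - W (fst p) w) * (W (snd p + d) w - W (snd p) w)) =
          (\<bar>fst p + e - snd p\<bar> powr (2*H) + \<bar>fst p - (snd p + d)\<bar> powr (2*H) - \<bar>fst p + e - (snd p + d)\<bar> powr (2*H) - \<bar>fst p - snd p\<bar> powr (2*H)) / 2"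
          using p e d by (intro W_increment_cov) auto
        then show ?thesis unfolding eqs increment_kernel_def by (simp only: divide_divide_eq_left mult.assoc)
      qed
      finally show ?thesis .
    qed
    have a: "expectation (\<lambda>w. \<bar>?D e (fst p) w * ?D d (snd p) w\<bar>) \<le> ?C"
      using glim_expectation_abs_prod_le[OF g g, of "fst p" e "snd p" d] v[of "fst p" e] v[of "snd p" d] p e d by simp
    have i: "integrable M (\<lambda>w. ?D e (fst p) w * ?D d (snd p) w)"
      using glim_prod_integrable(1)[OF g g, of "fst p" e "snd p" d] p e d by simp
    have "expectation (\<lambda>w. \<bar>?f w p\<bar>) = \<bar>\<phi> (fst p) * \<psi> (snd p)\<bar> * expectation (\<lambda>w. \<bar>?D e (fst p) w * ?D d (snd p) w\<bar>)"
      unfolding eq abs_mult[of "\<phi> (fst p) * \<psi> (snd p)"] by (rule integral_mult_right_zero)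
    also have "\<dots> \<le> \<bar>\<phi> (fst p) * \<psi> (snd p)\<bar> * ?C" using a by (intro mult_left_mono) auto
    finally have 1: "expectation (\<lambda>w. \<bar>?f w p\<bar>) \<le> \<bar>\<phi> (fst p) * \<psi> (snd p)\<bar> * ?C" .
    have 2: "expectation (\<lambda>w. ?f w p) = \<phi> (fst p) * \<psi> (snd p) * increment_kernel H e d (fst p - snd p)"
      unfolding eq c[symmetric] by (rule integral_mult_right_zero)
    have 3: "integrable M (\<lambda>w. ?f w p)" unfolding eq using i by (rule integrable_mult_right)
    show ?thesis using 1 2 3 by blast
  qed
  have ae: "AE p in ivl2 0 T 0 T. integrable M (\<lambda>w. ?f w p) \<and> expectation (\<lambda>w. \<bar>?f w p\<bar>) \<le> \<bar>\<phi> (fst p) * \<psi> (snd p)\<bar> * ?C"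
    using AE_ivl2[of 0 T 0 T] by eventually_elim (use bd in blast)
  have ae': "AE p in ivl2 0 T 0 T. expectation (\<lambda>w. ?f w p) = \<phi> (fst p) * \<psi> (snd p) * increment_kernel H e d (fst p - snd p)"
    using AE_ivl2[of 0 T 0 T] by eventually_elim (use bd in blast)
  have fm: "(\<lambda>(w, p). ?f w p) \<in> borel_measurable (M \<Otimes>\<^sub>M ivl2 0 T 0 T)" by measurable
  have gi: "integrable (ivl2 0 T 0 T) (\<lambda>p. \<bar>\<phi> (fst p) * \<psi> (snd p)\<bar> * ?C)"
    by (intro integrable_mult_left integrable_abs ivl2_continuous_integrable \<phi>\<psi>)
  note fub = fubini_expectation[OF ivl2.P.sigma_finite_measure_axioms fm ae gi]
  have "expectation (\<lambda>w. weighted_increments T e \<phi> w * weighted_increments T d \<psi> w) = expectation (\<lambda>w. \<integral>p. ?f w p \<partial>ivl2 0 T 0 T)"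
  proof (intro Bochner_Integration.integral_cong refl)
    fix w assume w: "w \<in> space M"
    have "integrable (ivl 0 T) (\<lambda>u. \<phi> u * ?D e u w)" "integrable (ivl 0 T) (\<lambda>u. \<psi> u * ?D d u w)"
      by (intro ivl_continuous(1) continuous_on_mult \<phi> \<psi> increment_continuous w e d)+
    from ivl2_product[OF this] show "weighted_increments T e \<phi> w * weighted_increments T d \<psi> w = (\<integral>p. ?f w p \<partial>ivl2 0 T 0 T)" unfolding weighted_increments_def .
  qed
  also have "\<dots> = (\<integral>p. expectation (\<lambda>w. ?f w p) \<partial>ivl2 0 T 0 T)" by (rule fub(2))
  also have "\<dots> = (\<integral>p. \<phi> (fst p) * \<psi> (snd p) * increment_kernel H e d (fst p - snd p) \<partial>ivl2 0 T 0 T)"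
    by (rule integral_cong_AE[OF fub(5) _ ae']) measurable
  finally show ?thesis .
qed

lemma weighted_increments_cos:
  fixes a b :: real
  assumes \<phi>: "continuous_on UNIV \<phi>" and \<psi>: "continuous_on UNIV \<psi>" and e: "e > 0" and d: "d > 0" and T: "T > 0"
  defines "q \<equiv> a\<^sup>2 * expectation (\<lambda>w. weighted_increments T e \<phi> w * weighted_increments T e \<phi> w) + b\<^sup>2 * expectation (\<lambda>w. weighted_increments T d \<psi> w * weighted_increments T d \<psi> w)
      + 2 * a * b * expectation (\<lambda>w. weighted_increments T e \<phi> w * weighted_increments T d \<psi> w)"
  shows "expectation (\<lambda>w. cos (a * weighted_increments T e \<phi> w + b * weighted_increments T d \<psi> w)) = exp (- q / 2)" "q \<ge> 0"
proof -
  have g: "glim (weighted_increments T e \<phi>)" "glim (weighted_increments T d \<psi>)" using assms by (auto intro: glim_weighted_increments)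
  have g2: "glim (\<lambda>w. a * weighted_increments T e \<phi> w + b * weighted_increments T d \<psi> w)" by (intro glim_add glim_scale g)
  have q: "expectation (\<lambda>w. (a * weighted_increments T e \<phi> w + b * weighted_increments T d \<psi> w)\<^sup>2) = q"
    unfolding glim_second_moment_combination[OF g] q_def by (simp add: power2_eq_square)
  show "expectation (\<lambda>w. cos (a * weighted_increments T e \<phi> w + b * weighted_increments T d \<psi> w)) = exp (- q / 2)"
    using glim_moments(3)[OF g2, of 1] unfolding q by simp
  show "q \<ge> 0" unfolding q[symmetric] by (intro integral_nonneg_AE) auto
qed

end

text \<open>Freezing time at 0 extends the paths continuously to the line and changes nothing at
  nonnegative times; the increment variance is read off from a two-point linear combination.\<close>

lemma is_fBm_imp_fbm:
  assumes B: "is_fBm M H B" and H: "0 < H" "H \<le> 1/4"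
  shows "fbm M (\<lambda>t. B (max 0 t)) H"
proof -
  interpret prob_space M using B by (simp add: is_fBm_def)
  have Bm: "B t \<in> borel_measurable M" if "t \<ge> 0" for t using B that by (simp add: is_fBm_def)
  have Bc: "continuous_on {0..} (\<lambda>t. B t w)" if "w \<in> space M" for w using B that by (simp add: is_fBm_def)
  have Bg: "distr M borel (\<lambda>w. \<Sum>t\<in>I. c t * B t w) = gauss_law (\<Sum>t\<in>I. \<Sum>s\<in>I. c t * c s * fBm_cov H t s)"
    if "finite I" "I \<subseteq> {0..}" for I and c :: "real \<Rightarrow> real" using B that unfolding is_fBm_def by blast
  show ?thesis
  proof unfold_locales
    show "B (max 0 t) \<in> borel_measurable M" for t by (rule Bm) simp
    show "continuous_on UNIV (\<lambda>t. B (max 0 t) w)" if "w \<in> space M" for w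
      by (rule continuous_on_compose2[OF Bc[OF that]]) (auto intro!: continuous_intros)
    fix I :: "real set" and c :: "real \<Rightarrow> real" assume I: "finite I" "I \<subseteq> {0..}"
    have "(\<lambda>w. \<Sum>t\<in>I. c t * B (max 0 t) w) = (\<lambda>w. \<Sum>t\<in>I. c t * B t w)"
      using I by (intro ext sum.cong) (auto simp: max_absorb2 subset_iff)
    then show "\<exists>v. distr M borel (\<lambda>w. \<Sum>t\<in>I. c t * B (max 0 t) w) = gauss_law v" using Bg[OF I, of c] by auto
  next
    fix s t :: real assume st: "s \<ge> 0" "t \<ge> 0"
    show "expectation (\<lambda>w. (B (max 0 t) w - B (max 0 s) w)\<^sup>2) = \<bar>t - s\<bar> powr (2*H)"
    proof (cases "s = t")
      case False
      \<comment> \<open>Coefficients 1 at \<open>t\<close> and -1 at \<open>s\<close>; the case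
        \<open>s = t\<close> is separate because the index set then collapses to one point.\<close>
      define c where "c r = (if r = t then 1 else -1 :: real)" for r
      have "distr M borel (\<lambda>w. \<Sum>r\<in>{t, s}. c r * B r w) = gauss_law (\<Sum>r\<in>{t, s}. \<Sum>r'\<in>{t, s}. c r * c r' * fBm_cov H r r')"
        using st by (intro Bg) auto
      moreover have "(\<lambda>w. \<Sum>r\<in>{t, s}. c r * B r w) = (\<lambda>w. B t w - B s w)" using False by (auto simp: c_def)
      moreover have "(\<Sum>r\<in>{t, s}. \<Sum>r'\<in>{t, s}. c r * c r' * fBm_cov H r r') = \<bar>t - s\<bar> powr (2*H)"
        using False H by (auto simp: c_def fBm_cov_def abs_minus_commute field_simps)
      ultimately have d: "distr M borel (\<lambda>w. B t w - B s w) = gauss_law (\<bar>t - s\<bar> powr (2*H))" by simp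
      have [measurable]: "B t \<in> borel_measurable M" "B s \<in> borel_measurable M" using Bm st by auto
      have "expectation (\<lambda>w. (B t w - B s w)\<^sup>2) = (\<integral>x. x\<^sup>2 \<partial>distr M borel (\<lambda>w. B t w - B s w))"
        by (subst integral_distr) auto
      also have "\<dots> = \<bar>t - s\<bar> powr (2*H)" unfolding d gauss_law_moments by simp
      finally show ?thesis using st by (simp add: max_absorb2)
    qed (use H in auto)
  qed (use H in auto)
qed

text \<open>By independence \<open>w \<mapsto> f(w, w)\<close> may be integrated as if the two arguments were
  sampled separately, provided \<open>f\<close> sees each of them only through its own process.\<close>

lemma (in prob_space) expectation_decouple:
  fixes f :: "'a \<times> 'a \<Rightarrow> real"
  assumes ind: "indep_var S X S' X'"
  defines "N1 \<equiv> vimage_algebra (space M) X S" and "N2 \<equiv> vimage_algebra (space M) X' S'"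
  assumes f: "f \<in> borel_measurable (N1 \<Otimes>\<^sub>M N2)" and bd: "\<And>z. \<bar>f z\<bar> \<le> C"
  shows "expectation (\<lambda>w. f (w, w)) = expectation (\<lambda>w1. expectation (\<lambda>w2. f (w1, w2)))"
proof -
  have rv: "random_variable S X" "random_variable S' X'"
    and ins: "indep_set (sets N1) (sets N2)"
    using ind unfolding indep_var_eq N1_def N2_def sets_vimage_algebra by auto
  have sp: "space N1 = space M" "space N2 = space M" by (simp_all add: N1_def N2_def)
  have m1: "(\<lambda>w. w) \<in> measurable M N1" unfolding N1_def by (rule measurable_vimage_algebra2) (use rv in auto)
  have m2: "(\<lambda>w. w) \<in> measurable M N2" unfolding N2_def by (rule measurable_vimage_algebra2) (use rv in auto)
  have gen: "sigma_sets (space M) {(\<lambda>w. w) -` A \<inter> space M | A. A \<in> sets N} = sets N" if "space N = space M" for N :: "'a measure"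
  proof -
    have "{(\<lambda>w. w) -` A \<inter> space M | A. A \<in> sets N} = sets N"
      using sets.sets_into_space[of _ N] that by (auto simp: Int_absorb2)
    then show ?thesis using sets.sigma_sets_eq[of N] that by simp
  qed
  \<comment> \<open>Independence of the two path maps is restated for the identity map into the
    sigma-algebras they generate, so that the product law lives on pairs of outcomes.\<close>
  have "indep_var N1 (\<lambda>w. w) N2 (\<lambda>w. w)"
    unfolding indep_var_eq gen[OF sp(1)] gen[OF sp(2)] using m1 m2 ins by auto
  then have eq: "distr M N1 (\<lambda>w. w) \<Otimes>\<^sub>M distr M N2 (\<lambda>w. w) = distr M (N1 \<Otimes>\<^sub>M N2) (\<lambda>w. (w, w))"
    unfolding indep_var_distribution_eq by simp
  interpret P1: prob_space "distr M N1 (\<lambda>w. w)" by (rule prob_space_distr[OF m1])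
  interpret P2: prob_space "distr M N2 (\<lambda>w. w)" by (rule prob_space_distr[OF m2])
  interpret P: pair_prob_space "distr M N1 (\<lambda>w. w)" "distr M N2 (\<lambda>w. w)" ..
  have fP: "f \<in> borel_measurable (distr M N1 (\<lambda>w. w) \<Otimes>\<^sub>M distr M N2 (\<lambda>w. w))"
    using f by (simp cong: measurable_cong_sets)
  have i: "integrable (distr M N1 (\<lambda>w. w) \<Otimes>\<^sub>M distr M N2 (\<lambda>w. w)) f"
    using fP bd by (intro P.integrable_const_bound[where B=C]) auto
  have "expectation (\<lambda>w. f (w, w)) = (\<integral>z. f z \<partial>distr M (N1 \<Otimes>\<^sub>M N2) (\<lambda>w. (w, w)))"
    using m1 m2 f by (subst integral_distr) auto
  also have "\<dots> = (\<integral>w1. \<integral>w2. f (w1, w2) \<partial>distr M N2 (\<lambda>w. w) \<partial>distr M N1 (\<lambda>w. w))"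
    unfolding eq[symmetric] using P.integral_fst'[OF i] by simp
  also have "\<dots> = (\<integral>w1. expectation (\<lambda>w2. f (w1, w2)) \<partial>distr M N1 (\<lambda>w. w))"
  proof (rule Bochner_Integration.integral_cong[OF refl])
    fix w1 assume "w1 \<in> space (distr M N1 (\<lambda>w. w))"
    then have "(\<lambda>w2. f (w1, w2)) \<in> borel_measurable N2" using measurable_compose_Pair1[OF _ f] by simp
    then show "(\<integral>w2. f (w1, w2) \<partial>distr M N2 (\<lambda>w. w)) = expectation (\<lambda>w2. f (w1, w2))" by (rule integral_distr[OF m2])
  qed
  also have "\<dots> = expectation (\<lambda>w1. expectation (\<lambda>w2. f (w1, w2)))"
  proof (rule integral_distr[OF m1, of "\<lambda>w1. expectation (\<lambda>w2. f (w1, w2))"])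
    have "(\<lambda>w1. \<integral>w2. f (w1, w2) \<partial>distr M N2 (\<lambda>w. w)) \<in> borel_measurable N1"
      using P2.borel_measurable_lebesgue_integral[of "\<lambda>w1 w2. f (w1, w2)" N1] f by (simp cong: measurable_cong_sets)
    moreover have "(\<integral>w2. f (w1, w2) \<partial>distr M N2 (\<lambda>w. w)) = expectation (\<lambda>w2. f (w1, w2))" if "w1 \<in> space N1" for w1
      by (rule integral_distr[OF m2]) (use measurable_compose_Pair1[OF that f] in simp)
    ultimately show "(\<lambda>w1. expectation (\<lambda>w2. f (w1, w2))) \<in> borel_measurable N1"
      by (subst measurable_cong[of N1 _ "\<lambda>w1. \<integral>w2. f (w1, w2) \<partial>distr M N2 (\<lambda>w. w)"]) auto
  qed
  finally show ?thesis .
qed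

locale fbm_pair =
  fixes M :: "'a measure" and B1 B2 :: "real \<Rightarrow> 'a \<Rightarrow> real" and H T :: real
  assumes T_pos: "T > 0" and H0: "0 < H" and H1: "H \<le> 1/4"
    and fBm1: "is_fBm M H B1" and fBm2: "is_fBm M H B2"
    and indep: "prob_space.indep_var M
           (Pi\<^sub>M {0::real..} (\<lambda>_. borel)) (\<lambda>\<omega>. \<lambda>t\<in>{0::real..}. B1 t \<omega>)
           (Pi\<^sub>M {0::real..} (\<lambda>_. borel)) (\<lambda>\<omega>. \<lambda>t\<in>{0::real..}. B2 t \<omega>)"
begin

sublocale p1: fbm M "\<lambda>t. B1 (max 0 t)" H
  by (rule is_fBm_imp_fbm[OF fBm1 H0 H1])

sublocale p2: fbm M "\<lambda>t. B2 (max 0 t)" H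
  by (rule is_fBm_imp_fbm[OF fBm2 H0 H1])

abbreviation \<phi> :: "real \<Rightarrow> 'a \<Rightarrow> real \<Rightarrow> real" where
  "\<phi> e w u \<equiv> p1.moving_avg e u w - p1.moving_avg e 0 w"

lemma \<phi>_continuous: "w \<in> space M \<Longrightarrow> continuous_on UNIV (\<phi> e w)"
  by (intro continuous_on_diff continuous_on_const p1.moving_avg_continuous)

text \<open>The functional with separate outcomes for the two motions: the first feeds the weight,
  the second the increments. On the diagonal it is \<open>G_breve\<close>.\<close>

definition G_dec :: "real \<Rightarrow> 'a \<times> 'a \<Rightarrow> real" where
  "G_dec e z = p2.weighted_increments T e (\<phi> e (fst z)) (snd z)"

lemma G_breve_eq:
  assumes w: "w \<in> space M" and e: "e > 0"
  shows "G_breve B1 B2 T e w = G_dec e (w, w)"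
proof -
  let ?b1 = "\<lambda>t. B1 (max 0 t) w" and ?b2 = "\<lambda>t. B2 (max 0 t) w"
  have "G_breve B1 B2 T e w = integral {0..T} (\<lambda>u. \<phi> e w u * ((?b2 (u + e) - ?b2 u) / e))"
    unfolding G_breve_def
  proof (intro integral_cong)
    fix u assume u: "u \<in> {0..T}"
    have "integral {0..u} (\<lambda>v. (B1 (v + e) w - B1 v w) / e) = integral {0..u} (\<lambda>v. (?b1 (v + e) - ?b1 v) / e)"
      using e by (intro integral_cong) (auto simp: max_absorb2)
    also have "\<dots> = \<phi> e w u" unfolding p1.moving_avg_def
      using integral_increment_eq[OF p1.W_continuous[OF w], of u e] u e by simp
    finally show "integral {0..u} (\<lambda>v. (B1 (v + e) w - B1 v w) / e) * ((B2 (u + e) w - B2 u w) / e) =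
        \<phi> e w u * ((?b2 (u + e) - ?b2 u) / e)" using u e by (simp add: max_absorb2)
  qed
  also have "\<dots> = G_dec e (w, w)" unfolding G_dec_def p2.weighted_increments_def fst_conv snd_conv
    by (intro ivl_continuous(2)[symmetric] continuous_on_mult \<phi>_continuous p2.increment_continuous w e)
  finally show ?thesis .
qed

text \<open>The sigma-algebras are left open: \<open>M\<close> itself gives measurability on the
  diagonal, those generated by the two paths give the form that decoupling requires.\<close>

lemma G_dec_measurable_gen:
  assumes sp: "space N1 = space M" "space N2 = space M"
    and m1: "\<And>t. (\<lambda>w. B1 (max 0 t) w) \<in> borel_measurable N1"
    and m2: "\<And>t. (\<lambda>w. B2 (max 0 t) w) \<in> borel_measurable N2"
  shows "G_dec e \<in> borel_measurable (N1 \<Otimes>\<^sub>M N2)"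
proof -
  have Ym: "p1.moving_avg e u \<in> borel_measurable N1" for u
    unfolding p1.moving_avg_def by (intro borel_measurable_divide borel_measurable_ivl_integral m1 p1.W_shift_continuous) (auto simp: sp)
  let ?K = "(N1 \<Otimes>\<^sub>M N2) \<Otimes>\<^sub>M ivl 0 T"
  have Y1: "(\<lambda>x. p1.moving_avg e (snd x) (fst (fst x))) \<in> borel_measurable ?K"
    by (rule measurable_compose_caratheodory[of "\<lambda>w u. p1.moving_avg e u w" N1 "\<lambda>x. fst (fst x)" ?K snd])
       (use Ym p1.moving_avg_continuous sp in auto)
  have Y0: "(\<lambda>x. p1.moving_avg e 0 (fst (fst x))) \<in> borel_measurable ?K"
    by (rule measurable_compose[OF _ Ym, of "\<lambda>x. fst (fst x)"]) measurable
  have W2: "(\<lambda>x. B2 (max 0 (X x)) (snd (fst x))) \<in> borel_measurable ?K" if X: "X \<in> borel_measurable ?K" for X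
    by (rule measurable_compose_caratheodory[of "\<lambda>w t. B2 (max 0 t) w" N2 "\<lambda>x. snd (fst x)" ?K X])
       (use m2 p2.W_continuous sp X in auto)
  have "(\<lambda>x. (p1.moving_avg e (snd x) (fst (fst x)) - p1.moving_avg e 0 (fst (fst x))) *
     ((B2 (max 0 (snd x + e)) (snd (fst x)) - B2 (max 0 (snd x)) (snd (fst x))) / e)) \<in> borel_measurable ?K"
    by (intro borel_measurable_times borel_measurable_diff borel_measurable_divide Y1 Y0 W2) measurable
  then have "(\<lambda>(z, u). (p1.moving_avg e u (fst z) - p1.moving_avg e 0 (fst z)) *
     ((B2 (max 0 (u + e)) (snd z) - B2 (max 0 u) (snd z)) / e)) \<in> borel_measurable ?K"
    by (simp add: case_prod_beta')
  from ivl.borel_measurable_lebesgue_integral[OF this] show ?thesis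
    unfolding G_dec_def[abs_def] p2.weighted_increments_def by simp
qed

lemma G_dec_diag_measurable: "(\<lambda>w. G_dec e (w, w)) \<in> borel_measurable M"
  by (rule measurable_compose[OF _ G_dec_measurable_gen[of M M], of "\<lambda>w. (w, w)"]) auto

lemma restrict_path_measurable:
  fixes B :: "real \<Rightarrow> 'a \<Rightarrow> real"
  shows "(\<lambda>w. B (max 0 t) w) \<in> borel_measurable
    (vimage_algebra (space M) (\<lambda>w. \<lambda>t\<in>{0::real..}. B t w) (Pi\<^sub>M {0::real..} (\<lambda>_. borel)))"
proof -
  let ?N = "vimage_algebra (space M) (\<lambda>w. \<lambda>t\<in>{0::real..}. B t w) (Pi\<^sub>M {0::real..} (\<lambda>_. borel))"
  have p: "(\<lambda>w. \<lambda>t\<in>{0::real..}. B t w) \<in> measurable ?N (Pi\<^sub>M {0::real..} (\<lambda>_. borel))"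
    by (rule measurable_vimage_algebra1) (auto simp: space_PiM)
  have "(\<lambda>w. (\<lambda>t\<in>{0::real..}. B t w) (max 0 t)) \<in> borel_measurable ?N"
    by (rule measurable_compose[OF p measurable_component_singleton]) simp
  then show ?thesis by simp
qed

text \<open>Given the first motion, \<^term>\<open>G_dec e\<close> is a Gaussian linear functional of the second one.\<close>

lemma expectation_cos:
  assumes e: "e > 0" and d: "d > 0"
  shows "p1.expectation (\<lambda>w. cos (a * G_dec e (w, w) + b * G_dec d (w, w))) =
    p1.expectation (\<lambda>w. exp (- (a\<^sup>2 * p1.cond_cov T e e w + b\<^sup>2 * p1.cond_cov T d d w + 2 * a * b * p1.cond_cov T e d w) / 2))"
    and "w \<in> space M \<Longrightarrow> a\<^sup>2 * p1.cond_cov T e e w + b\<^sup>2 * p1.cond_cov T d d w + 2 * a * b * p1.cond_cov T e d w \<ge> 0"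
proof -
  \<comment> \<open>For frozen \<open>w\<close> the weight is deterministic, so the Gaussian formula
    holds under the second motion, with covariances that are the \<open>cond_cov\<close> of the
    first.\<close>
  have cond: "p1.expectation (\<lambda>w2. cos (a * G_dec e (w, w2) + b * G_dec d (w, w2))) =
      exp (- (a\<^sup>2 * p1.cond_cov T e e w + b\<^sup>2 * p1.cond_cov T d d w + 2 * a * b * p1.cond_cov T e d w) / 2) \<and>
      a\<^sup>2 * p1.cond_cov T e e w + b\<^sup>2 * p1.cond_cov T d d w + 2 * a * b * p1.cond_cov T e d w \<ge> 0" if w: "w \<in> space M" for w
    using p2.weighted_increments_cos[OF \<phi>_continuous[OF w] \<phi>_continuous[OF w] e d T_pos, of a e b d]
    unfolding p2.weighted_increments_cov[OF \<phi>_continuous[OF w] \<phi>_continuous[OF w] e e T_pos]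
      p2.weighted_increments_cov[OF \<phi>_continuous[OF w] \<phi>_continuous[OF w] d d T_pos]
      p2.weighted_increments_cov[OF \<phi>_continuous[OF w] \<phi>_continuous[OF w] e d T_pos] G_dec_def fst_conv snd_conv p1.cond_cov_def by blast
  show "w \<in> space M \<Longrightarrow> a\<^sup>2 * p1.cond_cov T e e w + b\<^sup>2 * p1.cond_cov T d d w + 2 * a * b * p1.cond_cov T e d w \<ge> 0"
    using cond by blast
  have fm: "(\<lambda>z. cos (a * G_dec e z + b * G_dec d z)) \<in> borel_measurable
     (vimage_algebra (space M) (\<lambda>w. \<lambda>t\<in>{0::real..}. B1 t w) (Pi\<^sub>M {0::real..} (\<lambda>_. borel)) \<Otimes>\<^sub>M
      vimage_algebra (space M) (\<lambda>w. \<lambda>t\<in>{0::real..}. B2 t w) (Pi\<^sub>M {0::real..} (\<lambda>_. borel)))"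
  proof -
    note [measurable] = G_dec_measurable_gen[OF space_vimage_algebra space_vimage_algebra restrict_path_measurable[of B1] restrict_path_measurable[of B2]]
    show ?thesis by measurable
  qed
  have "p1.expectation (\<lambda>w. cos (a * G_dec e (w, w) + b * G_dec d (w, w))) =
     p1.expectation (\<lambda>w1. p1.expectation (\<lambda>w2. cos (a * G_dec e (w1, w2) + b * G_dec d (w1, w2))))"
    by (rule p1.expectation_decouple[OF indep fm, of 1]) simp
  also have "\<dots> = p1.expectation (\<lambda>w. exp (- (a\<^sup>2 * p1.cond_cov T e e w + b\<^sup>2 * p1.cond_cov T d d w + 2 * a * b * p1.cond_cov T e d w) / 2))"
    by (intro Bochner_Integration.integral_cong refl) (use cond in blast)
  finally show "p1.expectation (\<lambda>w. cos (a * G_dec e (w, w) + b * G_dec d (w, w))) =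
    p1.expectation (\<lambda>w. exp (- (a\<^sup>2 * p1.cond_cov T e e w + b\<^sup>2 * p1.cond_cov T d d w + 2 * a * b * p1.cond_cov T e d w) / 2))" .
qed

lemma cond_cov_nonneg: "e > 0 \<Longrightarrow> w \<in> space M \<Longrightarrow> p1.cond_cov T e e w \<ge> 0"
  using expectation_cos(2)[of e e w 1 0] by simp

text \<open>Common core of both regimes: they differ only in the normalization
  \<open>\<sigma>\<close>, in the constant of \<open>sC\<close> and in the limit \<open>D\<close> of
  the mean.\<close>

lemma convergence_along_sequence:
  fixes e \<sigma> :: "nat \<Rightarrow> real"
  assumes e: "\<And>n. 0 < e n" "\<And>n. e n \<le> 1" and e0: "e \<longlonglongrightarrow> 0" and \<sigma>: "\<And>n. \<sigma> n \<ge> 0" and \<sigma>0: "\<sigma> \<longlonglongrightarrow> 0"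
    and sC: "\<And>n h. (\<sigma> n)\<^sup>2 * (max \<bar>h\<bar> (e n)) powr (4*H - 1) \<le> C"
    and D: "(\<lambda>n. (\<sigma> n)\<^sup>2 * (- mean_form H T (e n) / 2)) \<longlonglongrightarrow> v"
    and F: "bcont_CT_R T F"
  shows "(\<lambda>n. p1.expectation (\<lambda>w. F ((\<lambda>t. (B1 t w, B2 t w)), \<sigma> n * G_breve B1 B2 T (e n) w)))
    \<longlonglongrightarrow> p1.expectation (\<lambda>w. \<integral>x. F ((\<lambda>t. (B1 t w, B2 t w)), x) \<partial>gauss_law v)"
proof -
  let ?Q = "\<lambda>n k. p1.cond_cov T (e n) (e k)"
  let ?X = "\<lambda>n w. \<sigma> n * G_dec (e n) (w, w)"
  have s0: "(\<lambda>n. (\<sigma> n)\<^sup>2) \<longlonglongrightarrow> 0" using tendsto_power[OF \<sigma>0, of 2] by simp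
  have QL: "(\<lambda>n. p1.expectation (\<lambda>w. \<bar>(\<sigma> n)\<^sup>2 * ?Q n n w - v\<bar>)) \<longlonglongrightarrow> 0"
    by (rule p1.cond_cov_limit[OF e e0 T_pos _ s0 sC D]) simp
  have Qi: "integrable M (?Q n k)" for n k by (rule p1.cond_cov_cross(1)[OF e(1) e(2) e(1) T_pos])
  have Qm [measurable]: "?Q n k \<in> borel_measurable M" for n k using Qi by auto
  \<comment> \<open>The sign is inherited: \<open>v\<close> is an L1 limit of nonnegative
    conditional variances. The explicit formula for the limit variance does not reveal it.\<close>
  have v: "v \<ge> 0"
  proof (rule ccontr)
    assume "\<not> v \<ge> 0"
    then have nv: "v < 0" by simp
    have "- v \<le> p1.expectation (\<lambda>w. \<bar>(\<sigma> n)\<^sup>2 * ?Q n n w - v\<bar>)" for n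
    proof -
      have "p1.expectation (\<lambda>w. - v) \<le> p1.expectation (\<lambda>w. \<bar>(\<sigma> n)\<^sup>2 * ?Q n n w - v\<bar>)"
      proof (rule integral_mono)
        show "integrable M (\<lambda>w. \<bar>(\<sigma> n)\<^sup>2 * ?Q n n w - v\<bar>)" using Qi by auto
        fix w assume "w \<in> space M"
        then have "0 \<le> (\<sigma> n)\<^sup>2 * ?Q n n w" using cond_cov_nonneg[OF e(1)] by simp
        then show "- v \<le> \<bar>(\<sigma> n)\<^sup>2 * ?Q n n w - v\<bar>" by linarith
      qed simp
      then show ?thesis by (simp add: p1.prob_space)
    qed
    then have "- v \<le> 0" using QL by (intro LIMSEQ_le_const) auto
    with nv show False by simp
  qed
  \<comment> \<open>Lipschitz bound for the exponential on the half-line where both exponents are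
    nonpositive; \<open>q0\<close> and \<open>r0\<close> below place the arguments there.\<close>
  have expdiff: "\<bar>exp (- x / 2) - exp (- y / 2)\<bar> \<le> \<bar>x / 2 - y / 2\<bar>" if "x \<ge> 0" "y \<ge> 0" for x y :: real
  proof -
    have *: "exp (- x) - exp (- y) \<le> y - x" if "x \<ge> 0" "x \<le> y" for x y :: real
    proof -
      have "1 + (x - y) \<le> exp (x - y)" by (rule exp_ge_add_one_self)
      then have "exp (- x) * (1 + (x - y)) \<le> exp (- x) * exp (x - y)" by (intro mult_left_mono) auto
      also have "\<dots> = exp (- y)" by (simp add: exp_add[symmetric])
      finally have "exp (- x) - exp (- y) \<le> exp (- x) * (y - x)" by (simp add: algebra_simps)
      also have "\<dots> \<le> 1 * (y - x)" using that by (intro mult_right_mono) auto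
      finally show ?thesis by simp
    qed
    show ?thesis using *[of "x / 2" "y / 2"] *[of "y / 2" "x / 2"] that by (cases "x \<le> y") auto
  qed
  have cosk: "p1.expectation (\<lambda>w. cos (b * ?X k w)) = p1.expectation (\<lambda>w. exp (- (b\<^sup>2 * (\<sigma> k)\<^sup>2 * ?Q k k w) / 2))" for b k
    using expectation_cos(1)[OF e(1) e(1), of "b * \<sigma> k" k 0 k] by (simp add: power_mult_distrib mult.assoc)
  have lim: "(\<lambda>n. p1.expectation (\<lambda>w. cos (a * ?X n w + b * ?X k w))) \<longlonglongrightarrow>
     exp (- (a\<^sup>2 * v) / 2) * p1.expectation (\<lambda>w. cos (b * ?X k w))" for a b k
  proof -
    let ?c = "T powr (2*H) * (T * (2 * (T + e k + 2) powr (2*H) / e k))"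
    let ?u = "\<lambda>n. a\<^sup>2 / 2 * p1.expectation (\<lambda>w. \<bar>(\<sigma> n)\<^sup>2 * ?Q n n w - v\<bar>) + \<bar>a * b\<bar> * \<sigma> n * \<sigma> k * ?c"
    \<comment> \<open>The two exponents share the term in \<open>?Q k k\<close>. Their difference is
      the diagonal error at \<open>n\<close> and the mixed term, whose mean is at most
      \<open>\<sigma> n\<close> times a constant depending on \<open>k\<close>, \<open>a\<close> and
      \<open>b\<close>.\<close>
    have main: "\<bar>p1.expectation (\<lambda>w. cos (a * ?X n w + b * ?X k w)) - exp (- (a\<^sup>2 * v) / 2) * p1.expectation (\<lambda>w. cos (b * ?X k w))\<bar> \<le> ?u n" for n
    proof -
      let ?q = "\<lambda>w. (a * \<sigma> n)\<^sup>2 * ?Q n n w + (b * \<sigma> k)\<^sup>2 * ?Q k k w + 2 * (a * \<sigma> n) * (b * \<sigma> k) * ?Q n k w"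
      let ?r = "\<lambda>w. a\<^sup>2 * v + b\<^sup>2 * (\<sigma> k)\<^sup>2 * ?Q k k w"
      have q0: "?q w \<ge> 0" if "w \<in> space M" for w
        using expectation_cos(2)[OF e(1) e(1) that, of "a * \<sigma> n" n "b * \<sigma> k" k] by simp
      have r0: "?r w \<ge> 0" if "w \<in> space M" for w using v cond_cov_nonneg[OF e(1) that] by simp
      have c1: "p1.expectation (\<lambda>w. cos (a * ?X n w + b * ?X k w)) = p1.expectation (\<lambda>w. exp (- ?q w / 2))"
        using expectation_cos(1)[OF e(1) e(1), of "a * \<sigma> n" n "b * \<sigma> k" k] by (simp add: mult.assoc)
      have c2: "exp (- (a\<^sup>2 * v) / 2) * p1.expectation (\<lambda>w. cos (b * ?X k w)) = p1.expectation (\<lambda>w. exp (- ?r w / 2))"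
      proof -
        have "p1.expectation (\<lambda>w. exp (- ?r w / 2)) = p1.expectation (\<lambda>w. exp (- (a\<^sup>2 * v) / 2) * exp (- (b\<^sup>2 * (\<sigma> k)\<^sup>2 * ?Q k k w) / 2))"
          by (intro Bochner_Integration.integral_cong refl) (simp add: exp_add[symmetric] diff_divide_distrib)
        then show ?thesis unfolding cosk by simp
      qed
      have ei: "integrable M (\<lambda>w. exp (- f w / 2))" if "f \<in> borel_measurable M" "\<And>w. w \<in> space M \<Longrightarrow> f w \<ge> 0" for f :: "'a \<Rightarrow> real"
        using that by (intro p1.integrable_const_bound[where B=1] AE_I2) auto
      have i1: "integrable M (\<lambda>w. exp (- ?q w / 2))" by (rule ei[OF _ q0]) measurable
      have i2: "integrable M (\<lambda>w. exp (- ?r w / 2))" by (rule ei[OF _ r0]) measurable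
      have "\<bar>p1.expectation (\<lambda>w. exp (- ?q w / 2)) - p1.expectation (\<lambda>w. exp (- ?r w / 2))\<bar>
          = \<bar>p1.expectation (\<lambda>w. exp (- ?q w / 2) - exp (- ?r w / 2))\<bar>" using i1 i2 by simp
      also have "\<dots> \<le> p1.expectation (\<lambda>w. \<bar>exp (- ?q w / 2) - exp (- ?r w / 2)\<bar>)" by (rule integral_abs_bound)
      also have "\<dots> \<le> p1.expectation (\<lambda>w. a\<^sup>2 / 2 * \<bar>(\<sigma> n)\<^sup>2 * ?Q n n w - v\<bar> + \<bar>a * b\<bar> * \<sigma> n * \<sigma> k * \<bar>?Q n k w\<bar>)"
      proof (rule integral_mono)
        show "integrable M (\<lambda>w. \<bar>exp (- ?q w / 2) - exp (- ?r w / 2)\<bar>)"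
          by (intro integrable_abs Bochner_Integration.integrable_diff i1 i2)
        show "integrable M (\<lambda>w. a\<^sup>2 / 2 * \<bar>(\<sigma> n)\<^sup>2 * ?Q n n w - v\<bar> + \<bar>a * b\<bar> * \<sigma> n * \<sigma> k * \<bar>?Q n k w\<bar>)"
          by (intro Bochner_Integration.integrable_add integrable_mult_right integrable_abs Bochner_Integration.integrable_diff Qi) auto
        fix w assume w: "w \<in> space M"
        have "\<bar>exp (- ?q w / 2) - exp (- ?r w / 2)\<bar> \<le> \<bar>?q w / 2 - ?r w / 2\<bar>"
          by (rule expdiff[OF q0[OF w] r0[OF w]])
        also have "?q w / 2 - ?r w / 2 = a\<^sup>2 / 2 * ((\<sigma> n)\<^sup>2 * ?Q n n w - v) + a * b * \<sigma> n * \<sigma> k * ?Q n k w"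
          by (simp add: power_mult_distrib field_simps)
        also have "\<bar>\<dots>\<bar> \<le> \<bar>a\<^sup>2 / 2 * ((\<sigma> n)\<^sup>2 * ?Q n n w - v)\<bar> + \<bar>a * b * \<sigma> n * \<sigma> k * ?Q n k w\<bar>" by (rule abs_triangle_ineq)
        also have "\<dots> = a\<^sup>2 / 2 * \<bar>(\<sigma> n)\<^sup>2 * ?Q n n w - v\<bar> + \<bar>a * b\<bar> * \<sigma> n * \<sigma> k * \<bar>?Q n k w\<bar>"
          using \<sigma>[of n] \<sigma>[of k] by (simp add: abs_mult)
        finally show "\<bar>exp (- ?q w / 2) - exp (- ?r w / 2)\<bar> \<le> a\<^sup>2 / 2 * \<bar>(\<sigma> n)\<^sup>2 * ?Q n n w - v\<bar> + \<bar>a * b\<bar> * \<sigma> n * \<sigma> k * \<bar>?Q n k w\<bar>" .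
      qed
      also have "\<dots> = a\<^sup>2 / 2 * p1.expectation (\<lambda>w. \<bar>(\<sigma> n)\<^sup>2 * ?Q n n w - v\<bar>) + \<bar>a * b\<bar> * \<sigma> n * \<sigma> k * p1.expectation (\<lambda>w. \<bar>?Q n k w\<bar>)"
      proof -
        have "integrable M (\<lambda>w. \<bar>(\<sigma> n)\<^sup>2 * ?Q n n w - v\<bar>)" "integrable M (\<lambda>w. \<bar>?Q n k w\<bar>)" using Qi by auto
        then show ?thesis by simp
      qed
      also have "\<dots> \<le> ?u n" using p1.cond_cov_cross(2)[OF e(1)[of n] e(2)[of n] e(1)[of k] T_pos] \<sigma>
        by (intro add_left_mono mult_left_mono) auto
      finally show ?thesis unfolding c1 c2 .
    qed
    have "?u \<longlonglongrightarrow> a\<^sup>2 / 2 * 0 + \<bar>a * b\<bar> * 0 * \<sigma> k * ?c" by (intro tendsto_add tendsto_mult tendsto_const QL \<sigma>0)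
    then have "?u \<longlonglongrightarrow> 0" by simp
    then have "(\<lambda>n. p1.expectation (\<lambda>w. cos (a * ?X n w + b * ?X k w)) - exp (- (a\<^sup>2 * v) / 2) * p1.expectation (\<lambda>w. cos (b * ?X k w))) \<longlonglongrightarrow> 0"
      by (rule Lim_null_comparison[rotated]) (use main in auto)
    then show ?thesis by (simp add: LIM_zero_iff)
  qed
  have Xm: "?X n \<in> borel_measurable M" for n using G_dec_diag_measurable by measurable
  have mix: "(\<lambda>n. p1.expectation (\<lambda>w. indicator A w * h (?X n w))) \<longlonglongrightarrow> p1.prob A * (\<integral>x. h x \<partial>gauss_law v)"
    if "A \<in> sets M" "continuous_on UNIV h" "\<And>x. \<bar>h x\<bar> \<le> K" for A h K
  proof (rule p1.renyi_mixing[OF Xm v _ _ that])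
    show "(\<lambda>n. p1.expectation (\<lambda>w. cos (a * ?X n w))) \<longlonglongrightarrow> exp (- (a\<^sup>2 * v) / 2)" for a
      using lim[of a 0 0] by (simp add: p1.prob_space)
    fix a b :: real and k assume "\<bar>b\<bar> = \<bar>a\<bar>"
    \<comment> \<open>Evenness of the cosine reconciles \<open>lim\<close>, whose limit is expressed
      with \<open>b\<close>, with the form required by \<open>renyi_mixing\<close>.\<close>
    then have "cos (b * x) = cos (a * x)" for x by (auto simp: abs_eq_iff)
    then show "(\<lambda>n. p1.expectation (\<lambda>w. cos (a * ?X n w + b * ?X k w))) \<longlonglongrightarrow> exp (- (a\<^sup>2 * v) / 2) * p1.expectation (\<lambda>w. cos (a * ?X k w))"
      using lim[of a b k] by simp
  qed
  have Bm: "B1 t \<in> borel_measurable M" "B2 t \<in> borel_measurable M" if "t \<ge> 0" for t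
    using p1.W_measurable[of t] p2.W_measurable[of t] that by (simp_all add: max_absorb2)
  have Bc: "continuous_on {0..T} (\<lambda>t. (B1 t w, B2 t w))" if "w \<in> space M" for w
  proof -
    have c: "continuous_on {0..} (\<lambda>t. B1 t w)" "continuous_on {0..} (\<lambda>t. B2 t w)"
      using fBm1 fBm2 that by (auto simp: is_fBm_def)
    show ?thesis by (intro continuous_on_Pair continuous_on_subset[OF c(1)] continuous_on_subset[OF c(2)]) auto
  qed
  have "(\<lambda>n. p1.expectation (\<lambda>w. F ((\<lambda>t. (B1 t w, B2 t w)), ?X n w)))
    \<longlonglongrightarrow> p1.expectation (\<lambda>w. \<integral>x. F ((\<lambda>t. (B1 t w, B2 t w)), x) \<partial>gauss_law v)"
    by (rule p1.functional_convergence[OF T_pos _ Bc Xm real_distribution_gauss_law mix F])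
       (auto intro!: borel_measurable_Pair Bm)
  moreover have "p1.expectation (\<lambda>w. F ((\<lambda>t. (B1 t w, B2 t w)), ?X n w)) =
     p1.expectation (\<lambda>w. F ((\<lambda>t. (B1 t w, B2 t w)), \<sigma> n * G_breve B1 B2 T (e n) w))" for n
    by (intro Bochner_Integration.integral_cong refl) (simp add: G_breve_eq e(1))
  ultimately show ?thesis by simp
qed

end

section \<open>The subcritical and the critical regime\<close>

theorem theorem6p2:
  fixes M :: "'a measure" and B1 B2 :: "real \<Rightarrow> 'a \<Rightarrow> real" and T H :: real
  assumes "T > 0" and "0 < H" and "H < 1"
    and "is_fBm M H B1" and "is_fBm M H B2"
    and "prob_space.indep_var M
           (Pi\<^sub>M {0::real..} (\<lambda>_. borel)) (\<lambda>\<omega>. \<lambda>t\<in>{0::real..}. B1 t \<omega>)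
           (Pi\<^sub>M {0::real..} (\<lambda>_. borel)) (\<lambda>\<omega>. \<lambda>t\<in>{0::real..}. B2 t \<omega>)"
  shows "(H < 1/4 \<longrightarrow>
            conv_law_indep M T
              (\<lambda>\<epsilon> \<omega>. ((\<lambda>t. (B1 t \<omega>, B2 t \<omega>)), \<epsilon> powr (1/2 - 2*H) * G_breve B1 B2 T \<epsilon> \<omega>))
              (\<lambda>\<omega> t. (B1 t \<omega>, B2 t \<omega>))
              (gauss_law (T * sigma_breve_sq H)))
       \<and> (H = 1/4 \<longrightarrow>
            conv_law_indep M T
              (\<lambda>\<epsilon> \<omega>. ((\<lambda>t. (B1 t \<omega>, B2 t \<omega>)), G_breve B1 B2 T \<epsilon> \<omega> / sqrt (ln (1 / \<epsilon>))))
              (\<lambda>\<omega> t. (B1 t \<omega>, B2 t \<omega>))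
              (gauss_law (T / 8)))"
proof (intro conjI impI)
  assume H: "H < 1/4"
  interpret fbm_pair M B1 B2 H T by (rule fbm_pair.intro[OF assms(1,2) _ assms(4,5,6)]) (use H in simp)
  show "conv_law_indep M T
              (\<lambda>\<epsilon> \<omega>. ((\<lambda>t. (B1 t \<omega>, B2 t \<omega>)), \<epsilon> powr (1/2 - 2*H) * G_breve B1 B2 T \<epsilon> \<omega>))
              (\<lambda>\<omega> t. (B1 t \<omega>, B2 t \<omega>))
              (gauss_law (T * sigma_breve_sq H))"
    unfolding conv_law_indep_def
  \<comment> \<open>One-sided limits are tested on sequences; the cap 1/2 provides
    \<open>e n \<le> 1\<close>.\<close>
  proof (intro allI impI tendsto_at_right_sequentially[where b = "1/2"])
    fix F and e :: "nat \<Rightarrow> real"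
    assume F: "bcont_CT_R T F" and e: "\<And>n. 0 < e n" "\<And>n. e n < 1/2" and e0: "e \<longlonglongrightarrow> 0"
    have sq: "(e n powr (1/2 - 2*H))\<^sup>2 = e n powr (1 - 4*H)" for n
      by (simp add: power2_eq_square powr_add[symmetric])
    show "(\<lambda>n. \<integral>\<omega>. F ((\<lambda>t. (B1 t \<omega>, B2 t \<omega>)), e n powr (1/2 - 2*H) * G_breve B1 B2 T (e n) \<omega>) \<partial>M)
       \<longlonglongrightarrow> (\<integral>\<omega>. \<integral>x. F (\<lambda>t. (B1 t \<omega>, B2 t \<omega>), x) \<partial>gauss_law (T * sigma_breve_sq H) \<partial>M)"
    \<comment> \<open>The power \<open>4*H - 1\<close> is negative, so replacing the maximum by
      \<open>e n\<close> only increases it, and the product with \<open>e n powr (1 - 4*H)\<close>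
      is at most 1.\<close>
    proof (rule convergence_along_sequence[OF e(1) _ e0 _ _ _ _ F, where C = 1])
      show "e n \<le> 1" for n using e(2)[of n] by simp
      show "(\<lambda>n. e n powr (1/2 - 2*H)) \<longlonglongrightarrow> 0"
        using tendsto_powr'[OF e0 tendsto_const[of "1/2 - 2*H"]] H e(1) by (auto simp: less_imp_le)
      show "(e n powr (1/2 - 2*H))\<^sup>2 * max \<bar>h\<bar> (e n) powr (4*H - 1) \<le> 1" for n h
      proof -
        have "max \<bar>h\<bar> (e n) powr (4*H - 1) \<le> e n powr (4*H - 1)" using H e(1)[of n] by (intro powr_mono2') auto
        then have "e n powr (1 - 4*H) * max \<bar>h\<bar> (e n) powr (4*H - 1) \<le> e n powr (1 - 4*H) * e n powr (4*H - 1)"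
          by (intro mult_left_mono) auto
        also have "\<dots> = 1" using e(1)[of n] by (simp add: powr_add[symmetric])
        finally show ?thesis unfolding sq .
      qed
      show "(\<lambda>n. (e n powr (1/2 - 2*H))\<^sup>2 * (- mean_form H T (e n) / 2)) \<longlonglongrightarrow> T * sigma_breve_sq H"
        unfolding sq by (rule mean_form_limit_subcritical[OF assms(2) H assms(1) e(1) e0])
    qed simp
  qed simp
next
  assume H: "H = 1/4"
  interpret fbm_pair M B1 B2 H T by (rule fbm_pair.intro[OF assms(1,2) _ assms(4,5,6)]) (use H in simp)
  show "conv_law_indep M T
              (\<lambda>\<epsilon> \<omega>. ((\<lambda>t. (B1 t \<omega>, B2 t \<omega>)), G_breve B1 B2 T \<epsilon> \<omega> / sqrt (ln (1 / \<epsilon>))))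
              (\<lambda>\<omega> t. (B1 t \<omega>, B2 t \<omega>))
              (gauss_law (T / 8))"
    unfolding conv_law_indep_def
  \<comment> \<open>Here the cap 1/2 also keeps \<open>ln (1 / e n)\<close> at least
    \<open>ln 2\<close>, so the normalization is defined and bounded.\<close>
  proof (intro allI impI tendsto_at_right_sequentially[where b = "1/2"])
    fix F and e :: "nat \<Rightarrow> real"
    assume F: "bcont_CT_R T F" and e: "\<And>n. 0 < e n" "\<And>n. e n < 1/2" and e0: "e \<longlonglongrightarrow> 0"
    have L2: "ln (1 / e n) \<ge> ln 2" for n
    proof -
      have "2 \<le> 1 / e n" using e(1)[of n] e(2)[of n] by (simp add: field_simps)
      then show ?thesis using e(1)[of n] by (subst ln_le_cancel_iff) auto
    qed
    have ln2: "ln (2::real) > 0" by simp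
    have L0: "ln (1 / e n) > 0" for n using L2[of n] ln2 by linarith
    have Linf: "filterlim (\<lambda>n. ln (1 / e n)) at_top sequentially"
    proof -
      have "filterlim (\<lambda>n. inverse (e n)) at_top sequentially" using e e0 by (intro filterlim_inverse_at_top) auto
      from filterlim_compose[OF ln_at_top this] show ?thesis by (simp add: inverse_eq_divide)
    qed
    have sq: "(1 / sqrt (ln (1 / e n)))\<^sup>2 = 1 / ln (1 / e n)" for n using L0[of n] by (simp add: power_divide)
    have "(\<lambda>n. \<integral>\<omega>. F ((\<lambda>t. (B1 t \<omega>, B2 t \<omega>)), 1 / sqrt (ln (1 / e n)) * G_breve B1 B2 T (e n) \<omega>) \<partial>M)
       \<longlonglongrightarrow> (\<integral>\<omega>. \<integral>x. F (\<lambda>t. (B1 t \<omega>, B2 t \<omega>), x) \<partial>gauss_law (T / 8) \<partial>M)"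
    \<comment> \<open>At \<open>H = 1/4\<close> the power \<open>4*H - 1\<close> is 0 and its base
      positive, so the bound is that of \<open>1 / ln (1 / e n)\<close> alone.\<close>
    proof (rule convergence_along_sequence[OF e(1) _ e0 _ _ _ _ F, where C = "1 / ln 2"])
      show "e n \<le> 1" for n using e(2)[of n] by simp
      show "0 \<le> 1 / sqrt (ln (1 / e n))" for n using L0[of n] by simp
      have "filterlim (\<lambda>n. sqrt (ln (1 / e n))) at_top sequentially"
        by (rule filterlim_compose[OF sqrt_at_top Linf])
      then show "(\<lambda>n. 1 / sqrt (ln (1 / e n))) \<longlonglongrightarrow> 0"
        by (intro tendsto_divide_0[OF tendsto_const] filterlim_at_top_imp_at_infinity)
      show "(1 / sqrt (ln (1 / e n)))\<^sup>2 * max \<bar>h\<bar> (e n) powr (4*H - 1) \<le> 1 / ln 2" for n h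
      proof -
        have "max \<bar>h\<bar> (e n) powr (4*H - 1) = 1" using e(1)[of n] by (simp add: H)
        moreover have "1 / ln (1 / e n) \<le> 1 / ln 2" using L2[of n] ln2 by (intro divide_left_mono mult_pos_pos L0) auto
        ultimately show ?thesis unfolding sq by simp
      qed
      show "(\<lambda>n. (1 / sqrt (ln (1 / e n)))\<^sup>2 * (- mean_form H T (e n) / 2)) \<longlonglongrightarrow> T / 8"
        unfolding sq H by (rule mean_form_limit_critical[OF assms(1) e(1) e0])
    qed
    then show "(\<lambda>n. \<integral>\<omega>. F ((\<lambda>t. (B1 t \<omega>, B2 t \<omega>)), G_breve B1 B2 T (e n) \<omega> / sqrt (ln (1 / e n))) \<partial>M)
       \<longlonglongrightarrow> (\<integral>\<omega>. \<integral>x. F (\<lambda>t. (B1 t \<omega>, B2 t \<omega>), x) \<partial>gauss_law (T / 8) \<partial>M)"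
      by simp
  qed simp
qed

end
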